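(* Let $f\colon D_1\to D_2$ be a quasi-isometry between hyperbolic digraphs $D_1$ and $D_2$ that satisfy (B1) and (B2). Then the following hold. (i) If every vertex of $D_1$ and $D_2$ has finite out-degree, then $f$ canonically defines an order-preserving bijective map between the geodesic f-boundaries of the digraphs. (ii) If every vertex of $D_1$ and $D_2$ has finite in-degree, then $f$ canonically defines an order-preserving bijective map between the geodesic b-boundaries of the digraphs. (iii) If $D_1$ and $D_2$ are locally finite, then $f$ canonically defines an order-preserving bijective map between the geodesic boundaries of the digraphs.
   Context: Digraphs may have loops, parallel edges and oppositely oriented edges. A directed path in $D$ is a sequence $x_0\ldots x_n$ of vertices with every $x_ix_{i+1}$ an edge; its length $\ell$ is $n$. $d(x,y)$ is the length of a shortest directed path from $x$ to $y$, or $\infty$ if there is none. $D$ is regarded as the semimetric space $(V(D),d)$ with these directed paths; a directed path from $x$ to $y$ is a geodesic if its length is $d(x,y)$. The out-degree (in-degree) of $x$ is the number of $y$ with $d(x,y)=1$ ($d(y,x)=1$); $D$ is locally finite if all in- and out-degrees are finite. $\mathcal B^+_r(x)=\{y: d(x,y)\le r\}$, $\mathcal B^-_r(x)=\{y:d(y,x)\le r\}$, and $\mathcal B^\pm_r(Y)=\bigcup_{y\in Y}\mathcal B^\pm_r(y)$. A geodesic triangle consists of three points and three geodesics (its sides), one between every two of these points (in one of the two directions). It is $\delta$-thin if for every labelling $P,Q,R$ of its sides such that the starting point of $P$ is the starting or the end point of $Q$ and the end point of $P$ is the starting or the end point of $R$, we have $P\subseteq\mathcal B^+_\delta(Q)\cup\mathcal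 B^-_\delta(R)$. $D$ is hyperbolic if for some $\delta\ge0$ all geodesic triangles are $\delta$-thin. (B1): there is $h\colon\mathbb R\to\mathbb R$ such that for all $x$, $r\ge0$ and $y,z\in\mathcal B^+_r(x)$, $d(y,z)$ is either $\infty$ or at most $h(r)$. (B2): the same with $\mathcal B^-_r(x)$ in place of $\mathcal B^+_r(x)$. A ray is a sequence $x_0x_1\ldots$ of distinct vertices with edges $x_ix_{i+1}$; an anti-ray is such a sequence with edges $x_{i+1}x_i$. A directed path $P$ is a $(\gamma,c)$-quasi-geodesic if $\ell(uPv)\le\gamma d(u,v)+c$ for every directed subpath $uPv$ of $P$. A (anti-)ray is geodesic (quasi-geodesic) if all its finite directed subpaths are geodesics (are $(\gamma,c)$-quasi-geodesics for fixed constants $\gamma\ge1,c\ge0$). For quasi-geodesic rays or anti-rays $R_1,R_2$ write $R_1\le R_2$ if there is $M\ge0$ such that for every $r\ge0$ and every $x$ there is a directed path from $R_1$ to $R_2$ of length at most $M$ outside of $\mathcal B^+_r(x)\cup\mathcal B^-_r(x)$; $R_1\approx R_2$ means $R_1\le R_2\le R_1$. Under the hypotheses $\le$ is a quasiorder and $\approx$ an equivalence relation. The geodesic boundary (f-boundary, b-boundary) is the set of classes of $\approx$ restricted to geodesic rays and anti-rays (geodesic rays, geodesic anti-rays), ordered by the order induced by $\le$. The quasi-geodesic boundary (f-boundary, b-boundary) is defined likewise with quasi-geodesic (anti-)rays. A map $f\colon D_1\to D_2$ (on vertex sets) is a quasi-isometry if for some $\gamma\ge1,c\ge0$: $\gamma^{-1}d(x,x')-c\le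 d(f(x),f(x'))\le\gamma d(x,x')+c$ for all $x,x'\in V(D_1)$, and for every $y\in V(D_2)$ there is $x\in V(D_1)$ with $d(f(x),y)\le c$ and $d(y,f(x))\le c$. "Canonically defines" means: the class of a geodesic ray (anti-ray) $R$ in $D_1$ is mapped to the class of those geodesic rays and anti-rays (of the type considered) in $D_2$ that are $\approx$-equivalent to a quasi-geodesic ray (anti-ray) $Q$ following $f(R)$, i.e. for which there is $K\ge0$ with $f(R)\subseteq\mathcal B^+_K(Q)\cap\mathcal B^-_K(Q)$ and $Q\subseteq\mathcal B^+_K(f(R))\cap\mathcal B^-_K(f(R))$. *)

theory Defs
  imports
    Complex_Main
    "HOL-Library.Extended_Real"
    "HOL-Library.Multiset"
    "HOL-Library.Sublist"
    "Graph_Theory.Vertex_Walk"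
begin

text \<open>
  A digraph is a \<open>wf_digraph\<close> (loops, parallel arcs and infinitely many vertices are allowed).
  A directed path is a \<open>vwalk\<close>: a nonempty list of vertices, possibly with repetitions, in which
  consecutive vertices are joined by an arc.  Its length is \<open>vwalk_length\<close>, one less than the
  length of the list.
\<close>

section \<open>Distance, balls and degrees\<close>

text \<open>The infimum of the empty set is \<open>\<infinity>\<close>, the distance when there is no directed path.\<close>

definition ddist :: "('a, 'b) pre_digraph \<Rightarrow> 'a \<Rightarrow> 'a \<Rightarrow> ereal" where
  "ddist D x y = (INF p\<in>{p. vwalk p D \<and> hd p = x \<and> last p = y}. ereal (real (vwalk_length p)))"

definition out_ball :: "('a, 'b) pre_digraph \<Rightarrow> real \<Rightarrow> 'a \<Rightarrow> 'a set" where
  "out_ball D r x = {y \<in> verts D. ddist D x y \<le> ereal r}"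

definition in_ball :: "('a, 'b) pre_digraph \<Rightarrow> real \<Rightarrow> 'a \<Rightarrow> 'a set" where
  "in_ball D r x = {y \<in> verts D. ddist D y x \<le> ereal r}"

definition out_nbhd :: "('a, 'b) pre_digraph \<Rightarrow> real \<Rightarrow> 'a set \<Rightarrow> 'a set" where
  "out_nbhd D r Y = (\<Union>y\<in>Y. out_ball D r y)"

definition in_nbhd :: "('a, 'b) pre_digraph \<Rightarrow> real \<Rightarrow> 'a set \<Rightarrow> 'a set" where
  "in_nbhd D r Y = (\<Union>y\<in>Y. in_ball D r y)"

text \<open>Degrees count vertices at distance 1, so loops and multiplicities of arcs do not matter.\<close>

definition finite_out_degrees :: "('a, 'b) pre_digraph \<Rightarrow> bool" where
  "finite_out_degrees D \<longleftrightarrow> (\<forall>x\<in>verts D. finite {y \<in> verts D. ddist D x y = 1})"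

definition finite_in_degrees :: "('a, 'b) pre_digraph \<Rightarrow> bool" where
  "finite_in_degrees D \<longleftrightarrow> (\<forall>x\<in>verts D. finite {y \<in> verts D. ddist D y x = 1})"

definition locally_finite_digraph :: "('a, 'b) pre_digraph \<Rightarrow> bool" where
  "locally_finite_digraph D \<longleftrightarrow> finite_out_degrees D \<and> finite_in_degrees D"

definition B1 :: "('a, 'b) pre_digraph \<Rightarrow> bool" where
  "B1 D \<longleftrightarrow> (\<exists>h :: real \<Rightarrow> real. \<forall>x\<in>verts D. \<forall>r\<ge>0. \<forall>y\<in>out_ball D r x. \<forall>z\<in>out_ball D r x.
     ddist D y z = \<infinity> \<or> ddist D y z \<le> ereal (h r))"

definition B2 :: "('a, 'b) pre_digraph \<Rightarrow> bool" where
  "B2 D \<longleftrightarrow> (\<exists>h :: real \<Rightarrow> real. \<forall>x\<in>verts D. \<forall>r\<ge>0. \<forall>y\<in>in_ball D r x. \<forall>z\<in>in_ball D r x.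
     ddist D y z = \<infinity> \<or> ddist D y z \<le> ereal (h r))"

section \<open>Geodesics and hyperbolicity\<close>

definition geodesic :: "('a, 'b) pre_digraph \<Rightarrow> 'a list \<Rightarrow> bool" where
  "geodesic D p \<longleftrightarrow> vwalk p D \<and> ereal (real (vwalk_length p)) = ddist D (hd p) (last p)"

definition quasi_geodesic :: "('a, 'b) pre_digraph \<Rightarrow> real \<Rightarrow> real \<Rightarrow> 'a list \<Rightarrow> bool" where
  "quasi_geodesic D \<gamma> c p \<longleftrightarrow> vwalk p D \<and>
     (\<forall>q. q \<noteq> [] \<and> sublist q p \<longrightarrow>
        ereal (real (vwalk_length q)) \<le> ereal \<gamma> * ddist D (hd q) (last q) + ereal c)"

definition geodesic_side :: "('a, 'b) pre_digraph \<Rightarrow> 'a \<Rightarrow> 'a \<Rightarrow> 'a list \<Rightarrow> bool" where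
  "geodesic_side D x y p \<longleftrightarrow>
     geodesic D p \<and> (hd p = x \<and> last p = y \<or> hd p = y \<and> last p = x)"

definition geodesic_triangle ::
  "('a, 'b) pre_digraph \<Rightarrow> 'a list \<Rightarrow> 'a list \<Rightarrow> 'a list \<Rightarrow> bool" where
  "geodesic_triangle D p1 p2 p3 \<longleftrightarrow>
     (\<exists>x\<in>verts D. \<exists>y\<in>verts D. \<exists>z\<in>verts D.
        geodesic_side D x y p1 \<and> geodesic_side D y z p2 \<and> geodesic_side D z x p3)"

text \<open>The multiset equation says that \<open>P, Q, R\<close> is a labelling of the three sides.\<close>

definition thin_triangle ::
  "('a, 'b) pre_digraph \<Rightarrow> real \<Rightarrow> 'a list \<Rightarrow> 'a list \<Rightarrow> 'a list \<Rightarrow> bool" where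
  "thin_triangle D \<delta> p1 p2 p3 \<longleftrightarrow>
     (\<forall>P Q R. {#P, Q, R#} = {#p1, p2, p3#} \<and> hd P \<in> {hd Q, last Q} \<and> last P \<in> {hd R, last R} \<longrightarrow>
        set P \<subseteq> out_nbhd D \<delta> (set Q) \<union> in_nbhd D \<delta> (set R))"

definition hyperbolic :: "('a, 'b) pre_digraph \<Rightarrow> bool" where
  "hyperbolic D \<longleftrightarrow>
     (\<exists>\<delta>\<ge>0. \<forall>p1 p2 p3. geodesic_triangle D p1 p2 p3 \<longrightarrow> thin_triangle D \<delta> p1 p2 p3)"

section \<open>Rays and anti-rays\<close>

definition is_ray :: "('a, 'b) pre_digraph \<Rightarrow> (nat \<Rightarrow> 'a) \<Rightarrow> bool" where
  "is_ray D R \<longleftrightarrow> inj R \<and> (\<forall>i. (R i, R (Suc i)) \<in> arcs_ends D)"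

definition is_antiray :: "('a, 'b) pre_digraph \<Rightarrow> (nat \<Rightarrow> 'a) \<Rightarrow> bool" where
  "is_antiray D R \<longleftrightarrow> inj R \<and> (\<forall>i. (R (Suc i), R i) \<in> arcs_ends D)"

text \<open>
  The finite directed subpaths of a ray are the segments \<open>R i, \<dots>, R j\<close>; those of an anti-ray
  are traversed in the opposite direction \<open>R j, \<dots>, R i\<close>.
\<close>

definition ray_segment :: "(nat \<Rightarrow> 'a) \<Rightarrow> nat \<Rightarrow> nat \<Rightarrow> 'a list" where
  "ray_segment R i j = map R [i..<Suc j]"

definition geodesic_rays :: "('a, 'b) pre_digraph \<Rightarrow> (nat \<Rightarrow> 'a) set" where
  "geodesic_rays D = {R. is_ray D R \<and> (\<forall>i j. i \<le> j \<longrightarrow> geodesic D (ray_segment R i j))}"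

definition geodesic_antirays :: "('a, 'b) pre_digraph \<Rightarrow> (nat \<Rightarrow> 'a) set" where
  "geodesic_antirays D =
     {R. is_antiray D R \<and> (\<forall>i j. i \<le> j \<longrightarrow> geodesic D (rev (ray_segment R i j)))}"

definition quasi_geodesic_rays :: "('a, 'b) pre_digraph \<Rightarrow> (nat \<Rightarrow> 'a) set" where
  "quasi_geodesic_rays D =
     {R. is_ray D R \<and>
         (\<exists>\<gamma>\<ge>1. \<exists>c\<ge>0. \<forall>i j. i \<le> j \<longrightarrow> quasi_geodesic D \<gamma> c (ray_segment R i j))}"

definition quasi_geodesic_antirays :: "('a, 'b) pre_digraph \<Rightarrow> (nat \<Rightarrow> 'a) set" where
  "quasi_geodesic_antirays D =
     {R. is_antiray D R \<and>
         (\<exists>\<gamma>\<ge>1. \<exists>c\<ge>0. \<forall>i j. i \<le> j \<longrightarrow> quasi_geodesic D \<gamma> c (rev (ray_segment R i j)))}"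

definition ray_le :: "('a, 'b) pre_digraph \<Rightarrow> (nat \<Rightarrow> 'a) \<Rightarrow> (nat \<Rightarrow> 'a) \<Rightarrow> bool" where
  "ray_le D R1 R2 \<longleftrightarrow>
     (\<exists>M::real. M \<ge> 0 \<and> (\<forall>r\<ge>0. \<forall>x\<in>verts D. \<exists>p. vwalk p D \<and> hd p \<in> range R1 \<and> last p \<in> range R2 \<and>
        real (vwalk_length p) \<le> M \<and> set p \<inter> (out_ball D r x \<union> in_ball D r x) = {}))"

definition ray_equiv :: "('a, 'b) pre_digraph \<Rightarrow> (nat \<Rightarrow> 'a) \<Rightarrow> (nat \<Rightarrow> 'a) \<Rightarrow> bool" where
  "ray_equiv D R1 R2 \<longleftrightarrow> ray_le D R1 R2 \<and> ray_le D R2 R1"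

section \<open>Boundaries\<close>

text \<open>
  The set \<open>G\<close> consists of the rays and anti-rays of the type considered.  As \<open>ray_le\<close> depends only on
  the vertices of its arguments, a sequence that is both a ray and an anti-ray may be treated
  as a single element of \<open>G\<close>.
\<close>

definition equiv_on :: "('a, 'b) pre_digraph \<Rightarrow> (nat \<Rightarrow> 'a) set \<Rightarrow> (nat \<Rightarrow> 'a) rel" where
  "equiv_on D G = {(R, S). R \<in> G \<and> S \<in> G \<and> ray_equiv D R S}"

definition boundary_of :: "('a, 'b) pre_digraph \<Rightarrow> (nat \<Rightarrow> 'a) set \<Rightarrow> (nat \<Rightarrow> 'a) set set" where
  "boundary_of D G = G // equiv_on D G"

definition boundary_le ::
  "('a, 'b) pre_digraph \<Rightarrow> (nat \<Rightarrow> 'a) set \<Rightarrow> (nat \<Rightarrow> 'a) set \<Rightarrow> bool" where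
  "boundary_le D \<xi> \<eta> \<longleftrightarrow> (\<exists>R\<in>\<xi>. \<exists>S\<in>\<eta>. ray_le D R S)"

abbreviation geodesic_f_boundary :: "('a, 'b) pre_digraph \<Rightarrow> (nat \<Rightarrow> 'a) set set" where
  "geodesic_f_boundary D \<equiv> boundary_of D (geodesic_rays D)"

abbreviation geodesic_b_boundary :: "('a, 'b) pre_digraph \<Rightarrow> (nat \<Rightarrow> 'a) set set" where
  "geodesic_b_boundary D \<equiv> boundary_of D (geodesic_antirays D)"

abbreviation geodesic_boundary :: "('a, 'b) pre_digraph \<Rightarrow> (nat \<Rightarrow> 'a) set set" where
  "geodesic_boundary D \<equiv> boundary_of D (geodesic_rays D \<union> geodesic_antirays D)"

section \<open>Quasi-isometries and the maps they define\<close>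

definition quasi_isometry ::
  "('a, 'b) pre_digraph \<Rightarrow> ('c, 'd) pre_digraph \<Rightarrow> ('a \<Rightarrow> 'c) \<Rightarrow> bool" where
  "quasi_isometry D1 D2 f \<longleftrightarrow> f ` verts D1 \<subseteq> verts D2 \<and>
     (\<exists>\<gamma>\<ge>1. \<exists>c\<ge>0.
        (\<forall>x\<in>verts D1. \<forall>x'\<in>verts D1.
           ereal (inverse \<gamma>) * ddist D1 x x' - ereal c \<le> ddist D2 (f x) (f x') \<and>
           ddist D2 (f x) (f x') \<le> ereal \<gamma> * ddist D1 x x' + ereal c) \<and>
        (\<forall>y\<in>verts D2. \<exists>x\<in>verts D1. ddist D2 (f x) y \<le> ereal c \<and> ddist D2 y (f x) \<le> ereal c))"

definition follows :: "('a, 'b) pre_digraph \<Rightarrow> (nat \<Rightarrow> 'a) \<Rightarrow> 'a set \<Rightarrow> bool" where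
  "follows D Q X \<longleftrightarrow>
     (\<exists>K\<ge>0. X \<subseteq> out_nbhd D K (range Q) \<inter> in_nbhd D K (range Q) \<and>
            range Q \<subseteq> out_nbhd D K X \<inter> in_nbhd D K X)"

text \<open>
  \<open>\<Phi>\<close> maps the class in \<open>boundary_of D1 G1\<close> of every \<open>R \<in> A\<close> to the class in \<open>boundary_of D2 G2\<close>
  determined by the members \<open>Q\<close> of \<open>Qs\<close> that follow \<open>f(R)\<close>.  Such \<open>Q\<close> must exist, and all choices
  of \<open>R\<close> and \<open>Q\<close> must give the same value.  The sets \<open>A\<close> and \<open>Qs\<close> are the geodesic rays of \<open>D1\<close> and the
  quasi-geodesic rays of \<open>D2\<close>, or the respective anti-rays.
\<close>

definition canonical_on ::
  "('a, 'b) pre_digraph \<Rightarrow> ('c, 'd) pre_digraph \<Rightarrow> ('a \<Rightarrow> 'c) \<Rightarrow>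
   (nat \<Rightarrow> 'a) set \<Rightarrow> (nat \<Rightarrow> 'a) set \<Rightarrow> (nat \<Rightarrow> 'c) set \<Rightarrow> (nat \<Rightarrow> 'c) set \<Rightarrow>
   ((nat \<Rightarrow> 'a) set \<Rightarrow> (nat \<Rightarrow> 'c) set) \<Rightarrow> bool" where
  "canonical_on D1 D2 f A G1 Qs G2 \<Phi> \<longleftrightarrow>
     (\<forall>R\<in>A. (\<exists>Q\<in>Qs. follows D2 Q (f ` range R)) \<and>
            (\<forall>Q\<in>Qs. follows D2 Q (f ` range R) \<longrightarrow>
               \<Phi> (equiv_on D1 G1 `` {R}) = {S \<in> G2. ray_equiv D2 S Q}))"

abbreviation canonical_f ::
  "('a, 'b) pre_digraph \<Rightarrow> ('c, 'd) pre_digraph \<Rightarrow> ('a \<Rightarrow> 'c) \<Rightarrow>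
   ((nat \<Rightarrow> 'a) set \<Rightarrow> (nat \<Rightarrow> 'c) set) \<Rightarrow> bool" where
  "canonical_f D1 D2 f \<Phi> \<equiv>
     canonical_on D1 D2 f (geodesic_rays D1) (geodesic_rays D1)
       (quasi_geodesic_rays D2) (geodesic_rays D2) \<Phi>"

abbreviation canonical_b ::
  "('a, 'b) pre_digraph \<Rightarrow> ('c, 'd) pre_digraph \<Rightarrow> ('a \<Rightarrow> 'c) \<Rightarrow>
   ((nat \<Rightarrow> 'a) set \<Rightarrow> (nat \<Rightarrow> 'c) set) \<Rightarrow> bool" where
  "canonical_b D1 D2 f \<Phi> \<equiv>
     canonical_on D1 D2 f (geodesic_antirays D1) (geodesic_antirays D1)
       (quasi_geodesic_antirays D2) (geodesic_antirays D2) \<Phi>"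

abbreviation canonical_fb ::
  "('a, 'b) pre_digraph \<Rightarrow> ('c, 'd) pre_digraph \<Rightarrow> ('a \<Rightarrow> 'c) \<Rightarrow>
   ((nat \<Rightarrow> 'a) set \<Rightarrow> (nat \<Rightarrow> 'c) set) \<Rightarrow> bool" where
  "canonical_fb D1 D2 f \<Phi> \<equiv>
     canonical_on D1 D2 f (geodesic_rays D1) (geodesic_rays D1 \<union> geodesic_antirays D1)
       (quasi_geodesic_rays D2) (geodesic_rays D2 \<union> geodesic_antirays D2) \<Phi> \<and>
     canonical_on D1 D2 f (geodesic_antirays D1) (geodesic_rays D1 \<union> geodesic_antirays D1)
       (quasi_geodesic_antirays D2) (geodesic_rays D2 \<union> geodesic_antirays D2) \<Phi>"

end

theory Submission
  imports Defs
begin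

text \<open>
  The distance of a digraph is not symmetric, and whether one vertex reaches another matters as much
  as the distance itself.  The proof therefore works with the relations ``\<open>y\<close> can be reached from
  \<open>x\<close> in at most \<open>n\<close> steps''.  They satisfy a short list of axioms (\<open>hyperbolic_space\<close>) that is
  invariant under reversing all arcs, so that every statement about rays has a twin about anti-rays.

  The heart of the matter is the stability of quasi-geodesics (\<open>geodesic_stability\<close>).  For a geodesic
  triangle, thinness only says that a point of a side is reached from one of the other sides \<^emph>\<open>or\<close>
  reaches the other one, so iterating it produces zigzags instead of directed paths.  Three facts
  repair this.  Counting along thin triangles turns the arbitrary bounds of (B1) and (B2) into
  linear ones (\<open>linear_bound_out\<close>).  A point that is reached from a geodesic within a bounded distance
  and reaches its end also returns to the geodesic within a bounded distance
  (\<open>return_to_geodesic\<close>).  And if \<open>m\<close> is an intermediate stop between \<open>a\<close> and \<open>b\<close>, then every point of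
  a geodesic from \<open>a\<close> to \<open>b\<close> \<^emph>\<open>reaches\<close> a geodesic from \<open>a\<close> to \<open>m\<close> or one from \<open>m\<close> to \<open>b\<close> within a bounded
  distance (\<open>forward_thin\<close>).  Bisecting a walk of length \<open>n\<close> then shows that geodesics between its ends
  reach it within \<open>O(log n)\<close> steps, and the usual detour argument, in which all lengths are linear in the
  largest distance from the geodesic to the quasi-geodesic, bounds that distance.

  Local finiteness is used for a compactness argument: the geodesics from the start of a
  quasi-geodesic ray to its points have a limit, which is a geodesic ray close to the given one
  (\<open>quasi_ray_fellow_travel_georay\<close>).

  For the order, only two things matter about a ray or anti-ray: it leaves every ball, and it stays
  close to a geodesic one.  Leaving balls turns \<open>ray_le\<close> into a condition that is easy to transport
  along quasi-isometries: infinitely many points of the first sequence reach the second one within a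
  fixed distance (\<open>ray_le_iff_leads\<close>).  Thin triangles show that for geodesic (anti-)rays then all but
  finitely many points do, whence transitivity (\<open>leads_trans\<close>).  Composing with the quasi-isometry
  and with a quasi-inverse maps coarsely geodesic sequences to such sequences, preserves and
  reflects the order, and is onto up to equivalence.  The bijection between the boundaries follows by
  pure order theory (\<open>boundary_map_of_order_embedding\<close>).
\<close>

section \<open>Directed metrics given by step bounds\<close>

text \<open>
  Think of \<open>dle n x y\<close> as \<open>d(x, y) \<le> n\<close>.  Using this relation instead of a distance function avoids
  infinite values.  The space has no separate carrier: its points are the \<open>x\<close> with \<open>dle 0 x x\<close>.  The last
  axiom says that distances are realised by paths with integer steps.
\<close>

locale path_metric =
  fixes dle :: "nat \<Rightarrow> 'a \<Rightarrow> 'a \<Rightarrow> bool"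
  assumes dle_refl: "dle n x y \<Longrightarrow> dle 0 x x \<and> dle 0 y y"
    and dle_0: "dle 0 x y \<Longrightarrow> x = y"
    and dle_mono: "dle m x y \<Longrightarrow> m \<le> n \<Longrightarrow> dle n x y"
    and dle_trans: "dle m x y \<Longrightarrow> dle n y z \<Longrightarrow> dle (m + n) x z"
    and dle_split: "dle (m + n) x z \<Longrightarrow> \<exists>y. dle m x y \<and> dle n y z"
begin

definition reach :: "'a \<Rightarrow> 'a \<Rightarrow> bool" where
  "reach x y \<longleftrightarrow> (\<exists>n. dle n x y)"

text \<open>
  This value is meaningful only if \<open>y\<close> can be reached from \<open>x\<close>.
\<close>

definition dst :: "'a \<Rightarrow> 'a \<Rightarrow> nat" where
  "dst x y = (LEAST n. dle n x y)"

definition between :: "'a \<Rightarrow> 'a \<Rightarrow> 'a \<Rightarrow> bool" where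
  "between x w y \<longleftrightarrow> reach x w \<and> reach w y \<and> dst x w + dst w y = dst x y"

definition geo :: "(nat \<Rightarrow> 'a) \<Rightarrow> nat \<Rightarrow> bool" where
  "geo P n \<longleftrightarrow> (\<forall>i j. i \<le> j \<and> j \<le> n \<longrightarrow> reach (P i) (P j) \<and> dst (P i) (P j) = j - i)"

text \<open>
  A geodesic regarded as a set of points has the same description in the reversed space with its two
  ends exchanged, which a parametrised geodesic does not.
\<close>

definition geodesic_set :: "'a set \<Rightarrow> 'a \<Rightarrow> 'a \<Rightarrow> bool" where
  "geodesic_set G x y \<longleftrightarrow> (\<exists>P n. geo P n \<and> P 0 = x \<and> P n = y \<and> G = P ` {..n})"

lemma reachI: "dle n x y \<Longrightarrow> reach x y"
  unfolding reach_def by blast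

lemma dle_dst: "reach x y \<Longrightarrow> dle (dst x y) x y"
  unfolding reach_def dst_def by (metis LeastI)

lemma dst_le: "dle n x y \<Longrightarrow> dst x y \<le> n"
  unfolding dst_def by (rule Least_le)

lemma dle_iff: "dle n x y \<longleftrightarrow> reach x y \<and> dst x y \<le> n"
  using dle_dst dst_le dle_mono reachI by blast

lemma reach_trans: "reach x y \<Longrightarrow> reach y z \<Longrightarrow> reach x z"
  unfolding reach_def using dle_trans by blast

lemma dst_triangle: "reach x y \<Longrightarrow> reach y z \<Longrightarrow> dst x z \<le> dst x y + dst y z"
  using dle_trans dle_dst dst_le by blast

lemma reach_refl: "reach x y \<Longrightarrow> reach x x" "reach x y \<Longrightarrow> reach y y"
  unfolding reach_def using dle_refl by blast+

lemma dst_self: "reach x x \<Longrightarrow> dst x x = 0"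
  using dle_refl dst_le unfolding reach_def by blast

lemma dst_0: "reach x y \<Longrightarrow> dst x y = 0 \<Longrightarrow> x = y"
  using dle_dst dle_0 by metis

lemma between_reach: "between x w y \<Longrightarrow> reach x w" "between x w y \<Longrightarrow> reach w y"
  "between x w y \<Longrightarrow> reach x y"
  unfolding between_def using reach_trans by blast+

lemma between_dst: "between x w y \<Longrightarrow> dst x w + dst w y = dst x y"
  unfolding between_def by blast

lemma between_dle:
  assumes "between x w y" and "dle n x y"
  shows "dle n x w" "dle n w y"
proof -
  have "dst x w \<le> n" "dst w y \<le> n"
    using between_dst[OF assms(1)] dst_le[OF assms(2)] by linarith+
  then show "dle n x w" "dle n w y"
    using between_reach[OF assms(1)] by (simp_all add: dle_iff)
qed

lemma between_trans:
  assumes "between x w y" "between w u y"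
  shows "between x u y"
proof -
  have r: "reach x w" "reach w u" "reach u y" "reach x u"
    using between_reach[OF assms(1)] between_reach[OF assms(2)] reach_trans by blast+
  have "dst x y \<le> dst x u + dst u y" "dst x u \<le> dst x w + dst w u"
    using dst_triangle r by blast+
  then show ?thesis
    using between_dst[OF assms(1)] between_dst[OF assms(2)] r unfolding between_def by simp
qed

lemma geo_reach: "geo P n \<Longrightarrow> i \<le> j \<Longrightarrow> j \<le> n \<Longrightarrow> reach (P i) (P j)"
  unfolding geo_def by blast

lemma geo_dst: "geo P n \<Longrightarrow> i \<le> j \<Longrightarrow> j \<le> n \<Longrightarrow> dst (P i) (P j) = j - i"
  unfolding geo_def by blast

lemma geo_dle: "geo P n \<Longrightarrow> i \<le> j \<Longrightarrow> j \<le> n \<Longrightarrow> dle (j - i) (P i) (P j)"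
  using geo_reach geo_dst dle_iff by simp

lemma geo_between: "geo P n \<Longrightarrow> i \<le> j \<Longrightarrow> j \<le> k \<Longrightarrow> k \<le> n \<Longrightarrow> between (P i) (P j) (P k)"
  unfolding between_def geo_def by auto

lemma geo_shift: "geo P n \<Longrightarrow> i \<le> j \<Longrightarrow> j \<le> n \<Longrightarrow> geo (\<lambda>t. P (i + t)) (j - i)"
  unfolding geo_def by auto

lemma geodesic_setI: "geo P n \<Longrightarrow> geodesic_set (P ` {..n}) (P 0) (P n)"
  unfolding geodesic_set_def by blast

lemma geodesic_set_sub:
  assumes "geo P n" "i \<le> j" "j \<le> n"
  shows "geodesic_set (P ` {i..j}) (P i) (P j)"
proof -
  have "(\<lambda>t. P (i + t)) ` {..j - i} = P ` {i..j}"
  proof -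
    have "(\<lambda>t. i + t) ` {..j - i} = {i..j}"
    proof (intro equalityI subsetI)
      fix t assume "t \<in> {i..j}"
      then have "t = i + (t - i)" "t - i \<in> {..j - i}" by auto
      then show "t \<in> (\<lambda>t. i + t) ` {..j - i}" by blast
    qed (use assms in auto)
    then show ?thesis by (metis image_image)
  qed
  then show ?thesis using geodesic_setI[OF geo_shift[OF assms]] assms by simp
qed

lemma geodesic_set_between: "geodesic_set G x y \<Longrightarrow> u \<in> G \<Longrightarrow> between x u y"
  unfolding geodesic_set_def using geo_between by (metis atMost_iff imageE le0 order_refl)

lemma geodesic_set_card: "geodesic_set G x y \<Longrightarrow> finite G \<and> card G \<le> dst x y + 1"
  unfolding geodesic_set_def
  by (metis card_atMost card_image_le finite_atMost finite_imageI geo_dst le0 minus_nat.diff_0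
      order_refl Suc_eq_plus1)

text \<open>
  The path may stop at a vertex for some steps; this allows paths with a prescribed number of steps.
\<close>

lemma ex_lazy_path:
  "dle n x y \<Longrightarrow> \<exists>P. P 0 = x \<and> P n = y \<and> (\<forall>i<n. dle 1 (P i) (P (Suc i)))"
proof (induction n arbitrary: y)
  case 0
  then show ?case using dle_0 by (intro exI[of _ "\<lambda>_. x"]) auto
next
  case (Suc n)
  then obtain z where z: "dle n x z" "dle 1 z y"
    using dle_split[of n 1 x y] by auto
  from Suc.IH[OF z(1)] obtain P where P: "\<forall>i<n. dle 1 (P i) (P (Suc i))" "P 0 = x" "P n = z"
    by blast
  show ?case
    by (rule exI[of _ "P(Suc n := y)"]) (use P z less_Suc_eq in auto)
qed

lemma dle_steps:
  assumes "\<And>i. a \<le> i \<Longrightarrow> i < b \<Longrightarrow> dle 1 (P i) (P (Suc i))" "a \<le> i" "i < j" "j \<le> b"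
  shows "dle (j - i) (P i) (P j)"
  using assms(3,4)
proof (induction j)
  case (Suc j)
  show ?case
  proof (cases "i = j")
    case True
    then show ?thesis using assms(1)[of j] assms(2) Suc.prems by auto
  next
    case False
    then have "dle (j - i) (P i) (P j)" "dle 1 (P j) (P (Suc j))" "Suc j - i = j - i + 1"
      using Suc assms(1)[of j] assms(2) by auto
    then show ?thesis using dle_trans by metis
  qed
qed simp

lemma geoI:
  assumes w: "\<And>i j. i \<le> j \<Longrightarrow> j \<le> n \<Longrightarrow> dle (j - i) (P i) (P j)"
    and n: "n \<le> dst (P 0) (P n)"
  shows "geo P n"
proof -
  have "dst (P i) (P j) = j - i" if "i \<le> j" "j \<le> n" for i j
  proof -
    have r: "reach (P i) (P j)" using w that reachI by blast
    have "dle (i + dst (P i) (P j) + (n - j)) (P 0) (P n)"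
      using dle_trans[OF dle_trans[OF w[of 0 i] dle_dst[OF r]] w[of j n]] that by simp
    then have "n \<le> i + dst (P i) (P j) + (n - j)" using dst_le n order_trans by blast
    moreover have "dst (P i) (P j) \<le> j - i" using w that dst_le by blast
    ultimately show ?thesis using that by simp
  qed
  then show ?thesis unfolding geo_def using w reachI by blast
qed

lemma ex_geo:
  assumes r: "reach x y"
  shows "\<exists>P. geo P (dst x y) \<and> P 0 = x \<and> P (dst x y) = y"
proof -
  let ?n = "dst x y"
  obtain P where P: "P 0 = x" "P ?n = y" "\<And>i. i < ?n \<Longrightarrow> dle 1 (P i) (P (Suc i))"
    using ex_lazy_path[OF dle_dst[OF r]] by blast
  have "geo P ?n"
  proof (rule geoI)
    fix i j assume ij: "i \<le> j" "j \<le> ?n"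
    show "dle (j - i) (P i) (P j)"
    proof (cases "i < j")
      case True
      show ?thesis by (rule dle_steps[where P = P and a = 0 and b = ?n]) (use P(3) True ij in auto)
    next
      case False
      have "dle 0 (P j) (P j)"
      proof (cases "j = ?n")
        case True
        then show ?thesis using dle_refl dle_dst[OF r] P(2) by simp
      next
        case False
        then show ?thesis using dle_refl P(3)[of j] ij by simp
      qed
      then show ?thesis using False ij by simp
    qed
  qed (simp add: P(1,2))
  then show ?thesis using P by blast
qed

lemma ex_geodesic_set: "reach x y \<Longrightarrow> \<exists>G. geodesic_set G x y"
  using ex_geo geodesic_setI by metis

lemma between_geo:
  assumes "between x p y"
  obtains P n i where "geo P n" "P 0 = x" "P n = y" "P i = p" "i \<le> n"
proof -
  let ?k = "dst x p" and ?n = "dst x y"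
  obtain A where A: "geo A ?k" "A 0 = x" "A ?k = p"
    using ex_geo between_reach(1)[OF assms] by blast
  obtain B where B: "geo B (dst p y)" "B 0 = p" "B (dst p y) = y"
    using ex_geo between_reach(2)[OF assms] by blast
  have n: "?n = ?k + dst p y" using between_dst[OF assms] by simp
  define P where "P i = (if i \<le> ?k then A i else B (i - ?k))" for i
  have P: "P 0 = x" "P ?k = p" "P ?n = y"
    using A B n unfolding P_def by auto
  have w: "dle (j - i) (P i) (P j)" if "i \<le> j" "j \<le> ?n" for i j
  proof -
    consider "j \<le> ?k" | "i \<le> ?k" "?k < j" | "?k < i" by linarith
    then show ?thesis
    proof cases
      case 1
      then show ?thesis using geo_dle[OF A(1)] that unfolding P_def by auto
    next
      case 2
      have "dle (?k - i) (A i) p" using geo_dle[OF A(1), of i ?k] A 2 by auto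
      moreover have "dle (j - ?k) p (B (j - ?k))"
        using geo_dle[OF B(1), of 0 "j - ?k"] B n that by auto
      ultimately have "dle (?k - i + (j - ?k)) (A i) (B (j - ?k))" using dle_trans by blast
      then show ?thesis using 2 unfolding P_def by auto
    next
      case 3
      then show ?thesis using geo_dle[OF B(1), of "i - ?k" "j - ?k"] that n unfolding P_def by auto
    qed
  qed
  have "geo P ?n" by (rule geoI) (use w P in simp_all)
  then show thesis using that[OF _ P(1,3,2)] n by simp
qed

text \<open>
  Reversing all directions gives a space of the same kind.  All later results are transferred to
  in-distances and anti-rays in this way.
\<close>

lemma dual_path_metric: "path_metric (\<lambda>n x y. dle n y x)"
proof
  fix m n x z assume "dle (m + n) z x"
  then show "\<exists>y. dle m y x \<and> dle n z y"
    using dle_split[of n m z x] by (auto simp: add.commute)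
next
  fix m n x y z assume "dle m y x" "dle n z y"
  then show "dle (m + n) z x"
    using dle_trans[of n z y m x] by (simp add: add.commute)
qed (use dle_refl dle_0 dle_mono in blast)+

lemma dual_reach: "path_metric.reach (\<lambda>n x y. dle n y x) x y = reach y x"
  unfolding path_metric.reach_def[OF dual_path_metric] reach_def ..

lemma dual_dst: "path_metric.dst (\<lambda>n x y. dle n y x) x y = dst y x"
  unfolding path_metric.dst_def[OF dual_path_metric] dst_def ..

lemma dual_between: "path_metric.between (\<lambda>n x y. dle n y x) x w y = between y w x"
  unfolding path_metric.between_def[OF dual_path_metric] between_def dual_reach dual_dst by auto

lemma dual_geo: "path_metric.geo (\<lambda>n x y. dle n y x) P n = geo (\<lambda>i. P (n - i)) n"
proof
  assume d: "path_metric.geo (\<lambda>n x y. dle n y x) P n"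
  show "geo (\<lambda>i. P (n - i)) n" unfolding geo_def
  proof (intro allI impI)
    fix i j assume ij: "i \<le> j \<and> j \<le> n"
    then have "n - j \<le> n - i \<and> n - i \<le> n" by auto
    with d have "reach (P (n - i)) (P (n - j))" "dst (P (n - i)) (P (n - j)) = (n - i) - (n - j)"
      unfolding path_metric.geo_def[OF dual_path_metric] dual_reach dual_dst by blast+
    with ij show "reach (P (n - i)) (P (n - j)) \<and> dst (P (n - i)) (P (n - j)) = j - i"
      by auto
  qed
next
  assume g: "geo (\<lambda>i. P (n - i)) n"
  show "path_metric.geo (\<lambda>n x y. dle n y x) P n"
    unfolding path_metric.geo_def[OF dual_path_metric] dual_reach dual_dst
  proof (intro allI impI)
    fix i j assume ij: "i \<le> j \<and> j \<le> n"
    then have "n - j \<le> n - i \<and> n - i \<le> n" by auto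
    with g have "reach (P (n - (n - j))) (P (n - (n - i)))"
      "dst (P (n - (n - j))) (P (n - (n - i))) = (n - i) - (n - j)"
      unfolding geo_def by blast+
    with ij show "reach (P j) (P i) \<and> dst (P j) (P i) = j - i" by auto
  qed
qed

lemma dual_geodesic_set:
  "path_metric.geodesic_set (\<lambda>n x y. dle n y x) G x y = geodesic_set G y x"
proof -
  have im: "(\<lambda>i. P (n - i)) ` {..n} = P ` {..n::nat}" for P :: "nat \<Rightarrow> 'a" and n
  proof -
    have "(\<lambda>i. n - i) ` {..n} = {..n}"
    proof (intro equalityI subsetI)
      fix t assume "t \<in> {..n}"
      then have "t = n - (n - t)" "n - t \<in> {..n}" by auto
      then show "t \<in> (\<lambda>i. n - i) ` {..n}" by blast
    qed auto
    then show ?thesis by (metis image_image)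
  qed
  have rr: "geo (\<lambda>i. P (n - (n - i))) n = geo P n" for P n
    unfolding geo_def by auto
  show ?thesis
    unfolding path_metric.geodesic_set_def[OF dual_path_metric] geodesic_set_def dual_geo
  proof (intro iffI; elim exE conjE)
    fix P n assume "geo (\<lambda>i. P (n - i)) n" "P 0 = x" "P n = y" "G = P ` {..n}"
    then show "\<exists>P n. geo P n \<and> P 0 = y \<and> P n = x \<and> G = P ` {..n}"
      by (intro exI[of _ "\<lambda>i. P (n - i)"] exI[of _ n]) (auto simp: im)
  next
    fix P n assume "geo P n" "P 0 = y" "P n = x" "G = P ` {..n}"
    then show "\<exists>P n. geo (\<lambda>i. P (n - i)) n \<and> P 0 = x \<and> P n = y \<and> G = P ` {..n}"
      by (intro exI[of _ "\<lambda>i. P (n - i)"] exI[of _ n]) (auto simp: im rr)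
  qed
qed

lemmas dual_simps = dual_reach dual_dst dual_between dual_geodesic_set

end

section \<open>Hyperbolicity and linear distance bounds\<close>

lemma card_le_of_diam:
  fixes S :: "nat set"
  assumes "finite S" and "\<And>s t. s \<in> S \<Longrightarrow> t \<in> S \<Longrightarrow> s \<le> t \<Longrightarrow> t - s \<le> k"
  shows "card S \<le> k + 1"
proof (cases "S = {}")
  case False
  have "S \<subseteq> {Min S..Min S + k}"
  proof
    fix t assume "t \<in> S"
    then have "Min S \<le> t" "t - Min S \<le> k" using assms False by auto
    then show "t \<in> {Min S..Min S + k}" by auto
  qed
  then have "card S \<le> card {Min S..Min S + k}" using card_mono finite_atLeastAtMost by blast
  then show ?thesis by simp
qed simp

text \<open>
  Thinness is required only for triangles \<open>x \<rightarrow> y \<rightarrow> z\<close>, \<open>x \<rightarrow> z\<close>; the three axioms concern a point \<open>w\<close> on the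
  composite side, on the first and on the second side.  Reversal fixes the first axiom and
  exchanges the other two, and it exchanges the two bounds.
\<close>

locale hyperbolic_space = path_metric +
  fixes \<delta> :: nat and h :: "nat \<Rightarrow> nat"
  assumes thin_long: "geodesic_set A x y \<Longrightarrow> geodesic_set B y z \<Longrightarrow> between x w z \<Longrightarrow>
      (\<exists>u\<in>A. dle \<delta> u w) \<or> (\<exists>u\<in>B. dle \<delta> w u)"
    and thin_first: "geodesic_set C x z \<Longrightarrow> geodesic_set B y z \<Longrightarrow> between x w y \<Longrightarrow>
      (\<exists>u\<in>C. dle \<delta> u w) \<or> (\<exists>u\<in>B. dle \<delta> w u)"
    and thin_second: "geodesic_set A x y \<Longrightarrow> geodesic_set C x z \<Longrightarrow> between y w z \<Longrightarrow>
      (\<exists>u\<in>A. dle \<delta> u w) \<or> (\<exists>u\<in>C. dle \<delta> w u)"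
    and bound_out: "dle r x y \<Longrightarrow> dle r x z \<Longrightarrow> reach y z \<Longrightarrow> dle (h r) y z"
    and bound_in: "dle r y x \<Longrightarrow> dle r z x \<Longrightarrow> reach y z \<Longrightarrow> dle (h r) y z"
begin

lemma dual_hyperbolic_space: "hyperbolic_space (\<lambda>n x y. dle n y x) \<delta> h"
proof -
  interpret dual: path_metric "\<lambda>n x y. dle n y x" by (rule dual_path_metric)
  show ?thesis
  proof (unfold_locales, unfold dual_simps)
    fix A x y B z w assume "geodesic_set A y x" "geodesic_set B z y" "between z w x"
    then show "(\<exists>u\<in>A. dle \<delta> w u) \<or> (\<exists>u\<in>B. dle \<delta> u w)" using thin_long by blast
  next
    fix C x z B y w assume "geodesic_set C z x" "geodesic_set B z y" "between y w x"
    then show "(\<exists>u\<in>C. dle \<delta> w u) \<or> (\<exists>u\<in>B. dle \<delta> u w)" using thin_second by blast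
  next
    fix A x y C z w assume "geodesic_set A y x" "geodesic_set C z x" "between z w y"
    then show "(\<exists>u\<in>A. dle \<delta> w u) \<or> (\<exists>u\<in>C. dle \<delta> u w)" using thin_first by blast
  qed (use bound_in bound_out in blast)+
qed

text \<open>
  The linear function that can replace \<open>h\<close> in both bounds.
\<close>

definition H :: "nat \<Rightarrow> nat" where
  "H r = 2 * (h \<delta> + 1) * (r + 1)"

text \<open>
  Every point of a geodesic from \<open>y\<close> to \<open>z\<close> is reached from a geodesic \<open>A\<close> from \<open>x\<close> to \<open>y\<close> or reaches a geodesic
  \<open>C\<close> from \<open>x\<close> to \<open>z\<close> within \<open>\<delta>\<close>.  By the given bounds, the points served by the same vertex of \<open>A\<close> or \<open>C\<close> lie
  within \<open>h \<delta>\<close> of each other, and there are at most \<open>2 * (r + 1)\<close> such vertices.  The linear bound is what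
  makes the logarithmic estimate below strong enough.
\<close>

lemma linear_bound_out:
  assumes "dle r x y" "dle r x z" "reach y z"
  shows "dle (H r) y z"
proof -
  obtain A where A: "geodesic_set A x y" using ex_geodesic_set assms(1) reachI by blast
  obtain C where C: "geodesic_set C x z" using ex_geodesic_set assms(2) reachI by blast
  let ?T = "dst y z"
  obtain P where P: "geo P ?T" "P 0 = y" "P ?T = z" using ex_geo assms(3) by blast
  let ?a = "\<lambda>u. {t\<in>{..?T}. dle \<delta> u (P t)}" and ?c = "\<lambda>u. {t\<in>{..?T}. dle \<delta> (P t) u}"
  have cov: "{..?T} \<subseteq> (\<Union>u\<in>A. ?a u) \<union> (\<Union>u\<in>C. ?c u)"
  proof
    fix t assume t: "t \<in> {..?T}"
    then have "between y (P t) z" using geo_between[OF P(1), of 0 t ?T] P by simp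
    then show "t \<in> (\<Union>u\<in>A. ?a u) \<union> (\<Union>u\<in>C. ?c u)" using thin_second[OF A C] t by blast
  qed
  have diff: "t - s \<le> h \<delta>" if "dle (h \<delta>) (P s) (P t)" "s \<le> t" "t \<le> ?T" for s t
    using dst_le[OF that(1)] geo_dst[OF P(1) that(2,3)] by simp
  have ca: "card (?a u) \<le> h \<delta> + 1" for u
    by (rule card_le_of_diam) (use diff bound_out geo_reach[OF P(1)] in auto)
  have cc: "card (?c u) \<le> h \<delta> + 1" for u
    by (rule card_le_of_diam) (use diff bound_in geo_reach[OF P(1)] in auto)
  have fA: "finite A" "card A \<le> r + 1" and fC: "finite C" "card C \<le> r + 1"
    using geodesic_set_card[OF A] geodesic_set_card[OF C] dst_le[OF assms(1)] dst_le[OF assms(2)]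
    by auto
  have "?T + 1 = card {..?T}" by simp
  also have "\<dots> \<le> card ((\<Union>u\<in>A. ?a u) \<union> (\<Union>u\<in>C. ?c u))"
    by (rule card_mono[OF _ cov]) (use fA fC in auto)
  also have "\<dots> \<le> card (\<Union>u\<in>A. ?a u) + card (\<Union>u\<in>C. ?c u)" by (rule card_Un_le)
  also have "\<dots> \<le> (\<Sum>u\<in>A. card (?a u)) + (\<Sum>u\<in>C. card (?c u))"
    by (intro add_mono card_UN_le fA fC)
  also have "\<dots> \<le> (\<Sum>u\<in>A. h \<delta> + 1) + (\<Sum>u\<in>C. h \<delta> + 1)"
    by (intro add_mono sum_mono ca cc)
  also have "\<dots> \<le> (r + 1) * (h \<delta> + 1) + (r + 1) * (h \<delta> + 1)"
    using fA fC by (simp only: sum_constant of_nat_id) (intro add_mono mult_right_mono; simp)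
  finally have "?T \<le> H r" unfolding H_def by (simp add: algebra_simps)
  then show ?thesis using dle_dst[OF assms(3)] dle_mono by blast
qed

lemma linear_bound_in:
  assumes "dle r y x" "dle r z x" "reach y z"
  shows "dle (H r) y z"
proof -
  interpret dual: hyperbolic_space "\<lambda>n x y. dle n y x" \<delta> h by (rule dual_hyperbolic_space)
  have "dual.H = H" unfolding dual.H_def H_def ..
  then show ?thesis using dual.linear_bound_out[where r = r and x = x and y = z and z = y] assms dual_reach by simp
qed

section \<open>Forward thinness and exponential divergence\<close>

definition \<kappa> :: "nat \<Rightarrow> nat" where
  "\<kappa> k = H (k + \<delta>) + 1 + \<delta>"

text \<open>
  Walk from \<open>p\<close> towards the end of \<open>G\<close>.  In the triangle of \<open>G i\<close>, \<open>p\<close> and \<open>G n\<close>, a point of this path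
  that is reached from the short side is close to \<open>p\<close> by the bound on out-balls; hence the first point beyond
  that range reaches \<open>G\<close>.
\<close>

lemma return_to_geodesic:
  assumes G: "geo G n" "i \<le> n" and k: "dle k (G i) p" and r: "reach p (G n)"
  shows "\<exists>j. i \<le> j \<and> j \<le> n \<and> dle (\<kappa> k) p (G j)"
proof (cases "dst p (G n) \<le> H (k + \<delta>) + 1")
  case True
  then have "dle (\<kappa> k) p (G n)" using r dle_iff unfolding \<kappa>_def by simp
  then show ?thesis using G by blast
next
  case False
  let ?m = "H (k + \<delta>) + 1"
  obtain P where P: "geo P (dst p (G n))" "P 0 = p" "P (dst p (G n)) = G n" using ex_geo r by blast
  have z: "between p (P ?m) (G n)" "dst p (P ?m) = ?m" "reach p (P ?m)"
    using geo_between[OF P(1), of 0 ?m "dst p (G n)"] geo_dst[OF P(1), of 0 ?m]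
      geo_reach[OF P(1), of 0 ?m] P False by auto
  obtain A where A: "geodesic_set A (G i) p" using ex_geodesic_set k reachI by blast
  have "geodesic_set (G ` {i..n}) (G i) (G n)" using geodesic_set_sub[OF G(1,2)] by simp
  from thin_second[OF A this z(1)] show ?thesis
  proof (elim disjE bexE)
    fix u assume "u \<in> A" "dle \<delta> u (P ?m)"
    then have "dle (k + \<delta>) (G i) (P ?m)"
      using between_dle(1)[OF geodesic_set_between[OF A] k] dle_trans by blast
    then have "dle (H (k + \<delta>)) p (P ?m)"
      using linear_bound_out[of "k + \<delta>" "G i" p "P ?m"] dle_mono[OF k] z by simp
    then show ?thesis using z(2) dst_le by fastforce
  next
    fix u assume u: "u \<in> G ` {i..n}" "dle \<delta> (P ?m) u"
    have "dle ?m p (P ?m)" using z dle_iff by auto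
    then have "dle (\<kappa> k) p u" using dle_trans u(2) unfolding \<kappa>_def by blast
    then show ?thesis using u(1) by auto
  qed
qed

lemma return_between:
  assumes "between a q b" "dle k q p" "reach p b"
  shows "\<exists>u. between a u b \<and> reach q u \<and> dle (\<kappa> k) p u"
proof -
  obtain P n i where P: "geo P n" "P 0 = a" "P n = b" "P i = q" "i \<le> n"
    using between_geo assms(1) by blast
  obtain j where j: "i \<le> j" "j \<le> n" "dle (\<kappa> k) p (P j)"
    using return_to_geodesic[OF P(1,5), of k p] assms(2,3) unfolding P(3,4) by blast
  have "between a (P j) b" "reach q (P j)"
    using geo_between[OF P(1), of 0 j n] geo_reach[OF P(1) j(1,2)] j(2) unfolding P(2,3,4) by simp_all
  then show ?thesis using j(3) by blast
qed

lemma thin_long_between: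
  assumes "reach x y" "reach y z" "between x w z"
  shows "(\<exists>u. between x u y \<and> dle \<delta> u w) \<or> (\<exists>u. between y u z \<and> dle \<delta> w u)"
proof -
  obtain A B where A: "geodesic_set A x y" and B: "geodesic_set B y z"
    using ex_geodesic_set assms(1,2) by blast
  from thin_long[OF A B assms(3)] geodesic_set_between[OF A] geodesic_set_between[OF B] show ?thesis
    by blast
qed

text \<open>
  Two geodesics to \<open>b\<close> that start at points within \<open>k\<close> steps of a common \<open>v\<close> are joined by short paths from the
  first to the second, although neither start need reach the other: pass through a geodesic
  from \<open>v\<close> to \<open>b\<close>.
\<close>

lemma join_geodesic:
  assumes "dle k v p" "dle k v w" "reach p b" "reach w b"
  shows "\<exists>u. between w u b \<and> dle (\<kappa> k + k + 2 * \<delta> + 1) p u"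
proof -
  have vb: "reach v b" using assms reachI reach_trans by blast
  obtain T n where T: "geo T n" "T 0 = v" "T n = b" using ex_geo vb by blast
  obtain j where j: "j \<le> n" "dle (\<kappa> k) p (T j)"
    using return_to_geodesic[OF T(1), of 0 k p] assms(1,3) unfolding T(2,3) by blast
  define m where "m = min n (max j (k + \<delta> + 1))"
  have m: "j \<le> m" "m \<le> n" "m - j \<le> k + \<delta> + 1" using j unfolding m_def by auto
  have pm: "dle (\<kappa> k + (k + \<delta> + 1)) p (T m)"
    using dle_trans[OF j(2) dle_mono[OF geo_dle[OF T(1) m(1,2)] m(3)]] .
  show ?thesis
  proof (cases "m = n")
    case True
    have "between w b b"
      using assms(4) reach_refl(2)[OF assms(4)] dst_self unfolding between_def by simp
    moreover have "dle (\<kappa> k + k + 2 * \<delta> + 1) p b"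
      using dle_mono[OF pm] unfolding True T(3) by simp
    ultimately show ?thesis by blast
  next
    case False
    then have "k + \<delta> + 1 \<le> m" using j unfolding m_def by auto
    then have far: "\<not> dle (k + \<delta>) v (T m)"
      using geo_dst[OF T(1), of 0 m] m(2) dst_le[of "k + \<delta>" v "T m"] unfolding T(2) by auto
    have "between v (T m) b" using geo_between[OF T(1), of 0 m n] m(2) unfolding T(2,3) by simp
    from thin_long_between[OF _ assms(4) this] assms(2) reachI
    consider u where "between v u w" "dle \<delta> u (T m)" | u where "between w u b" "dle \<delta> (T m) u"
      by blast
    then show ?thesis
    proof cases
      case 1
      then have "dle (k + \<delta>) v (T m)" using between_dle(1) assms(2) dle_trans by blast
      with far show ?thesis by blast
    next
      case 2
      then have "dle (\<kappa> k + (k + \<delta> + 1) + \<delta>) p u" using pm dle_trans by blast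
      then have "dle (\<kappa> k + k + 2 * \<delta> + 1) p u" by (rule dle_mono) simp
      then show ?thesis using 2(1) by blast
    qed
  qed
qed

text \<open>
  The value comes from the proof below: \<open>\<kappa> \<delta> + 3 * \<delta> + 1\<close> for joining and \<open>2 * \<delta>\<close> for a shift along the side.
\<close>

definition \<sigma> :: nat where
  "\<sigma> = \<kappa> \<delta> + 5 * \<delta> + 1"

text \<open>
  Let \<open>P\<close> be a geodesic from \<open>a\<close> to \<open>b\<close>.  If a point of \<open>P\<close> is reached from \<open>v\<close> on a geodesic from \<open>a\<close> to \<open>m\<close>, there
  are three cases.  If the point reaches \<open>m\<close>, it returns to the part between \<open>a\<close> and \<open>m\<close>.  If \<open>v\<close> reaches a
  geodesic from \<open>m\<close> to \<open>b\<close> within \<open>\<delta>\<close>, then the point reaches it within a bounded distance, by \<open>join_geodesic\<close>.  Otherwise \<open>v\<close>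
  is reached from a point \<open>P l\<close>; this point reaches \<open>m\<close> and lies at most \<open>2 * \<delta>\<close> before the given one.
  The third case cannot hold for two points of \<open>P\<close> at distance \<open>2 * \<delta>\<close>, since the first of them does not
  reach \<open>m\<close>.
\<close>

lemma forward_thin:
  assumes p: "between a p b" and am: "reach a m" and mb: "reach m b"
  shows "\<exists>u. (between a u m \<or> between m u b) \<and> dle \<sigma> p u"
proof -
  obtain P n k where P: "geo P n" "P 0 = a" "P n = b" "P k = p" and kn: "k \<le> n"
    using between_geo p by blast
  let ?s = "\<kappa> \<delta> + 3 * \<delta> + 1"
  let ?good = "\<lambda>u. between a u m \<or> between m u b"
  have PG: "geodesic_set (P ` {..n}) a b" using geodesic_setI[OF P(1)] P by simp
  obtain N where N: "geodesic_set N m b" using ex_geodesic_set mb by blast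
  have key: "(\<exists>u. ?good u \<and> dle ?s (P i) u) \<or>
      (\<not> reach (P i) m \<and> (\<exists>l<i. reach (P l) m \<and> dle (2 * \<delta>) (P l) (P i)))"
    if i: "i \<le> n" for i
  proof -
    have ri: "reach (P i) b" and bi: "between a (P i) b"
      using geo_reach[OF P(1) i] geo_between[OF P(1), of 0 i n] i P by auto
    from thin_long_between[OF am mb bi]
    consider v where "between a v m" "dle \<delta> v (P i)" | u where "between m u b" "dle \<delta> (P i) u"
      by blast
    then show ?thesis
    proof cases
      case 2
      then show ?thesis using dle_mono[of \<delta> "P i" u ?s] by auto
    next
      case v: 1
      show ?thesis
      proof (cases "reach (P i) m")
        case True
        then obtain u where "between a u m" "dle (\<kappa> \<delta>) (P i) u"
          using return_between v by blast
        then show ?thesis using dle_mono[of "\<kappa> \<delta>" "P i" u ?s] by auto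
      next
        case nr: False
        from thin_first[OF PG N v(1)] show ?thesis
        proof (elim disjE bexE)
          fix w assume w: "w \<in> N" "dle \<delta> v w"
          have mw: "between m w b" using geodesic_set_between N w(1) by blast
          from join_geodesic[OF v(2) w(2) ri between_reach(2)[OF mw]]
          obtain u where u: "between w u b" "dle (\<kappa> \<delta> + \<delta> + 2 * \<delta> + 1) (P i) u"
            by blast
          have "?good u" using between_trans[OF mw u(1)] by blast
          moreover have "dle ?s (P i) u" using u(2) by (simp add: algebra_simps)
          ultimately show ?thesis by blast
        next
          fix s assume "s \<in> P ` {..n}" "dle \<delta> s v"
          then obtain l where l: "l \<le> n" "dle \<delta> (P l) v" by auto
          then have lm: "reach (P l) m" using reach_trans reachI between_reach(2)[OF v(1)] by blast
          have "\<not> i \<le> l" using geo_reach[OF P(1) _ l(1)] lm nr reach_trans by blast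
          moreover have "dle (2 * \<delta>) (P l) (P i)"
            using dle_trans[OF l(2) v(2)] by (simp add: mult_2)
          ultimately show ?thesis using lm nr by auto
        qed
      qed
    qed
  qed
  have ext: "\<exists>u. ?good u \<and> dle \<sigma> p u" if "\<exists>u. ?good u \<and> dle ?s (P j) u" "k \<le> j" "j \<le> n" "j \<le> k + 2 * \<delta>" for j
  proof -
    have "dle (2 * \<delta>) p (P j)"
      using geo_dle[OF P(1) that(2,3)] P(4) dle_mono[of "j - k" p "P j" "2 * \<delta>"] that(4) by simp
    then have "dle (2 * \<delta> + ?s) p u" if "dle ?s (P j) u" for u using dle_trans that by blast
    moreover have "2 * \<delta> + ?s = \<sigma>" unfolding \<sigma>_def by simp
    ultimately show ?thesis using that(1) by metis
  qed
  show ?thesis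
  proof (rule ccontr)
    assume no: "\<not> ?thesis"
    have "\<not> (\<exists>u. ?good u \<and> dle ?s (P k) u)" using ext[OF _ _ kn] no by auto
    with key[OF kn] have nrk: "\<not> reach (P k) m" by blast
    show False
    proof (cases "k + 2 * \<delta> \<le> n")
      case True
      have "\<not> (\<exists>u. ?good u \<and> dle ?s (P (k + 2 * \<delta>)) u)"
        using ext[OF _ _ True] no by auto
      with key[OF True] obtain l where l: "reach (P l) m"
        "dle (2 * \<delta>) (P l) (P (k + 2 * \<delta>))" "l < k + 2 * \<delta>" by blast
      have "\<not> k \<le> l" using nrk l(1) geo_reach[OF P(1), of k l] True l(3) reach_trans
        by (meson less_le_trans less_imp_le)
      moreover have "k + 2 * \<delta> - l \<le> 2 * \<delta>"
        using geo_dst[OF P(1), of l "k + 2 * \<delta>"] dst_le[OF l(2)] l(3) True by simp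
      ultimately show False by simp
    next
      case False
      have "between m b b" using mb reach_refl dst_self unfolding between_def by simp
      moreover have "dle ?s (P n) b"
        using dle_mono[of 0 b b ?s] dle_refl dle_dst[OF mb] P(3) by auto
      ultimately show False using ext[of n] False kn no by auto
    qed
  qed
qed

text \<open>
  Bisect the walk and apply forward thinness at its midpoint.  The bound is logarithmic in the
  length of the walk and concerns directed distances only.
\<close>

lemma exponential_divergence:
  assumes "\<And>i. s \<le> i \<Longrightarrow> i < t \<Longrightarrow> dle 1 (W i) (W (Suc i))" "s < t" "t - s \<le> 2 ^ N"
    and "between (W s) p (W t)"
  shows "\<exists>i. s \<le> i \<and> i \<le> t \<and> dle (\<sigma> * N) p (W i)"
  using assms
proof (induction N arbitrary: s t p)
  case 0
  then have t: "t = Suc s" by simp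
  then have "dle 1 (W s) (W t)" using 0 by simp
  then have "dst (W s) p + dst p (W t) \<le> 1"
    using between_dst[OF 0(4)] dst_le by metis
  moreover have "reach (W s) p" "reach p (W t)" using between_reach[OF 0(4)] by auto
  moreover from calculation(1) have "dst (W s) p = 0 \<or> dst p (W t) = 0" by linarith
  ultimately have "p = W s \<or> p = W t" using dst_0 by metis
  moreover have "dle 0 p p" using between_reach(2)[OF 0(4)] dle_refl unfolding reach_def by blast
  ultimately show ?case unfolding t by (auto intro: exI[of _ s] exI[of _ "Suc s"])
next
  case (Suc N)
  show ?case
  proof (cases "t = Suc s")
    case True
    then obtain i where "s \<le> i" "i \<le> t" "dle (\<sigma> * N) p (W i)"
      using Suc.IH[of s t p] Suc.prems by auto
    then show ?thesis using dle_mono[of "\<sigma> * N" p "W i" "\<sigma> * Suc N"] by auto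
  next
    case False
    define m where "m = s + (t - s) div 2"
    have m: "s < m" "m < t" "m - s \<le> 2 ^ N" "t - m \<le> 2 ^ N"
      using False Suc.prems(2,3) unfolding m_def by auto
    have "dle (m - s) (W s) (W m)"
      by (rule dle_steps[where P = W and a = s and b = t]) (use Suc.prems(1) m in auto)
    moreover have "dle (t - m) (W m) (W t)"
      by (rule dle_steps[where P = W and a = s and b = t]) (use Suc.prems(1) m in auto)
    ultimately have r: "reach (W s) (W m)" "reach (W m) (W t)" using reachI by blast+
    obtain u where u: "between (W s) u (W m) \<or> between (W m) u (W t)" "dle \<sigma> p u"
      using forward_thin[OF Suc.prems(4) r] by blast
    have "\<exists>i. s \<le> i \<and> i \<le> t \<and> dle (\<sigma> * N) u (W i)"
      using u(1)
    proof
      assume b: "between (W s) u (W m)"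
      have "\<exists>i\<ge>s. i \<le> m \<and> dle (\<sigma> * N) u (W i)"
        by (rule Suc.IH[OF _ m(1,3) b]) (use Suc.prems(1) m in simp)
      then show ?thesis using m(2) by (meson le_trans less_imp_le)
    next
      assume b: "between (W m) u (W t)"
      have "\<exists>i\<ge>m. i \<le> t \<and> dle (\<sigma> * N) u (W i)"
        by (rule Suc.IH[OF _ m(2,4) b]) (use Suc.prems(1) m in simp)
      then show ?thesis using m(1) by (meson le_trans less_imp_le)
    qed
    then obtain i where "s \<le> i" "i \<le> t" "dle (\<sigma> * N) u (W i)" by blast
    then show ?thesis using dle_trans[OF u(2), of "\<sigma> * N" "W i"] by auto
  qed
qed

end

section \<open>Stability of quasi-geodesics\<close>

definition linearly_bounded :: "(nat \<Rightarrow> nat) \<Rightarrow> bool" where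
  "linearly_bounded f \<longleftrightarrow> (\<exists>a. \<forall>x. f x \<le> a * (x + 1))"

lemma linearly_bounded_const: "linearly_bounded (\<lambda>_. b)"
  unfolding linearly_bounded_def by (intro exI[of _ b]) simp

lemma linearly_bounded_id: "linearly_bounded (\<lambda>x. x)"
  unfolding linearly_bounded_def by (intro exI[of _ 1]) simp

lemma linearly_bounded_add:
  assumes "linearly_bounded f" "linearly_bounded g"
  shows "linearly_bounded (\<lambda>x. f x + g x)"
proof -
  obtain a b where "\<And>x. f x \<le> a * (x + 1)" "\<And>x. g x \<le> b * (x + 1)"
    using assms unfolding linearly_bounded_def by blast
  then have "f x + g x \<le> (a + b) * (x + 1)" for x
    using add_mono[of "f x" "a * (x + 1)" "g x" "b * (x + 1)"] by (simp add: distrib_right)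
  then show ?thesis unfolding linearly_bounded_def by blast
qed

lemma linearly_bounded_cmult:
  assumes "linearly_bounded f"
  shows "linearly_bounded (\<lambda>x. b * f x)"
proof -
  obtain a where "\<And>x. f x \<le> a * (x + 1)"
    using assms unfolding linearly_bounded_def by blast
  then have "b * f x \<le> b * a * (x + 1)" for x
    using mult_le_mono2[of "f x" "a * (x + 1)" b] by (simp only: mult.assoc)
  then show ?thesis unfolding linearly_bounded_def by blast
qed

lemma linear_le_power2:
  fixes b N :: nat
  assumes "4 * b \<le> N"
  shows "b * (N + 1) \<le> 2 ^ N"
proof -
  define M where "M = N div 2"
  have M: "2 * M \<le> N" "N \<le> 2 * M + 1" "2 * b \<le> M" using assms unfolding M_def by auto
  have "M + 1 \<le> 2 ^ M" by (induction M) auto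
  then have "(M + 1) * (M + 1) \<le> 2 ^ M * 2 ^ M" by (rule mult_le_mono) (rule \<open>M + 1 \<le> 2 ^ M\<close>)
  also have "\<dots> = 2 ^ (2 * M)" by (simp add: power_add mult_2)
  also have "\<dots> \<le> 2 ^ N" using M(1) by (intro power_increasing) auto
  finally have "(M + 1) * (M + 1) \<le> 2 ^ N" .
  moreover have "b * (N + 1) \<le> b * (2 * (M + 1))" using M(2) by (intro mult_le_mono2) simp
  moreover have "b * (2 * (M + 1)) = (2 * b) * (M + 1)" by simp
  moreover have "(2 * b) * (M + 1) \<le> (M + 1) * (M + 1)" using M(3) by (intro mult_le_mono1) simp
  ultimately show ?thesis by linarith
qed

text \<open>
  The form in which an estimate \<open>D \<le> s * log\<^sub>2 (f D) + t\<close> with linear \<open>f\<close> bounds \<open>D\<close>.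
\<close>

lemma logarithm_below_linear:
  assumes "linearly_bounded f"
  shows "\<exists>K::nat. \<forall>D>K. \<exists>N. f D \<le> 2 ^ N \<and> s * N + t < D"
proof -
  obtain a where a: "\<And>x. f x \<le> a * (x + 1)" using assms unfolding linearly_bounded_def by blast
  define b where "b = a * (s + t + 3)"
  show ?thesis
  proof (rule exI[of _ "t + 1 + (s + 1) * (4 * b)"], intro allI impI)
    fix D assume D: "t + 1 + (s + 1) * (4 * b) < D"
    define N where "N = (D - t - 1) div (s + 1)"
    have "(s + 1) * (4 * b) \<le> D - t - 1" using D by linarith
    then have "4 * b \<le> N" unfolding N_def
      by (metis add.commute div_le_mono nonzero_mult_div_cancel_left zero_neq_one add_is_0)
    have m: "(s + 1) * N \<le> D - t - 1" "D - t - 1 < (s + 1) * (N + 1)"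
      unfolding N_def using dividend_less_times_div[of "s + 1" "D - t - 1"]
        times_div_less_eq_dividend[of "s + 1" "D - t - 1"] by (simp_all add: algebra_simps)
    have "s * N + t < D" using m(1) D by (simp add: algebra_simps)
    moreover have "f D \<le> 2 ^ N"
    proof -
      have "D + 1 \<le> (s + 1) * (N + 1) + (t + 2)" using m(2) by linarith
      also have "\<dots> \<le> (s + 1) * (N + 1) + (t + 2) * (N + 1)" by simp
      also have "\<dots> = (s + t + 3) * (N + 1)" by (simp add: algebra_simps)
      finally have "a * (D + 1) \<le> b * (N + 1)" unfolding b_def mult.assoc by (rule mult_le_mono2)
      then show ?thesis using a[of D] linear_le_power2[OF \<open>4 * b \<le> N\<close>] by linarith
    qed
    ultimately show "\<exists>N. f D \<le> 2 ^ N \<and> s * N + t < D" by blast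
  qed
qed

context path_metric
begin

definition quasi_geo :: "nat \<Rightarrow> (nat \<Rightarrow> 'a) \<Rightarrow> nat \<Rightarrow> bool" where
  "quasi_geo c Q n \<longleftrightarrow> (\<forall>i<n. dle 1 (Q i) (Q (Suc i))) \<and>
     (\<forall>i j m. i \<le> j \<and> j \<le> n \<and> dle m (Q i) (Q j) \<longrightarrow> j - i \<le> c * m + c)"

lemma quasi_geo_dle:
  assumes "quasi_geo c Q n" "0 < n" "i \<le> j" "j \<le> n"
  shows "dle (j - i) (Q i) (Q j)"
proof (cases "i < j")
  case True
  show ?thesis
    by (rule dle_steps[where P = Q and a = 0 and b = n])
      (use assms True in \<open>auto simp: quasi_geo_def\<close>)
next
  case False
  then have ij: "i = j" using assms by simp
  have "dle 0 (Q j) (Q j)"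
  proof (cases "j < n")
    case True
    then show ?thesis using assms(1) dle_refl unfolding quasi_geo_def by blast
  next
    case False
    then have "Suc (j - 1) = j" "j - 1 < n" using assms by auto
    then show ?thesis using assms(1) dle_refl unfolding quasi_geo_def by metis
  qed
  then show ?thesis using ij by simp
qed

lemma quasi_geo_gap:
  assumes "quasi_geo c Q n" "i \<le> j" "j \<le> n" "dle m (Q i) (Q j)"
  shows "j - i \<le> c * m + c"
  using assms unfolding quasi_geo_def by blast

end

context hyperbolic_space
begin

lemma linearly_bounded_H:
  assumes "linearly_bounded f"
  shows "linearly_bounded (\<lambda>x. H (f x))"
  unfolding H_def
  by (intro linearly_bounded_cmult linearly_bounded_add assms linearly_bounded_const)

text \<open>
  Let \<open>D\<close> be the largest distance from a point \<open>p\<close> between the ends to \<open>Q\<close>.  Leave a geodesic through \<open>p\<close> at a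
  point \<open>a\<close> well before \<open>p\<close>, go to \<open>Q\<close>, and follow \<open>Q\<close> to a point \<open>b\<close> that is near a point of the geodesic
  after \<open>p\<close>.  By the linear bounds this detour has length linear in \<open>D\<close>, so a geodesic from \<open>a\<close> to \<open>b\<close> reaches
  it within \<open>O(log D)\<close> steps.  But \<open>p\<close> is close to that geodesic and far from the detour.
  The directedness of \<open>Q\<close> requires that \<open>b\<close> comes after the point where the detour enters \<open>Q\<close>; this fixes
  the choice of \<open>l\<close> below.
\<close>

lemma geodesic_reaches_quasi_geodesic:
  "\<exists>K. \<forall>Q n p. quasi_geo c Q n \<and> between (Q 0) p (Q n) \<longrightarrow> (\<exists>i\<le>n. dle K p (Q i))"
proof -
  define E where "E D = H D + \<delta> + 1" for D
  define E' where "E' = H \<delta> + 1"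
  define J where "J D = c * H (D + 1) + c" for D
  define \<Lambda> where "\<Lambda> D = E D + E' + H (D + J D)" for D
  define \<nu> where "\<nu> D = D + (c * H (\<Lambda> D + D) + c)" for D
  have "linearly_bounded \<nu>"
    unfolding \<nu>_def \<Lambda>_def J_def E_def
    by (intro linearly_bounded_add linearly_bounded_cmult linearly_bounded_H
        linearly_bounded_id linearly_bounded_const)
  from logarithm_below_linear[OF this, of \<sigma> "\<kappa> \<delta>"]
  obtain K0 where K0: "\<And>D. K0 < D \<Longrightarrow> \<exists>N. \<nu> D \<le> 2 ^ N \<and> \<sigma> * N + \<kappa> \<delta> < D" by blast
  define K where "K = K0 + H \<delta> + \<delta>"
  have "\<exists>i\<le>n. dle K p (Q i)" if Q: "quasi_geo c Q n" and p0: "between (Q 0) p (Q n)" for Q n p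
  proof (rule ccontr)
    assume no: "\<not> (\<exists>i\<le>n. dle K p (Q i))"
    have n0: "0 < n"
    proof (rule ccontr)
      assume "\<not> 0 < n"
      then have "dst p (Q 0) = 0" "reach p (Q 0)"
        using between_dst[OF p0] between_reach[OF p0] dst_self by auto
      then show False using no dle_iff by auto
    qed
    note qd = quasi_geo_dle[OF Q n0]
    \<comment> \<open>Take a point of the geodesic region for which the distance \<open>D\<close> to \<open>Q\<close> is largest.\<close>
    define far where "far m \<longleftrightarrow> (\<exists>p. between (Q 0) p (Q n) \<and> (\<forall>i\<le>n. \<forall>k<m. \<not> dle k p (Q i)))" for m
    have bd: "m \<le> dst (Q 0) (Q n)" if far: "far m" for m
    proof -
      obtain p where p: "between (Q 0) p (Q n)" "\<forall>i\<le>n. \<forall>k<m. \<not> dle k p (Q i)"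
        using far unfolding far_def by blast
      have "dle (dst (Q 0) (Q n)) p (Q n)"
        using between_dle(2)[OF p(1)] dle_dst between_reach(3)[OF p(1)] by blast
      then show ?thesis using p(2) by (meson le_refl not_le)
    qed
    have farK: "far (K + 1)" unfolding far_def
    proof (intro exI[of _ p] conjI p0 allI impI)
      fix i k assume "i \<le> n" "k < K + 1"
      then show "\<not> dle k p (Q i)" using no dle_mono[of k p "Q i" K] by auto
    qed
    define D where "D = Greatest far"
    have far_D: "far D" unfolding D_def by (rule GreatestI_nat[where P = far, OF farK bd])
    have D_max: "m \<le> D" if "far m" for m
      unfolding D_def by (rule Greatest_le_nat[where P = far, OF that bd])
    have KD: "K < D" using D_max[OF farK] by simp
    have proj: "\<exists>i\<le>n. dle D q (Q i)" if "between (Q 0) q (Q n)" for q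
    proof -
      have "\<not> far (Suc D)" using D_max[of "Suc D"] by (metis Suc_n_not_le_n)
      then have "\<not> (\<forall>i\<le>n. \<forall>k<Suc D. \<not> dle k q (Q i))" using that unfolding far_def by metis
      then obtain i k where ik: "i \<le> n" "k < Suc D" "dle k q (Q i)" by metis
      then have "dle D q (Q i)" using dle_mono[OF ik(3), of D] by simp
      then show ?thesis using ik(1) by metis
    qed
    obtain p where p: "between (Q 0) p (Q n)" and p_far: "\<And>i k. i \<le> n \<Longrightarrow> k < D \<Longrightarrow> \<not> dle k p (Q i)"
      using far_D unfolding far_def by blast
    obtain P len k where P: "geo P len" "P 0 = Q 0" "P len = Q n" "P k = p" and k: "k \<le> len"
      using between_geo p by blast
    have Pb: "between (Q 0) (P i) (Q n)" if "i \<le> len" for i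
      using geo_between[OF P(1), of 0 i len] that P(2,3) by simp
    have len0: "0 < len"
    proof (rule ccontr)
      assume "\<not> 0 < len"
      then have "p = Q 0" using k P(2,4) by simp
      then have "dle 0 p (Q 0)" using qd[of 0 0] by simp
      then show False using p_far[of 0 0] KD by simp
    qed
    \<comment> \<open>The index of a point of \<open>Q\<close> close to \<open>P i\<close>, with the ends of \<open>P\<close> sent to the ends of \<open>Q\<close>.\<close>
    define \<pi> where "\<pi> i = (if i = 0 then 0 else if i = len then n
        else SOME j. j \<le> n \<and> dle D (P i) (Q j))" for i
    have \<pi>: "\<pi> i \<le> n \<and> dle D (P i) (Q (\<pi> i))" if "i \<le> len" for i
    proof -
      have "dle D (Q 0) (Q 0)" "dle D (Q n) (Q n)"
        using qd[of 0 0] qd[of n n] dle_mono[of 0 _ _ D] by auto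
      moreover have "\<exists>j. j \<le> n \<and> dle D (P i) (Q j)" using proj[OF Pb[OF that]] by blast
      ultimately show ?thesis using someI_ex[of "\<lambda>j. j \<le> n \<and> dle D (P i) (Q j)"] P(2,3)
        unfolding \<pi>_def by auto
    qed
    have \<pi>_0: "\<pi> 0 = 0" and \<pi>_len: "\<pi> len = n" using len0 unfolding \<pi>_def by auto
    \<comment> \<open>If \<open>p\<close> is near the start, the truncated subtraction gives \<open>k' = 0\<close>, where \<open>P\<close> and \<open>Q\<close> meet.\<close>
    define k' where "k' = k - E D"
    define l0 where "l0 = min len (k + E')"
    define l where "l = (LEAST l. l0 \<le> l \<and> l \<le> len \<and> \<pi> k' \<le> \<pi> l)"
    have k'k: "k' \<le> k" "k' \<le> len" using k unfolding k'_def by auto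
    have "l0 \<le> len \<and> len \<le> len \<and> \<pi> k' \<le> \<pi> len"
      using \<pi>[OF k'k(2)] \<pi>_len unfolding l0_def by auto
    then have l: "l0 \<le> l" "l \<le> len" "\<pi> k' \<le> \<pi> l"
      unfolding l_def by (metis (mono_tags, lifting) LeastI)+
    have kl: "k \<le> l" using l(1) k unfolding l0_def by auto
    then have k'l: "k' \<le> l" using k'k by simp
    \<comment> \<open>If \<open>l\<close> is not the first candidate, then \<open>\<pi>\<close> jumps over \<open>\<pi> k'\<close> just before \<open>l\<close>.  The jump is linear in \<open>D\<close>, so
    \<open>P k'\<close> and \<open>P l\<close> both reach \<open>Q (\<pi> l)\<close> within a linear distance.\<close>
    have lk: "l - k' \<le> \<Lambda> D"
    proof (cases "l = l0")
      case True
      then show ?thesis unfolding \<Lambda>_def l0_def k'_def by auto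
    next
      case False
      define j where "j = l - 1"
      have j: "Suc j = l" "l0 \<le> j" "j \<le> len" "j < l" using l False unfolding j_def by auto
      then have "\<pi> j < \<pi> k'"
        using not_less_Least[of j "\<lambda>l. l0 \<le> l \<and> l \<le> len \<and> \<pi> k' \<le> \<pi> l"] unfolding l_def[symmetric]
        by auto
      have "dle (1 + D) (P j) (Q (\<pi> l))"
        using dle_trans[of 1 "P j" "P l" D "Q (\<pi> l)"] geo_dle[OF P(1), of j l] j l \<pi>[OF l(2)] by auto
      moreover have "dle (1 + D) (P j) (Q (\<pi> j))"
        using dle_mono[of D "P j" "Q (\<pi> j)" "1 + D"] \<pi>[OF j(3)] by simp
      moreover have jl: "\<pi> j \<le> \<pi> l" "\<pi> l \<le> n" using \<open>\<pi> j < \<pi> k'\<close> l(3) \<pi>[OF l(2)] by auto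
      moreover have "reach (Q (\<pi> j)) (Q (\<pi> l))" using qd[OF jl] reachI by blast
      ultimately have "dle (H (1 + D)) (Q (\<pi> j)) (Q (\<pi> l))" using linear_bound_out by blast
      then have "\<pi> l - \<pi> j \<le> J D" using quasi_geo_gap[OF Q jl] unfolding J_def by (simp add: add.commute)
      then have "\<pi> l - \<pi> k' \<le> J D" using \<open>\<pi> j < \<pi> k'\<close> by simp
      then have "dle (J D) (Q (\<pi> k')) (Q (\<pi> l))" using dle_mono[OF qd[OF l(3) jl(2)]] by blast
      then have "dle (D + J D) (P k') (Q (\<pi> l))" using dle_trans \<pi>[OF k'k(2)] by blast
      moreover have "dle (D + J D) (P l) (Q (\<pi> l))"
        using dle_mono[of D "P l" "Q (\<pi> l)" "D + J D"] \<pi>[OF l(2)] by simp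
      moreover have "reach (P k') (P l)" using geo_reach[OF P(1) k'l l(2)] .
      ultimately have "dle (H (D + J D)) (P k') (P l)" using linear_bound_in by blast
      then have "l - k' \<le> H (D + J D)" using dst_le geo_dst[OF P(1) k'l l(2)] by metis
      then show ?thesis unfolding \<Lambda>_def by simp
    qed
    define a where "a = P k'"
    define u where "u = Q (\<pi> k')"
    define b where "b = Q (\<pi> l)"
    have pl_n: "\<pi> l \<le> n" using \<pi>[OF l(2)] by simp
    have au: "dle D a u" using \<pi>[OF k'k(2)] unfolding a_def u_def by simp
    have ub: "reach u b" using qd[OF l(3) pl_n] reachI unfolding u_def b_def by blast
    have lb: "dle D (P l) b" using \<pi>[OF l(2)] unfolding b_def by simp
    have al: "dle (\<Lambda> D) a (P l)" using dle_mono[OF geo_dle[OF P(1) k'l l(2)] lk] unfolding a_def .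
    have ab: "dle (\<Lambda> D + D) a b" using dle_trans al lb by blast
    have "dle (H (\<Lambda> D + D)) u b"
      using linear_bound_out[of "\<Lambda> D + D" a u b] dle_mono[OF au, of "\<Lambda> D + D"] ab ub by simp
    then have gap: "\<pi> l - \<pi> k' \<le> c * H (\<Lambda> D + D) + c"
      using quasi_geo_gap[OF Q l(3) pl_n] unfolding u_def b_def by blast
    \<comment> \<open>The detour \<open>W\<close> runs from \<open>a\<close> to \<open>u\<close> and then along \<open>Q\<close> to \<open>b\<close>; its length is linear in \<open>D\<close>.\<close>
    define d where "d = dst a u"
    have d: "d \<le> D" using dst_le[OF au] unfolding d_def .
    obtain U where U: "geo U d" "U 0 = a" "U d = u" using ex_geo au reachI unfolding d_def by blast
    define W where "W i = (if i < d then U i else Q (\<pi> k' + (i - d)))" for i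
    define t where "t = d + (\<pi> l - \<pi> k')"
    have W0: "W 0 = a" using U unfolding W_def u_def by auto
    have Wt: "W t = b"
    proof -
      have "\<not> t < d" "\<pi> k' + (t - d) = \<pi> l" using l(3) unfolding t_def by auto
      then show ?thesis unfolding W_def b_def by simp
    qed
    have W_step: "dle 1 (W i) (W (Suc i))" if "i < t" for i
    proof (cases "i < d")
      case True
      have "W (Suc i) = U (Suc i)"
        using True U(3) unfolding W_def u_def by (cases "Suc i < d") (auto simp: not_less_eq less_Suc_eq)
      then show ?thesis using geo_dle[OF U(1), of i "Suc i"] True unfolding W_def by simp
    next
      case False
      then have "W i = Q (\<pi> k' + (i - d))" "W (Suc i) = Q (Suc (\<pi> k' + (i - d)))"
        unfolding W_def by (auto simp: Suc_diff_le)
      moreover have "\<pi> k' + (i - d) < n" using that False l(3) pl_n unfolding t_def by linarith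
      ultimately show ?thesis using Q unfolding quasi_geo_def by simp
    qed
    have "t \<le> \<nu> D" using d gap unfolding t_def \<nu>_def by simp
    obtain N where N: "\<nu> D \<le> 2 ^ N" "\<sigma> * N + \<kappa> \<delta> < D" using K0[of D] KD unfolding K_def by auto
    have W_close: "\<exists>i\<le>t. dle (\<sigma> * N) q (W i)" if "between a q b" for q
    proof (cases "t = 0")
      case True
      then have "a = b" using W0 Wt by simp
      then have "dst q b = 0" "reach q b"
        using between_dst[OF that] between_reach[OF that] dst_self by auto
      then show ?thesis using Wt dle_iff True by auto
    next
      case False
      have "\<exists>i\<ge>0. i \<le> t \<and> dle (\<sigma> * N) q (W i)"
        by (rule exponential_divergence)
          (use False W_step W0 Wt that \<open>t \<le> \<nu> D\<close> N(1) in auto)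
      then show ?thesis by blast
    qed
    have reach_ab: "reach a b" using ab reachI by blast
    obtain G where G: "geo G (dst a b)" "G 0 = a" "G (dst a b) = b" using ex_geo[OF reach_ab] by blast
    have Gset: "geodesic_set (G ` {..dst a b}) a b" using geodesic_setI[OF G(1)] unfolding G(2,3) .
    obtain B where B: "geodesic_set B (P l) b" using ex_geodesic_set lb reachI by blast
    have apl: "between a p (P l)"
      using geo_between[OF P(1) k'k(1) kl l(2)] P(4) unfolding a_def by simp
    have pl: "reach p (P l)" using between_reach(2)[OF apl] .
    have pb: "reach p b" using reach_trans[OF pl] lb reachI by blast
    from thin_first[OF Gset B apl] show False
    proof (elim disjE bexE)
      fix w assume w: "w \<in> B" "dle \<delta> p w"
      have wB: "between (P l) w b" using geodesic_set_between[OF B w(1)] .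
      have "dle (\<delta> + dst w b) p b" using dle_trans[OF w(2) dle_dst[OF between_reach(2)[OF wB]]] .
      then have "D \<le> \<delta> + dst w b" using p_far[OF pl_n] unfolding b_def by (meson not_le)
      then have "dst (P l) w \<le> \<delta>" using between_dst[OF wB] dst_le[OF lb] by linarith
      then have "dle \<delta> (P l) w" using between_reach(1)[OF wB] dle_iff by simp
      then have "dle (H \<delta>) p (P l)" using linear_bound_in[OF w(2) _ pl] by blast
      then have "l - k \<le> H \<delta>" using dst_le geo_dst[OF P(1) kl l(2)] P(4) by metis
      then have "l < k + E'" unfolding E'_def by simp
      then have "l = len" using l(1,2) unfolding l0_def by simp
      then have "dle (H \<delta>) p (Q n)" using \<open>dle (H \<delta>) p (P l)\<close> P(3) by simp
      then show False using p_far[of n "H \<delta>"] KD unfolding K_def by simp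
    next
      fix w assume "w \<in> G ` {..dst a b}" and wp: "dle \<delta> w p"
      then obtain i where i: "i \<le> dst a b" "w = G i" by blast
      obtain j where j: "i \<le> j" "j \<le> dst a b" "dle (\<kappa> \<delta>) p (G j)"
        using return_to_geodesic[OF G(1) i(1), of \<delta> p] wp pb unfolding i(2) G(3) by blast
      have "between a (G j) b" using geo_between[OF G(1), of 0 j "dst a b"] j(2) unfolding G(2,3) by simp
      then obtain r where r: "r \<le> t" "dle (\<sigma> * N) (G j) (W r)" using W_close by blast
      show False
      proof (cases "r < d")
        case False
        then have "W r = Q (\<pi> k' + (r - d))" "\<pi> k' + (r - d) \<le> n"
          using r(1) l(3) pl_n unfolding W_def t_def by auto
        moreover have "dle (\<kappa> \<delta> + \<sigma> * N) p (W r)" using dle_trans j(3) r(2) by blast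
        ultimately show False using p_far[of "\<pi> k' + (r - d)" "\<kappa> \<delta> + \<sigma> * N"] N(2) by simp
      next
        case True
        have "k' \<noteq> 0"
        proof
          assume "k' = 0"
          then have "a = u" unfolding a_def u_def using \<pi>_0 P(2) by simp
          then show False using True dst_self reach_refl(1)[OF reach_ab] unfolding d_def by simp
        qed
        then have kE: "k - k' = E D" unfolding k'_def by simp
        have "dle D (G j) (U r)" using dle_mono[OF r(2), of D] N(2) True unfolding W_def by simp
        moreover have "dle D a (U r)"
          using dle_mono[OF geo_dle[OF U(1), of 0 r], of D] True d unfolding U(2) by simp
        moreover have "reach a (G j)" using geo_reach[OF G(1), of 0 j] j(2) unfolding G(2) by simp
        ultimately have "dle (H D) a (G j)" using linear_bound_in by blast
        then have "j \<le> H D" using dst_le geo_dst[OF G(1), of 0 j] j(2) unfolding G(2) by fastforce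
        have "dle i a w" using geo_dle[OF G(1), of 0 i] i unfolding G(2) by simp
        then have "dle (i + \<delta>) a p" using dle_trans wp by blast
        then have "k - k' \<le> i + \<delta>"
          using dst_le geo_dst[OF P(1) k'k(1) k] P(4) unfolding a_def by metis
        then show False using kE \<open>j \<le> H D\<close> j(1) unfolding E_def by simp
      qed
    qed
  qed
  then show ?thesis by blast
qed

end

context path_metric
begin

lemma quasi_geo_dual:
  assumes "quasi_geo c Q n"
  shows "path_metric.quasi_geo (\<lambda>n x y. dle n y x) c (\<lambda>i. Q (n - i)) n"
  unfolding path_metric.quasi_geo_def[OF dual_path_metric]
proof (intro conjI allI impI)
  fix i assume "i < n"
  then have "n - i = Suc (n - Suc i)" "n - Suc i < n" by auto
  then show "dle 1 (Q (n - Suc i)) (Q (n - i))" using assms unfolding quasi_geo_def by metis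
next
  fix i j m assume ij: "i \<le> j \<and> j \<le> n \<and> dle m (Q (n - j)) (Q (n - i))"
  then have "(n - i) - (n - j) \<le> c * m + c"
    using quasi_geo_gap[OF assms, of "n - j" "n - i" m] by auto
  then show "j - i \<le> c * m + c" using ij by auto
qed

lemma geo_dual: "geo P n \<Longrightarrow> path_metric.geo (\<lambda>n x y. dle n y x) (\<lambda>i. P (n - i)) n"
  unfolding dual_geo unfolding geo_def by simp

end

context hyperbolic_space
begin

lemma quasi_geodesic_reaches_geodesic:
  "\<exists>K. \<forall>Q n p. quasi_geo c Q n \<and> between (Q 0) p (Q n) \<longrightarrow> (\<exists>i\<le>n. dle K (Q i) p)"
proof -
  interpret dual: hyperbolic_space "\<lambda>n x y. dle n y x" \<delta> h by (rule dual_hyperbolic_space)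
  obtain K where K: "\<And>Q n p. dual.quasi_geo c Q n \<Longrightarrow> between (Q n) p (Q 0) \<Longrightarrow> (\<exists>i\<le>n. dle K (Q i) p)"
    using dual.geodesic_reaches_quasi_geodesic[of c] unfolding dual_between by blast
  have "\<exists>i\<le>n. dle K (Q i) p" if q: "quasi_geo c Q n" "between (Q 0) p (Q n)" for Q n p
  proof -
    obtain i where "i \<le> n" "dle K (Q (n - i)) p"
      using K[OF quasi_geo_dual[OF q(1)], of p] q(2) by auto
    then show ?thesis by (intro exI[of _ "n - i"]) simp
  qed
  then show ?thesis by blast
qed

text \<open>
  A discrete continuity argument: consecutive points of \<open>P\<close> are close to points of \<open>Q\<close> whose indices differ by
  a bounded amount, and the ends correspond to each other.
\<close>

lemma quasi_geodesic_covered: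
  assumes Q: "quasi_geo c Q n" and P: "geo P len" "P 0 = Q 0" "P len = Q n"
    and near: "\<And>k. k \<le> len \<Longrightarrow> \<exists>i\<le>n. dle K (P k) (Q i)" and i: "i \<le> n"
  shows "\<exists>k\<le>len. dle (K + 1 + (c * H (K + 1) + c)) (P k) (Q i)"
proof (cases "n = 0")
  case True
  have "dle 0 (P 0) (P 0)" using geo_dle[OF P(1), of 0 0] by simp
  then have "dle (K + 1 + (c * H (K + 1) + c)) (P 0) (Q i)"
    using True i P(2) dle_mono by auto
  then show ?thesis by blast
next
  case False
  then have qd: "dle (j - i) (Q i) (Q j)" if "i \<le> j" "j \<le> n" for i j
    using quasi_geo_dle[OF Q _ that] by simp
  \<comment> \<open>The last point of \<open>P\<close> sent to the part of \<open>Q\<close> up to \<open>i\<close> is also close to the part after \<open>i\<close>.\<close>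
  define S where "S = {k. k \<le> len \<and> (\<exists>j\<le>i. dle K (P k) (Q j))}"
  have "dle K (P 0) (Q 0)" using dle_mono[OF geo_dle[OF P(1), of 0 0], of K] P(2) by simp
  then have S: "finite S" "0 \<in> S" unfolding S_def by auto
  define k where "k = Max S"
  have "k \<in> S" using Max_in S unfolding k_def by blast
  then obtain j where k: "k \<le> len" and j: "j \<le> i" "dle K (P k) (Q j)" unfolding S_def by blast
  obtain j' where j': "i \<le> j'" "j' \<le> n" "dle (K + 1) (P k) (Q j')"
  proof (cases "k = len")
    case True
    then have "dle (K + 1) (P k) (Q n)"
      using dle_mono[OF geo_dle[OF P(1), of k len], of "K + 1"] P(3) by simp
    then show thesis using that i by blast
  next
    case False
    then have Sk: "Suc k \<le> len" using k by simp
    obtain j' where jj: "j' \<le> n" "dle K (P (Suc k)) (Q j')" using near[OF Sk] by blast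
    have "Suc k \<notin> S" using Max_ge[OF S(1), of "Suc k"] unfolding k_def by auto
    then have "\<not> j' \<le> i" using Sk jj(2) unfolding S_def by blast
    moreover have "dle (K + 1) (P k) (Q j')"
      using dle_trans[OF geo_dle[OF P(1), of k "Suc k"] jj(2)] Sk by (simp add: add.commute)
    ultimately show thesis using that[of j'] jj(1) by simp
  qed
  have ij: "j \<le> j'" using j(1) j'(1) by simp
  have "dle (H (K + 1)) (Q j) (Q j')"
    using linear_bound_out[OF dle_mono[OF j(2)] j'(3) reachI[OF qd[OF ij j'(2)]]] by simp
  then have "j' - j \<le> c * H (K + 1) + c" using quasi_geo_gap[OF Q ij j'(2)] by blast
  then have "i - j \<le> c * H (K + 1) + c" using j'(1) by simp
  then have "dle (c * H (K + 1) + c) (Q j) (Q i)" using dle_mono[OF qd[OF j(1) i]] by blast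
  then have "dle (K + (c * H (K + 1) + c)) (P k) (Q i)" using dle_trans[OF j(2)] by blast
  then have "dle (K + 1 + (c * H (K + 1) + c)) (P k) (Q i)" by (rule dle_mono) simp
  then show ?thesis using k by blast
qed

theorem geodesic_stability:
  "\<exists>K. \<forall>Q n P len. quasi_geo c Q n \<and> geo P len \<and> P 0 = Q 0 \<and> P len = Q n \<longrightarrow>
     (\<forall>k\<le>len. \<exists>i\<le>n. dle K (P k) (Q i)) \<and> (\<forall>k\<le>len. \<exists>i\<le>n. dle K (Q i) (P k)) \<and>
     (\<forall>i\<le>n. \<exists>k\<le>len. dle K (P k) (Q i)) \<and> (\<forall>i\<le>n. \<exists>k\<le>len. dle K (Q i) (P k))"
proof -
  interpret dual: hyperbolic_space "\<lambda>n x y. dle n y x" \<delta> h by (rule dual_hyperbolic_space)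
  obtain K1 where K1: "\<And>Q n p. quasi_geo c Q n \<Longrightarrow> between (Q 0) p (Q n) \<Longrightarrow> \<exists>i\<le>n. dle K1 p (Q i)"
    using geodesic_reaches_quasi_geodesic by blast
  obtain K2 where K2: "\<And>Q n p. quasi_geo c Q n \<Longrightarrow> between (Q 0) p (Q n) \<Longrightarrow> \<exists>i\<le>n. dle K2 (Q i) p"
    using quasi_geodesic_reaches_geodesic by blast
  define g where "g K = K + 1 + (c * H (K + 1) + c)" for K
  define K where "K = g K1 + g K2"
  have le: "K1 \<le> K" "K2 \<le> K" "g K1 \<le> K" "g K2 \<le> K" unfolding K_def g_def by auto
  show ?thesis
  proof (rule exI[of _ K], intro allI impI, elim conjE)
    fix Q n P len assume Q: "quasi_geo c Q n" and P: "geo P len" "P 0 = Q 0" "P len = Q n"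
    have b: "between (Q 0) (P k) (Q n)" if "k \<le> len" for k
      using geo_between[OF P(1), of 0 k len] that unfolding P(2,3) by simp
    have A: "\<exists>i\<le>n. dle K1 (P k) (Q i)" if "k \<le> len" for k using K1[OF Q b[OF that]] .
    have B: "\<exists>i\<le>n. dle K2 (Q i) (P k)" if "k \<le> len" for k using K2[OF Q b[OF that]] .
    have C: "\<exists>k\<le>len. dle (g K1) (P k) (Q i)" if "i \<le> n" for i
      unfolding g_def by (rule quasi_geodesic_covered[OF Q P(1) P(2) P(3) _ that]) (rule A)
    have D: "\<exists>k\<le>len. dle (g K2) (Q i) (P k)" if i: "i \<le> n" for i
    proof -
      have "\<exists>k\<le>len. dle (g K2) (Q (n - (n - i))) (P (len - k))"
        unfolding g_def
      proof (rule dual.quasi_geodesic_covered[OF quasi_geo_dual[OF Q] geo_dual[OF P(1)]])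
        fix k assume "k \<le> len"
        then obtain i where "i \<le> n" "dle K2 (Q i) (P (len - k))" using B[of "len - k"] by auto
        then show "\<exists>i\<le>n. dle K2 (Q (n - i)) (P (len - k))" by (intro exI[of _ "n - i"]) simp
      qed (use P in simp_all)
      then obtain k where "k \<le> len" "dle (g K2) (Q i) (P (len - k))" using i by auto
      then show ?thesis by (intro exI[of _ "len - k"]) simp
    qed
    show "(\<forall>k\<le>len. \<exists>i\<le>n. dle K (P k) (Q i)) \<and> (\<forall>k\<le>len. \<exists>i\<le>n. dle K (Q i) (P k)) \<and>
     (\<forall>i\<le>n. \<exists>k\<le>len. dle K (P k) (Q i)) \<and> (\<forall>i\<le>n. \<exists>k\<le>len. dle K (Q i) (P k))"
      using A B C D dle_mono le by meson
  qed
qed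

end

section \<open>Geodesic rays near quasi-geodesic rays\<close>

context path_metric
begin

text \<open>
  Coarse rays need not follow arcs and may repeat vertices.  Unlike quasi-geodesic rays they are
  preserved by quasi-isometries.
\<close>

definition coarse_ray :: "nat \<Rightarrow> (nat \<Rightarrow> 'a) \<Rightarrow> bool" where
  "coarse_ray c X \<longleftrightarrow> (\<forall>i. dle c (X i) (X (Suc i))) \<and>
     (\<forall>i j m. i \<le> j \<and> dle m (X i) (X j) \<longrightarrow> j - i \<le> c * m + c)"

definition quasi_ray :: "nat \<Rightarrow> (nat \<Rightarrow> 'a) \<Rightarrow> bool" where
  "quasi_ray c X \<longleftrightarrow> (\<forall>n. quasi_geo c X n)"

definition georay :: "(nat \<Rightarrow> 'a) \<Rightarrow> bool" where
  "georay S \<longleftrightarrow> (\<forall>n. geo S n)"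

definition anti_georay :: "(nat \<Rightarrow> 'a) \<Rightarrow> bool" where
  "anti_georay S \<longleftrightarrow> (\<forall>i j. i \<le> j \<longrightarrow> reach (S j) (S i) \<and> dst (S j) (S i) = j - i)"

definition fellow_travel :: "(nat \<Rightarrow> 'a) \<Rightarrow> (nat \<Rightarrow> 'a) \<Rightarrow> bool" where
  "fellow_travel X Y \<longleftrightarrow> (\<exists>K. (\<forall>i. \<exists>j. dle K (X i) (Y j)) \<and> (\<forall>i. \<exists>j. dle K (Y j) (X i)) \<and>
     (\<forall>j. \<exists>i. dle K (X i) (Y j)) \<and> (\<forall>j. \<exists>i. dle K (Y j) (X i)))"

text \<open>
  These are the sequences that leave every ball, in either direction.
\<close>

definition proper :: "(nat \<Rightarrow> 'a) \<Rightarrow> bool" where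
  "proper X \<longleftrightarrow> (\<forall>x r. finite {i. dle r x (X i)} \<and> finite {i. dle r (X i) x})"

text \<open>
  For proper rays and anti-rays this is their order: leaving all balls amounts to infinitely many indices.
\<close>

definition leads :: "(nat \<Rightarrow> 'a) \<Rightarrow> (nat \<Rightarrow> 'a) \<Rightarrow> bool" where
  "leads X Y \<longleftrightarrow> (\<exists>L. infinite {i. \<exists>j. dle L (X i) (Y j)})"

lemma georay_iff: "georay S \<longleftrightarrow> (\<forall>i j. i \<le> j \<longrightarrow> reach (S i) (S j) \<and> dst (S i) (S j) = j - i)"
  unfolding georay_def geo_def by blast

lemma dual_georay: "path_metric.georay (\<lambda>n x y. dle n y x) = anti_georay"
  unfolding path_metric.georay_iff[OF dual_path_metric] anti_georay_def dual_reach dual_dst by blast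

lemma dual_fellow_travel: "path_metric.fellow_travel (\<lambda>n x y. dle n y x) = fellow_travel"
  unfolding path_metric.fellow_travel_def[OF dual_path_metric] fellow_travel_def by (intro ext) blast

lemma dual_proper: "path_metric.proper (\<lambda>n x y. dle n y x) = proper"
  unfolding path_metric.proper_def[OF dual_path_metric] proper_def by (intro ext) blast

lemma fellow_travel_sym: "fellow_travel X Y \<Longrightarrow> fellow_travel Y X"
  unfolding fellow_travel_def by blast

lemma fellow_travel_trans:
  assumes "fellow_travel X Y" "fellow_travel Y Z"
  shows "fellow_travel X Z"
proof -
  obtain K where K: "\<And>i. \<exists>j. dle K (X i) (Y j)" "\<And>i. \<exists>j. dle K (Y j) (X i)"
    "\<And>j. \<exists>i. dle K (X i) (Y j)" "\<And>j. \<exists>i. dle K (Y j) (X i)"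
    using assms(1) unfolding fellow_travel_def by blast
  obtain L where L: "\<And>i. \<exists>j. dle L (Y i) (Z j)" "\<And>i. \<exists>j. dle L (Z j) (Y i)"
    "\<And>j. \<exists>i. dle L (Y i) (Z j)" "\<And>j. \<exists>i. dle L (Z j) (Y i)"
    using assms(2) unfolding fellow_travel_def by blast
  have "\<exists>j. dle (K + L) (X i) (Z j)" for i using K(1) L(1) dle_trans by meson
  moreover have "\<exists>j. dle (K + L) (Z j) (X i)" for i
    using K(2) L(2) dle_trans by (metis add.commute)
  moreover have "\<exists>i. dle (K + L) (X i) (Z j)" for j using K(3) L(3) dle_trans by meson
  moreover have "\<exists>i. dle (K + L) (Z j) (X i)" for j
    using K(4) L(4) dle_trans by (metis add.commute)
  ultimately show ?thesis unfolding fellow_travel_def by blast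
qed

lemma coarse_ray_reach:
  assumes "coarse_ray c X" "i \<le> j"
  shows "reach (X i) (X j)"
  using assms(2)
proof (induction rule: dec_induct)
  case base
  have "dle c (X i) (X (Suc i))" using assms(1) unfolding coarse_ray_def by blast
  then show ?case using reachI reach_refl by blast
next
  case (step j)
  have "dle c (X j) (X (Suc j))" using assms(1) unfolding coarse_ray_def by blast
  then show ?case using reachI reach_trans step by blast
qed

lemma quasi_ray_coarse:
  assumes "quasi_ray c X"
  shows "coarse_ray (c + 1) X"
  unfolding coarse_ray_def
proof (intro conjI allI impI)
  fix i
  have "quasi_geo c X (Suc i)" using assms unfolding quasi_ray_def by blast
  then have "dle 1 (X i) (X (Suc i))" unfolding quasi_geo_def by blast
  then show "dle (c + 1) (X i) (X (Suc i))" by (rule dle_mono) simp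
next
  fix i j m assume a: "i \<le> j \<and> dle m (X i) (X j)"
  have "quasi_geo c X j" using assms unfolding quasi_ray_def by blast
  then have "j - i \<le> c * m + c" using quasi_geo_gap a by blast
  then show "j - i \<le> (c + 1) * m + (c + 1)" by simp
qed

lemma georay_coarse: "georay S \<Longrightarrow> coarse_ray 1 S"
  unfolding coarse_ray_def georay_iff
  by (auto simp: dle_iff)

lemma finite_nat_of_diam:
  fixes A :: "nat set"
  assumes "\<And>i j. i \<in> A \<Longrightarrow> j \<in> A \<Longrightarrow> i \<le> j \<Longrightarrow> j - i \<le> m"
  shows "finite A"
proof (cases "A = {}")
  case False
  then obtain a where a: "a \<in> A" by blast
  have "A \<subseteq> {..a + m}"
  proof
    fix j assume "j \<in> A"
    then show "j \<in> {..a + m}" using assms[OF a, of j] by (cases "a \<le> j") auto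
  qed
  then show ?thesis by (rule finite_subset) simp
qed simp

end

context hyperbolic_space
begin

lemma coarse_ray_proper:
  assumes X: "coarse_ray c X"
  shows "proper X"
  unfolding proper_def
proof (intro allI conjI)
  fix x r
  have gap: "j - i \<le> c * m + c" if "i \<le> j" "dle m (X i) (X j)" for i j m
    using X that unfolding coarse_ray_def by blast
  show "finite {i. dle r x (X i)}"
  proof (rule finite_nat_of_diam)
    fix i j assume "i \<in> {i. dle r x (X i)}" "j \<in> {i. dle r x (X i)}" "i \<le> j"
    then show "j - i \<le> c * h r + c"
      using bound_out[of r x "X i" "X j"] coarse_ray_reach[OF X] gap by simp
  qed
  show "finite {i. dle r (X i) x}"
  proof (rule finite_nat_of_diam)
    fix i j assume "i \<in> {i. dle r (X i) x}" "j \<in> {i. dle r (X i) x}" "i \<le> j"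
    then show "j - i \<le> c * h r + c"
      using bound_in[of r "X i" x "X j"] coarse_ray_reach[OF X] gap by simp
  qed
qed

lemma finite_out_balls:
  assumes "\<And>x. finite {y. dle 1 x y}"
  shows "finite {y. dle r x y}"
proof (induction r)
  case 0
  have "{y. dle 0 x y} \<subseteq> {x}" using dle_0 by blast
  then show ?case using finite_subset by blast
next
  case (Suc r)
  have "{y. dle (Suc r) x y} \<subseteq> (\<Union>z\<in>{z. dle r x z}. {y. dle 1 z y})"
    using dle_split[of r 1 x] by auto
  then show ?case by (rule finite_subset) (use Suc assms in blast)
qed

text \<open>
  Koenig's lemma: infinitely many of the geodesics agree up to a given length, and nested infinite index
  sets \<open>A m\<close> pick the agreeing ones.
\<close>

lemma limit_georay:
  fixes P :: "nat \<Rightarrow> nat \<Rightarrow> 'a"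
  assumes fin: "\<And>x. finite {y. dle 1 x y}"
    and P: "\<And>n. geo (P n) (len n)" "\<And>n. P n 0 = x" and len: "\<And>m. finite {n. len n < m}"
  shows "\<exists>S. georay S \<and> (\<forall>m. infinite {n. m \<le> len n \<and> (\<forall>k\<le>m. P n k = S k)})"
proof -
  define good where "good m A \<longleftrightarrow> infinite A \<and> (\<forall>n\<in>A. m \<le> len n) \<and> (\<exists>y. \<forall>n\<in>A. P n m = y)"
    for m and A :: "nat set"
  have "\<exists>A. \<forall>m. good m (A m) \<and> A (Suc m) \<subseteq> A m"
  proof (rule dependent_nat_choice)
    show "\<exists>A. good 0 A" unfolding good_def using P(2) by (intro exI[of _ UNIV]) auto
  next
    fix A m assume A: "good m A"
    define B where "B = A - {n. len n < Suc m}"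
    have B: "infinite B" "B \<subseteq> A" "\<And>n. n \<in> B \<Longrightarrow> Suc m \<le> len n"
      using A len[of "Suc m"] unfolding B_def good_def by auto
    have "(\<lambda>n. P n (Suc m)) ` B \<subseteq> {y. dle (Suc m) x y}"
      using geo_dle[OF P(1), of 0 "Suc m"] B(3) unfolding P(2) by auto
    then have "finite ((\<lambda>n. P n (Suc m)) ` B)" using finite_out_balls[OF fin] finite_subset by blast
    from pigeonhole_infinite[OF B(1) this]
    obtain n0 where "infinite {n \<in> B. P n (Suc m) = P n0 (Suc m)}" by blast
    then have "good (Suc m) {n \<in> B. P n (Suc m) = P n0 (Suc m)}"
      unfolding good_def using B(3) by auto
    then show "\<exists>A'. good (Suc m) A' \<and> A' \<subseteq> A" using B(2) by blast
  qed
  then obtain A where A: "\<And>m. good m (A m)" "\<And>m. A (Suc m) \<subseteq> A m" by blast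
  have mono: "A m \<subseteq> A k" if "k \<le> m" for k m
    using that by (induction rule: dec_induct) (use A(2) in blast)+
  have "\<forall>m. \<exists>y. \<forall>n\<in>A m. P n m = y" using A(1) unfolding good_def by blast
  from choice[OF this] obtain S where S: "\<And>m n. n \<in> A m \<Longrightarrow> P n m = S m" by blast
  have sub: "A m \<subseteq> {n. m \<le> len n \<and> (\<forall>k\<le>m. P n k = S k)}" for m
  proof
    fix n assume n: "n \<in> A m"
    have "P n k = S k" if "k \<le> m" for k using S mono[OF that] n by blast
    moreover have "m \<le> len n" using A(1)[of m] n unfolding good_def by blast
    ultimately show "n \<in> {n. m \<le> len n \<and> (\<forall>k\<le>m. P n k = S k)}" by simp
  qed
  have inf: "infinite {n. m \<le> len n \<and> (\<forall>k\<le>m. P n k = S k)}" for m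
  proof -
    have "infinite (A m)" using A(1)[of m] unfolding good_def by simp
    then show ?thesis using infinite_super[OF sub] by simp
  qed
  have "georay S" unfolding georay_iff
  proof (intro allI impI)
    fix i j :: nat assume ij: "i \<le> j"
    obtain n where n: "j \<le> len n" "\<forall>k\<le>j. P n k = S k"
      using inf[of j] by (metis (mono_tags, lifting) empty_Collect_eq finite.emptyI)
    then show "reach (S i) (S j) \<and> dst (S i) (S j) = j - i"
      using geo_reach[OF P(1) ij n(1)] geo_dst[OF P(1) ij n(1)] ij by auto
  qed
  then show ?thesis using inf by blast
qed

text \<open>
  The limit of geodesics from \<open>Q 0\<close> to \<open>Q n\<close>; stability applies to each of them with the same constant.
\<close>

lemma quasi_ray_fellow_travel_georay:
  assumes fin: "\<And>x. finite {y. dle 1 x y}" and Q: "quasi_ray c Q"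
  shows "\<exists>S. georay S \<and> fellow_travel S Q"
proof -
  have Qn: "quasi_geo c Q n" for n using Q unfolding quasi_ray_def by blast
  note X = quasi_ray_coarse[OF Q]
  have dQ: "dle n (Q 0) (Q n)" for n
    using quasi_geo_dle[OF Qn[of "Suc n"], of 0 n] by simp
  define len where "len n = dst (Q 0) (Q n)" for n
  have "\<exists>P. geo P (len n) \<and> P 0 = Q 0 \<and> P (len n) = Q n" for n
    unfolding len_def using ex_geo dQ reachI by blast
  then obtain P where P: "\<And>n. geo (P n) (len n)" "\<And>n. P n 0 = Q 0" "\<And>n. P n (len n) = Q n"
    by metis
  have fl: "finite {n. len n < m}" for m
  proof (rule finite_subset)
    show "{n. len n < m} \<subseteq> {i. dle m (Q 0) (Q i)}"
      using dQ reachI dle_iff unfolding len_def by auto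
    show "finite {i. dle m (Q 0) (Q i)}" using coarse_ray_proper[OF X] unfolding proper_def by blast
  qed
  from limit_georay[where P = P and len = len and x = "Q 0", OF fin P(1) P(2) fl]
  obtain S where S0: "georay S \<and> (\<forall>m. infinite {n. m \<le> len n \<and> (\<forall>k\<le>m. P n k = S k)})" ..
  then have S: "georay S" "\<And>m. infinite {n. m \<le> len n \<and> (\<forall>k\<le>m. P n k = S k)}" by simp_all
  from geodesic_stability[of c] obtain K where K0: "\<forall>Q n P len. quasi_geo c Q n \<and> geo P len \<and> P 0 = Q 0 \<and> P len = Q n \<longrightarrow>
     (\<forall>k\<le>len. \<exists>i\<le>n. dle K (P k) (Q i)) \<and> (\<forall>k\<le>len. \<exists>i\<le>n. dle K (Q i) (P k)) \<and>
     (\<forall>i\<le>n. \<exists>k\<le>len. dle K (P k) (Q i)) \<and> (\<forall>i\<le>n. \<exists>k\<le>len. dle K (Q i) (P k))" ..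
  have hyp: "quasi_geo c Q n \<and> geo (P n) (len n) \<and> P n 0 = Q 0 \<and> P n (len n) = Q n" for n
    by (intro conjI Qn P)
  note K1 = K0[THEN spec, THEN spec, THEN spec, THEN spec, THEN mp, OF hyp]
  have K: "\<And>n k. k \<le> len n \<Longrightarrow> \<exists>i\<le>n. dle K (P n k) (Q i)"
    "\<And>n k. k \<le> len n \<Longrightarrow> \<exists>i\<le>n. dle K (Q i) (P n k)"
    "\<And>n i. i \<le> n \<Longrightarrow> \<exists>k\<le>len n. dle K (P n k) (Q i)"
    "\<And>n i. i \<le> n \<Longrightarrow> \<exists>k\<le>len n. dle K (Q i) (P n k)"
    using K1[THEN conjunct1] K1[THEN conjunct2, THEN conjunct1]
      K1[THEN conjunct2, THEN conjunct2, THEN conjunct1]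
      K1[THEN conjunct2, THEN conjunct2, THEN conjunct2] by simp_all
  have large: "\<exists>n\<ge>i. m \<le> len n \<and> (\<forall>k\<le>m. P n k = S k)" for m i
  proof -
    have "\<exists>n\<ge>i. n \<in> {n. m \<le> len n \<and> (\<forall>k\<le>m. P n k = S k)}"
      using S(2)[of m] unfolding infinite_nat_iff_unbounded_le by blast
    then show ?thesis by simp
  qed
  have 1: "\<exists>j. dle K (S i) (Q j)" "\<exists>j. dle K (Q j) (S i)" for i
  proof -
    obtain n where n: "i \<le> len n" "\<forall>k\<le>i. P n k = S k" using large[of 0 i] by blast
    then have e: "P n i = S i" by simp
    show "\<exists>j. dle K (S i) (Q j)" using K(1)[OF n(1)] unfolding e by blast
    show "\<exists>j. dle K (Q j) (S i)" using K(2)[OF n(1)] unfolding e by blast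
  qed
  \<comment> \<open>A point of \<open>P n\<close> close to \<open>Q i\<close> has bounded distance from \<open>Q 0\<close>, so it lies on the part of
    \<open>P n\<close> that agrees with \<open>S\<close> if \<open>n\<close> is chosen suitably.\<close>
  have 2: "\<exists>j. dle K (S j) (Q i)" for i
  proof -
    define m where "m = H (K + i)"
    obtain n where n: "i \<le> n" "m \<le> len n" "\<forall>k\<le>m. P n k = S k" using large by blast
    obtain k where k: "k \<le> len n" "dle K (P n k) (Q i)" using K(3)[OF n(1)] by blast
    have r: "reach (Q 0) (P n k)" using geo_reach[OF P(1) _ k(1), of 0] P(2) by simp
    have "dle m (Q 0) (P n k)" unfolding m_def
      by (rule linear_bound_in[OF dle_mono[OF dQ[of i]] dle_mono[OF k(2)] r]) simp_all
    then have "k \<le> m" using dst_le geo_dst[OF P(1) _ k(1), of 0] P(2) by fastforce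
    then have "P n k = S k" using n(3) by simp
    then show ?thesis using k(2) by metis
  qed
  have 3: "\<exists>j. dle K (Q i) (S j)" for i
  proof -
    define m where "m = i + K"
    obtain n where n: "i \<le> n" "m \<le> len n" "\<forall>k\<le>m. P n k = S k" using large by blast
    obtain k where k: "k \<le> len n" "dle K (Q i) (P n k)" using K(4)[OF n(1)] by blast
    have "dle m (Q 0) (P n k)" unfolding m_def using dle_trans dQ k(2) by blast
    then have "k \<le> m" using dst_le geo_dst[OF P(1) _ k(1), of 0] P(2) by fastforce
    then have "P n k = S k" using n(3) by simp
    then show ?thesis using k(2) by metis
  qed
  have "fellow_travel S Q" unfolding fellow_travel_def using 1 2 3 by blast
  then show ?thesis using S(1) by blast
qed

end

context hyperbolic_space
begin

text \<open>
  Join consecutive points by paths with a fixed number of steps, then erase loops.  A loop has bounded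
  length because its ends coincide, so erasing it changes neither the constants nor the
  position by more than a bounded amount.
\<close>

lemma coarse_ray_refine:
  assumes X: "coarse_ray c X"
  shows "\<exists>c' Q. quasi_ray c' Q \<and> inj Q \<and> fellow_travel Q X"
proof -
  have step: "dle (c + 1) (X i) (X (Suc i))" for i
    using X dle_mono[of c "X i" "X (Suc i)" "c + 1"] unfolding coarse_ray_def by simp
  have gap: "j - i \<le> c * m + c" if "i \<le> j" "dle m (X i) (X j)" for i j m
    using X that unfolding coarse_ray_def by blast
  let ?d = "c + 1"
  have "\<exists>P. P 0 = X i \<and> P ?d = X (Suc i) \<and> (\<forall>k<?d. dle 1 (P k) (P (Suc k)))" for i
    using ex_lazy_path[OF step] .
  then obtain P where P: "\<And>i. P i 0 = X i" "\<And>i. P i ?d = X (Suc i)"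
    "\<And>i k. k < ?d \<Longrightarrow> dle 1 (P i k) (P i (Suc k))" by metis
  define W where "W t = P (t div ?d) (t mod ?d)" for t
  have W_step: "dle 1 (W t) (W (Suc t))" for t
  proof -
    have "W (Suc t) = P (t div ?d) (Suc (t mod ?d))"
    proof (cases "Suc (t mod ?d) = ?d")
      case True
      then show ?thesis unfolding W_def using P(1)[of "Suc (t div ?d)"] P(2)[of "t div ?d"]
        by (simp add: mod_Suc div_Suc)
    next
      case False
      then show ?thesis unfolding W_def by (simp add: mod_Suc div_Suc)
    qed
    then show ?thesis using P(3)[of "t mod ?d" "t div ?d"] unfolding W_def by simp
  qed
  have PX: "dle ?d (X i) (P i k) \<and> dle ?d (P i k) (X (Suc i))" if k: "k \<le> ?d" for i k
  proof -
    have s: "dle (b - a) (P i a) (P i b)" if "a < b" "b \<le> ?d" for a b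
      by (rule dle_steps[where P = "P i" and a = 0 and b = ?d]) (use P(3) that in auto)
    have "dle 0 (X i) (X i)" "dle 0 (X (Suc i)) (X (Suc i))" using dle_refl step by blast+
    then have "dle k (X i) (P i k)" "dle (?d - k) (P i k) (X (Suc i))"
      using s[of 0 k] s[of k ?d] P(1,2) k dle_mono by (cases "k = 0"; cases "k = ?d"; auto)+
    then show ?thesis using dle_mono[of k "X i" "P i k" ?d] dle_mono[of "?d - k" _ _ ?d] k by simp
  qed
  have XW: "dle ?d (X (t div ?d)) (W t)" "dle ?d (W t) (X (Suc (t div ?d)))" for t
    using PX[of "t mod ?d" "t div ?d"] unfolding W_def by simp_all
  have WX: "W (i * ?d) = X i" for i
  proof -
    have "i * ?d div ?d = i" "i * ?d mod ?d = 0" by (simp_all only: nonzero_mult_div_cancel_right mod_mult_self2_is_0)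
    then show ?thesis unfolding W_def using P(1) by (simp only:)
  qed
  define C where "C = ?d * (c * (2 * ?d) + c + c)"
  have W_gap: "t - s \<le> C * m + C" if st: "s \<le> t" "dle m (W s) (W t)" for s t m
  proof -
    let ?i = "s div ?d" and ?j = "t div ?d"
    have ij: "?i \<le> Suc ?j" using div_le_mono[OF st(1), of ?d] by simp
    have "dle (?d + (m + ?d)) (X ?i) (X (Suc ?j))"
      using dle_trans[OF XW(1)[of s] dle_trans[OF st(2) XW(2)[of t]]] .
    then have g: "Suc ?j - ?i \<le> c * (?d + (m + ?d)) + c" using gap[OF ij] by blast
    have "t < Suc ?j * ?d" "?i * ?d \<le> s"
      using dividend_less_div_times[of ?d t] div_times_less_eq_dividend[of s ?d]
      by (simp_all add: algebra_simps)
    then have "t - s \<le> Suc ?j * ?d - ?i * ?d" by linarith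
    also have "\<dots> = (Suc ?j - ?i) * ?d" by (simp only: diff_mult_distrib)
    also have "\<dots> \<le> (c * (?d + (m + ?d)) + c) * ?d" using g by (rule mult_le_mono1)
    also have "\<dots> \<le> C * m + C"
    proof -
      have "(c * (?d + (m + ?d)) + c) * ?d = ?d * c * m + ?d * (c * (2 * ?d) + c)"
        by (simp add: algebra_simps)
      moreover have "?d * c * m \<le> C * m" unfolding C_def by (intro mult_le_mono1 mult_le_mono2) simp
      moreover have "?d * (c * (2 * ?d) + c) \<le> C" unfolding C_def by (intro mult_le_mono2) simp
      ultimately show ?thesis by linarith
    qed
    finally show ?thesis .
  qed
  have W_refl: "dle 0 (W t) (W t)" for t using dle_refl W_step by blast
  have W_dle: "dle (t - s) (W s) (W t)" if "s \<le> t" for s t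
  proof (cases "s = t")
    case False
    show ?thesis
      by (rule dle_steps[where P = W and a = 0 and b = t]) (use that False W_step in auto)
  qed (use W_refl in simp)
  \<comment> \<open>Erasing loops: from each vertex the walk continues after its last visit there.\<close>
  define L where "L s = Max {t. W t = W s}" for s
  have fin: "finite {t. W t = W s}" for s
  proof (rule finite_nat_of_diam)
    fix i j assume "i \<in> {t. W t = W s}" "j \<in> {t. W t = W s}" "i \<le> j"
    then show "j - i \<le> C" using W_gap[of i j 0] W_refl[of s] by simp
  qed
  have L: "W (L s) = W s" "s \<le> L s" "L s - s \<le> C" and L_max: "\<And>t. W t = W s \<Longrightarrow> t \<le> L s" for s
  proof -
    have "L s \<in> {t. W t = W s}" unfolding L_def by (rule Max_in) (use fin in auto)
    then show 1: "W (L s) = W s" by simp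
    show m: "t \<le> L s" if "W t = W s" for t unfolding L_def using Max_ge[OF fin] that by blast
    show "s \<le> L s" using m[of s] by simp
    then show "L s - s \<le> C" using W_gap[of s "L s" 0] W_refl[of s] 1 by simp
  qed
  define \<tau> where "\<tau> = rec_nat (L 0) (\<lambda>_ t. L (Suc t))"
  have \<tau>: "\<tau> 0 = L 0" "\<And>n. \<tau> (Suc n) = L (Suc (\<tau> n))" unfolding \<tau>_def by simp_all
  have \<tau>_Suc: "\<tau> n < \<tau> (Suc n)" for n using L(2)[of "Suc (\<tau> n)"] \<tau>(2) by simp
  then have \<tau>_mono: "strict_mono \<tau>" by (simp add: strict_mono_Suc_iff)
  have last: "t \<le> \<tau> n" if "W t = W (\<tau> n)" for t n
  proof (cases n)
    case 0
    then show ?thesis using L_max[of t 0] L(1)[of 0] that \<tau>(1) by simp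
  next
    case (Suc k)
    then show ?thesis using L_max[of t "Suc (\<tau> k)"] L(1)[of "Suc (\<tau> k)"] that \<tau>(2) by simp
  qed
  define Q where "Q n = W (\<tau> n)" for n
  have "inj Q"
  proof (rule injI)
    fix i j assume "Q i = Q j"
    then have "\<tau> i = \<tau> j" using last[of "\<tau> i" j] last[of "\<tau> j" i] unfolding Q_def by simp
    then show "i = j" using strict_mono_eq[OF \<tau>_mono] by blast
  qed
  moreover have "quasi_ray C Q"
    unfolding quasi_ray_def quasi_geo_def
  proof (intro allI conjI impI)
    fix i
    have "W (\<tau> (Suc i)) = W (Suc (\<tau> i))" using L(1) \<tau>(2) by simp
    then show "dle 1 (Q i) (Q (Suc i))" unfolding Q_def using W_step[of "\<tau> i"] by simp
  next
    fix n i j m assume a: "i \<le> j \<and> j \<le> n \<and> dle m (Q i) (Q j)"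
    then have "\<tau> j - \<tau> i \<le> C * m + C"
      using W_gap[of "\<tau> i" "\<tau> j" m] strict_mono_less_eq[OF \<tau>_mono] unfolding Q_def by simp
    moreover have "j - i \<le> \<tau> j - \<tau> i"
    proof -
      have "\<tau> i + k \<le> \<tau> (i + k)" for k
      proof (induction k)
        case (Suc k)
        then show ?case using \<tau>_Suc[of "i + k"] by simp
      qed simp
      from this[of "j - i"] show ?thesis using a by simp
    qed
    ultimately show "j - i \<le> C * m + C" by linarith
  qed
  moreover have "fellow_travel Q X"
  proof -
    define K where "K = C + 1 + ?d"
    have QX: "dle K (X (\<tau> n div ?d)) (Q n)" "dle K (Q n) (X (Suc (\<tau> n div ?d)))" for n
      unfolding Q_def K_def using dle_mono[OF XW(1)[of "\<tau> n"]] dle_mono[OF XW(2)[of "\<tau> n"]] by simp_all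
    \<comment> \<open>Every \<open>W t\<close> lies between two visited times whose gap is at most \<open>C + 1\<close>.\<close>
    have near: "(\<exists>n. dle (C + 1) (Q n) (W t)) \<and> (\<exists>n. dle (C + 1) (W t) (Q n))" for t
    proof -
      define n where "n = (LEAST n. t \<le> \<tau> n)"
      have "t \<le> \<tau> t" using strict_mono_imp_increasing[OF \<tau>_mono] .
      then have n: "t \<le> \<tau> n" unfolding n_def by (rule LeastI)
      obtain s where s: "s \<le> t" "\<tau> n - s \<le> C + 1" "\<exists>k. Q k = W s"
      proof (cases n)
        case 0
        then have "Q 0 = W 0" "\<tau> n - 0 \<le> C + 1" using L(1,3)[of 0] \<tau>(1) unfolding Q_def by auto
        then show thesis using that[of 0] by blast
      next
        case (Suc k)
        then have "\<not> t \<le> \<tau> k" using not_less_Least[of k "\<lambda>n. t \<le> \<tau> n"] unfolding n_def by simp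
        moreover have "\<tau> n - \<tau> k \<le> C + 1" using L(3)[of "Suc (\<tau> k)"] \<tau>(2)[of k] Suc by simp
        ultimately show thesis using that[of "\<tau> k"] unfolding Q_def by auto
      qed
      have "dle (C + 1) (W s) (W t)" "dle (C + 1) (W t) (W (\<tau> n))"
        using dle_mono[OF W_dle[OF s(1)]] dle_mono[OF W_dle[OF n]] s n by simp_all
      then show ?thesis using s(3) unfolding Q_def by metis
    qed
    have "\<exists>n. dle K (Q n) (X i)" "\<exists>n. dle K (X i) (Q n)" for i
      using near[of "i * ?d"] dle_mono[where n = K] unfolding WX K_def by (meson le_add1)+
    then show ?thesis using QX unfolding fellow_travel_def by blast
  qed
  ultimately show ?thesis by blast
qed

end

section \<open>The order on rays and anti-rays\<close>

context path_metric
begin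

lemma leads_swap:
  assumes "proper X" "leads X Y"
  shows "\<exists>L. infinite {j. \<exists>i. dle L (X i) (Y j)}"
proof -
  obtain L where L: "infinite {i. \<exists>j. dle L (X i) (Y j)}" using assms(2) unfolding leads_def by blast
  have "infinite {j. \<exists>i. dle L (X i) (Y j)}"
  proof
    assume fin: "finite {j. \<exists>i. dle L (X i) (Y j)}"
    have "{i. \<exists>j. dle L (X i) (Y j)} \<subseteq> (\<Union>j\<in>{j. \<exists>i. dle L (X i) (Y j)}. {i. dle L (X i) (Y j)})"
      by blast
    moreover have "finite \<dots>" using fin assms(1) unfolding proper_def by blast
    ultimately show False using L finite_subset by blast
  qed
  then show ?thesis by blast
qed

lemma leads_iff_swapped:
  assumes "proper X" "proper Y"
  shows "leads X Y \<longleftrightarrow> (\<exists>L. infinite {j. \<exists>i. dle L (X i) (Y j)})"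
proof
  assume "\<exists>L. infinite {j. \<exists>i. dle L (X i) (Y j)}"
  then have "path_metric.leads (\<lambda>n x y. dle n y x) Y X"
    unfolding path_metric.leads_def[OF dual_path_metric] .
  then show "leads X Y"
    using path_metric.leads_swap[OF dual_path_metric, of Y X] assms(2)
    unfolding dual_proper leads_def by blast
qed (use leads_swap assms in blast)

lemma leads_dual:
  assumes "proper X" "proper Y"
  shows "path_metric.leads (\<lambda>n x y. dle n y x) Y X \<longleftrightarrow> leads X Y"
  unfolding path_metric.leads_def[OF dual_path_metric] leads_iff_swapped[OF assms] ..

lemma leads_cofinal:
  assumes "proper X" "leads X Y"
  shows "\<exists>M. \<forall>n m. \<exists>i\<ge>n. \<exists>j\<ge>m. dle M (X i) (Y j)"
proof -
  obtain M where M: "infinite {i. \<exists>j. dle M (X i) (Y j)}" using assms(2) unfolding leads_def by blast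
  have "\<exists>i\<ge>n. \<exists>j\<ge>m. dle M (X i) (Y j)" for n m
  proof -
    have "finite (\<Union>j\<in>{..<m}. {i. dle M (X i) (Y j)})" using assms(1) unfolding proper_def by blast
    then have "infinite ({i. \<exists>j. dle M (X i) (Y j)} - (\<Union>j\<in>{..<m}. {i. dle M (X i) (Y j)}))"
      using M by (rule Diff_infinite_finite)
    then obtain i where "i \<ge> n" "i \<in> {i. \<exists>j. dle M (X i) (Y j)} - (\<Union>j\<in>{..<m}. {i. dle M (X i) (Y j)})"
      unfolding infinite_nat_iff_unbounded_le by blast
    then obtain j where j: "n \<le> i" "dle M (X i) (Y j)" "\<not> j < m" by blast
    then have "m \<le> j" by simp
    then show ?thesis using j by blast
  qed
  then show ?thesis by blast
qed

text \<open>
  Only one of the two relations has to hold for almost all points of \<open>Y\<close>; for the other one infinitely many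
  suffice.
\<close>

lemma leads_chain:
  assumes "proper Y" and XY: "infinite {j. \<exists>i. dle L (X i) (Y j)}"
    and YZ: "\<And>j. n \<le> j \<Longrightarrow> \<exists>k. dle K (Y j) (Z k)"
  shows "infinite {k. \<exists>i. dle (L + K) (X i) (Z k)}"
proof
  assume fin: "finite {k. \<exists>i. dle (L + K) (X i) (Z k)}"
  have "{j. \<exists>i. dle L (X i) (Y j)} \<subseteq>
      {..<n} \<union> (\<Union>k\<in>{k. \<exists>i. dle (L + K) (X i) (Z k)}. {j. dle K (Y j) (Z k)})"
  proof
    fix j assume "j \<in> {j. \<exists>i. dle L (X i) (Y j)}"
    then obtain i where i: "dle L (X i) (Y j)" by blast
    show "j \<in> {..<n} \<union> (\<Union>k\<in>{k. \<exists>i. dle (L + K) (X i) (Z k)}. {j. dle K (Y j) (Z k)})"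
    proof (cases "n \<le> j")
      case True
      then obtain k where "dle K (Y j) (Z k)" using YZ by blast
      then show ?thesis using dle_trans[OF i] by blast
    qed auto
  qed
  moreover have "finite \<dots>" using fin assms(1) unfolding proper_def by blast
  ultimately show False using XY finite_subset by blast
qed

lemma leads_fellow_travel_right:
  assumes "fellow_travel Y S" "leads X Y"
  shows "leads X S"
proof -
  obtain L where L: "infinite {i. \<exists>j. dle L (X i) (Y j)}" using assms(2) unfolding leads_def by blast
  obtain K where K: "\<And>i. \<exists>j. dle K (Y i) (S j)" using assms(1) unfolding fellow_travel_def by blast
  have "{i. \<exists>j. dle L (X i) (Y j)} \<subseteq> {i. \<exists>j. dle (L + K) (X i) (S j)}"
    using K dle_trans by blast
  then show ?thesis unfolding leads_def using L finite_subset by blast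
qed

lemma leads_fellow_travel_left:
  assumes "fellow_travel Y S" "proper X" "proper Y" "proper S" "leads Y X"
  shows "leads S X"
proof -
  interpret dual: path_metric "\<lambda>n x y. dle n y x" by (rule dual_path_metric)
  show ?thesis
    using dual.leads_fellow_travel_right[of Y S X] assms unfolding dual_fellow_travel
    by (simp add: leads_dual)
qed

lemma antigeo_between:
  assumes "anti_georay S" "i \<le> j" "j \<le> k"
  shows "between (S k) (S j) (S i)"
proof -
  have "reach (S k) (S j) \<and> dst (S k) (S j) = k - j" "reach (S j) (S i) \<and> dst (S j) (S i) = j - i"
    "dst (S k) (S i) = k - i"
    using assms unfolding anti_georay_def by simp_all
  then show ?thesis using assms(2,3) unfolding between_def by simp
qed

lemma anti_georay_segment:
  assumes "anti_georay S" "i \<le> j"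
  shows "geodesic_set (S ` {i..j}) (S j) (S i)"
proof -
  interpret dual: path_metric "\<lambda>n x y. dle n y x" by (rule dual_path_metric)
  have "dual.georay S" using assms(1) unfolding dual_georay .
  then have "dual.geo S j" unfolding dual.georay_def by blast
  from dual.geodesic_set_sub[OF this assms(2) order_refl] show ?thesis
    unfolding dual_geodesic_set .
qed

lemma georay_segment:
  assumes "georay S" "i \<le> j"
  shows "geodesic_set (S ` {i..j}) (S i) (S j)"
  using geodesic_set_sub[of S j i j] assms unfolding georay_def by simp

end

context hyperbolic_space
begin

text \<open>
  A triangle with a fixed short side from \<open>x\<close> to \<open>S t0\<close> whose third point moves along \<open>S\<close>.  A ray \<open>S\<close> is traversed
  from \<open>S t0\<close> to \<open>S t\<close>, an anti-ray from \<open>S t\<close> to \<open>S t0\<close>.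
\<close>

lemma segment_to_end:
  assumes S: "georay S \<or> anti_georay S" and t: "t0 \<le> t" and x: "dle M x (S t0)"
    and u: "between x u (S t)"
  shows "dle (M + \<delta>) x u \<or> (\<exists>j. dle \<delta> u (S j))"
proof -
  obtain A where A: "geodesic_set A x (S t0)" using ex_geodesic_set x reachI by blast
  have Ax: "dle M x v" if "v \<in> A" for v
    using between_dle(1)[OF geodesic_set_between[OF A that] x] .
  have "(\<exists>v\<in>A. dle \<delta> v u) \<or> (\<exists>v\<in>S ` {t0..t}. dle \<delta> u v)"
    using S
  proof
    assume "georay S"
    then show ?thesis using thin_long[OF A georay_segment[OF _ t] u] by blast
  next
    assume "anti_georay S"
    then show ?thesis using thin_first[OF A anti_georay_segment[OF _ t] u] by blast
  qed
  then show ?thesis using Ax dle_trans by blast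
qed

text \<open>
  Given two links from \<open>R\<close> to \<open>S\<close>, an early one at \<open>s0\<close> and one at \<open>s\<close>, far out, compare the segment of \<open>R\<close> with a
  geodesic from \<open>R s0\<close> to the target of the far link and that geodesic with \<open>S\<close>.  The exceptions are
  points that are close to the early link.
\<close>

lemma georay_leads_eventually:
  assumes R: "georay R" and S: "georay S \<or> anti_georay S" and RS: "leads R S" and pR: "proper R"
  shows "\<exists>K n. \<forall>i\<ge>n. \<exists>j. dle K (R i) (S j)"
proof -
  obtain M where M: "\<And>n m. \<exists>i\<ge>n. \<exists>j\<ge>m. dle M (R i) (S j)"
    using leads_cofinal[OF pR RS] by blast
  obtain s0 t0 where s0: "dle M (R s0) (S t0)" using M by blast
  have Rr: "reach (R i) (R j)" "dst (R i) (R j) = j - i" if "i \<le> j" for i j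
    using R that unfolding georay_iff by blast+
  define B where "B = H (M + \<delta> + \<kappa> \<delta>)"
  have "\<exists>j. dle (M + \<kappa> \<delta> + \<delta>) (R i) (S j)" if i: "s0 + B + 1 \<le> i" for i
  proof -
    obtain s t where st: "i \<le> s" "t0 \<le> t" "dle M (R s) (S t)" using M by blast
    have b: "between (R s0) (R i) (R s)"
      using geo_between[of R s s0 i s] R i st(1) unfolding georay_def by simp
    have xy: "reach (R s0) (S t)" and ry: "reach (R i) (S t)"
      using reach_trans[OF Rr(1)[of s0 s] reachI[OF st(3)]]
        reach_trans[OF Rr(1)[of i s] reachI[OF st(3)]] st(1) i by simp_all
    obtain G n where G: "geo G n" "G 0 = R s0" "G n = S t" using ex_geo[OF xy] by blast
    have GS: "geodesic_set (G ` {..n}) (R s0) (S t)" using geodesic_setI[OF G(1)] unfolding G(2,3) .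
    obtain C where C: "geodesic_set C (R s) (S t)" using ex_geodesic_set reachI[OF st(3)] by blast
    from thin_first[OF GS C b] show ?thesis
    proof (elim disjE bexE)
      fix v assume v: "v \<in> C" "dle \<delta> (R i) v"
      have "dle M v (S t)" using between_dle(2)[OF geodesic_set_between[OF C v(1)] st(3)] .
      then have "dle (\<delta> + M) (R i) (S t)" using dle_trans v(2) by blast
      then have "dle (M + \<kappa> \<delta> + \<delta>) (R i) (S t)" by (rule dle_mono) simp
      then show ?thesis by blast
    next
      fix v assume v: "v \<in> G ` {..n}" "dle \<delta> v (R i)"
      then obtain l where l: "l \<le> n" "dle \<delta> (G l) (R i)" by blast
      obtain j where j: "j \<le> n" "dle (\<kappa> \<delta>) (R i) (G j)"
        using return_to_geodesic[OF G(1) l] ry unfolding G(3) by blast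
      have bj: "between (R s0) (G j) (S t)"
        using geo_between[OF G(1), of 0 j n] j(1) unfolding G(2,3) by simp
      from segment_to_end[OF S st(2) s0 bj] show ?thesis
      proof (elim disjE exE)
        assume "dle (M + \<delta>) (R s0) (G j)"
        then have "dle (M + \<delta> + \<kappa> \<delta>) (R s0) (G j)" by (rule dle_mono) simp
        moreover have "dle (M + \<delta> + \<kappa> \<delta>) (R i) (G j)" using j(2) by (rule dle_mono) simp
        ultimately have "dle B (R s0) (R i)" unfolding B_def using linear_bound_in Rr(1)[of s0 i] i by simp
        then have "i - s0 \<le> B" using dst_le Rr(2)[of s0 i] i by fastforce
        then show ?thesis using i by simp
      next
        fix k assume "dle \<delta> (G j) (S k)"
        then have "dle (\<kappa> \<delta> + \<delta>) (R i) (S k)" using dle_trans j(2) by blast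
        then have "dle (M + \<kappa> \<delta> + \<delta>) (R i) (S k)" by (rule dle_mono) simp
        then show ?thesis by blast
      qed
    qed
  qed
  then show ?thesis by blast
qed

text \<open>
  Now the segment of \<open>R\<close> runs from the far link to the early one.  If \<open>S\<close> is a ray, the target of the far link can
  be reached from \<open>R s0\<close>, which gives one diagonal.  If \<open>S\<close> is an anti-ray, this may fail, and the diagonal
  from \<open>R s\<close> to the target of the early link takes its place.
\<close>

lemma anti_georay_leads_eventually:
  assumes R: "anti_georay R" and S: "georay S \<or> anti_georay S" and RS: "leads R S" and pR: "proper R"
  shows "\<exists>K n. \<forall>i\<ge>n. \<exists>j. dle K (R i) (S j)"
proof -
  obtain M where M: "\<And>n m. \<exists>i\<ge>n. \<exists>j\<ge>m. dle M (R i) (S j)"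
    using leads_cofinal[OF pR RS] by blast
  obtain s0 t0 where s0: "dle M (R s0) (S t0)" using M by blast
  have Rr: "reach (R j) (R i)" "dst (R j) (R i) = j - i" if "i \<le> j" for i j
    using R that unfolding anti_georay_def by blast+
  define B where "B = H (M + \<delta> + \<kappa> \<delta>)"
  have "\<exists>j. dle (M + \<kappa> \<delta> + \<delta>) (R i) (S j)" if i: "s0 + B + 1 \<le> i" for i
  proof -
    obtain s t where st: "i + B + M + \<delta> + 1 \<le> s" "t0 \<le> t" "dle M (R s) (S t)" using M by blast
    have b: "between (R s) (R i) (R s0)"
      using antigeo_between[OF R, of s0 i s] i st(1) by simp
    have r_y0: "reach (R i) (S t0)" and s_y0: "reach (R s) (S t0)"
      using reach_trans[OF Rr(1)[of s0 i] reachI[OF s0]]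
        reach_trans[OF Rr(1)[of s0 s] reachI[OF s0]] st(1) i by simp_all
    from S show ?thesis
    proof
      assume ray: "georay S"
      have "reach (S t0) (S t)" using ray st(2) unfolding georay_iff by blast
      then have xy: "reach (R s0) (S t)" using reach_trans reachI[OF s0] by blast
      obtain C where C: "geodesic_set C (R s) (S t)" using ex_geodesic_set reachI[OF st(3)] by blast
      obtain A where A: "geodesic_set A (R s0) (S t)" using ex_geodesic_set[OF xy] by blast
      from thin_first[OF C A b] show ?thesis
      proof (elim disjE bexE)
        fix v assume v: "v \<in> C" "dle \<delta> v (R i)"
        have "dle M (R s) v" using between_dle(1)[OF geodesic_set_between[OF C v(1)] st(3)] .
        then have "dle (M + \<delta>) (R s) (R i)" using dle_trans v(2) by blast
        then have "s - i \<le> M + \<delta>" using dst_le Rr(2)[of i s] st(1) by fastforce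
        then show ?thesis using st(1) by simp
      next
        fix v assume v: "v \<in> A" "dle \<delta> (R i) v"
        from segment_to_end[OF S st(2) s0 geodesic_set_between[OF A v(1)]] show ?thesis
        proof (elim disjE exE)
          assume "dle (M + \<delta>) (R s0) v"
          then have "dle (M + \<delta> + \<kappa> \<delta>) (R s0) v" by (rule dle_mono) simp
          moreover have "dle (M + \<delta> + \<kappa> \<delta>) (R i) v" using v(2) by (rule dle_mono) simp
          ultimately have "dle B (R i) (R s0)" unfolding B_def using linear_bound_in Rr(1)[of s0 i] i by simp
          then have "i - s0 \<le> B" using dst_le Rr(2)[of s0 i] i by fastforce
          then show ?thesis using i by simp
        next
          fix k assume "dle \<delta> v (S k)"
          then have "dle (\<delta> + \<delta>) (R i) (S k)" using dle_trans v(2) by blast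
          then have "dle (M + \<kappa> \<delta> + \<delta>) (R i) (S k)" by (rule dle_mono) (simp add: \<kappa>_def)
          then show ?thesis by blast
        qed
      qed
    next
      assume anti: "anti_georay S"
      obtain G n where G: "geo G n" "G 0 = R s" "G n = S t0" using ex_geo[OF s_y0] by blast
      have GS: "geodesic_set (G ` {..n}) (R s) (S t0)" using geodesic_setI[OF G(1)] unfolding G(2,3) .
      obtain C where C: "geodesic_set C (R s0) (S t0)" using ex_geodesic_set reachI[OF s0] by blast
      from thin_first[OF GS C b] show ?thesis
      proof (elim disjE bexE)
        fix v assume v: "v \<in> C" "dle \<delta> (R i) v"
        have "dle M v (S t0)" using between_dle(2)[OF geodesic_set_between[OF C v(1)] s0] .
        then have "dle (\<delta> + M) (R i) (S t0)" using dle_trans v(2) by blast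
        then have "dle (M + \<kappa> \<delta> + \<delta>) (R i) (S t0)" by (rule dle_mono) simp
        then show ?thesis by blast
      next
        fix v assume v: "v \<in> G ` {..n}" "dle \<delta> v (R i)"
        then obtain l where l: "l \<le> n" "dle \<delta> (G l) (R i)" by blast
        obtain j where j: "j \<le> n" "dle (\<kappa> \<delta>) (R i) (G j)"
          using return_to_geodesic[OF G(1) l] r_y0 unfolding G(3) by blast
        have bj: "between (R s) (G j) (S t0)"
          using geo_between[OF G(1), of 0 j n] j(1) unfolding G(2,3) by simp
        obtain A where A: "geodesic_set A (R s) (S t)" using ex_geodesic_set reachI[OF st(3)] by blast
        from thin_long[OF A anti_georay_segment[OF anti st(2)] bj] show ?thesis
        proof (elim disjE bexE)
          fix w assume w: "w \<in> A" "dle \<delta> w (G j)"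
          have "dle M (R s) w" using between_dle(1)[OF geodesic_set_between[OF A w(1)] st(3)] .
          then have "dle (M + \<delta>) (R s) (G j)" using dle_trans w(2) by blast
          then have "dle (M + \<delta> + \<kappa> \<delta>) (R s) (G j)" by (rule dle_mono) simp
          moreover have "dle (M + \<delta> + \<kappa> \<delta>) (R i) (G j)" using j(2) by (rule dle_mono) simp
          ultimately have "dle B (R s) (R i)" unfolding B_def using linear_bound_in Rr(1)[of i s] st(1) by simp
          then have "s - i \<le> B" using dst_le Rr(2)[of i s] st(1) by fastforce
          then show ?thesis using st(1) by simp
        next
          fix w assume w: "w \<in> S ` {t0..t}" "dle \<delta> (G j) w"
          then obtain k where "dle \<delta> (G j) (S k)" by blast
          then have "dle (\<kappa> \<delta> + \<delta>) (R i) (S k)" using dle_trans j(2) by blast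
          then have "dle (M + \<kappa> \<delta> + \<delta>) (R i) (S k)" by (rule dle_mono) simp
          then show ?thesis by blast
        qed
      qed
    qed
  qed
  then show ?thesis by blast
qed

text \<open>
  Rays and anti-rays are compared with each other through these properties only.
\<close>

definition tame :: "(nat \<Rightarrow> 'a) \<Rightarrow> bool" where
  "tame X \<longleftrightarrow> proper X \<and> (\<exists>S. (georay S \<or> anti_georay S) \<and> proper S \<and> fellow_travel S X)"

text \<open>
  Replace \<open>Y\<close> and \<open>Z\<close> by the geodesic (anti-)rays next to them, of which the first reaches the second from
  almost all of its points.
\<close>

lemma leads_trans:
  assumes X: "tame X" and Y: "tame Y" and Z: "tame Z" and XY: "leads X Y" and YZ: "leads Y Z"
  shows "leads X Z"
proof -
  have pX: "proper X" and pY: "proper Y" and pZ: "proper Z" using X Y Z unfolding tame_def by blast+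
  obtain S where S: "georay S \<or> anti_georay S" "proper S" "fellow_travel S Y" using Y unfolding tame_def by blast
  obtain T where T: "georay T \<or> anti_georay T" "proper T" "fellow_travel T Z" using Z unfolding tame_def by blast
  have XS: "leads X S" using leads_fellow_travel_right[OF fellow_travel_sym[OF S(3)] XY] .
  have "leads S Z" using leads_fellow_travel_left[OF fellow_travel_sym[OF S(3)] pZ pY S(2) YZ] .
  then have ST: "leads S T" using leads_fellow_travel_right[OF fellow_travel_sym[OF T(3)]] by blast
  obtain K n where K: "\<And>j. n \<le> j \<Longrightarrow> \<exists>k. dle K (S j) (T k)"
    using S(1) georay_leads_eventually[OF _ T(1) ST S(2)]
      anti_georay_leads_eventually[OF _ T(1) ST S(2)] by blast
  obtain L where L: "infinite {j. \<exists>i. dle L (X i) (S j)}" using leads_swap[OF pX XS] by blast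
  have "infinite {k. \<exists>i. dle (L + K) (X i) (T k)}" by (rule leads_chain[OF S(2) L K])
  then have "leads X T" using leads_iff_swapped[OF pX T(2)] by blast
  then show ?thesis using leads_fellow_travel_right[OF T(3)] by blast
qed

lemma fellow_travel_leads:
  assumes "fellow_travel X Y"
  shows "leads X Y" "leads Y X"
proof -
  obtain K where "\<And>i. \<exists>j. dle K (X i) (Y j)" "\<And>i. \<exists>j. dle K (Y i) (X j)"
    using assms unfolding fellow_travel_def by blast
  then have "{i. \<exists>j. dle K (X i) (Y j)} = UNIV" "{i. \<exists>j. dle K (Y i) (X j)} = UNIV" by blast+
  then show "leads X Y" "leads Y X" unfolding leads_def by (metis infinite_UNIV_nat)+
qed

lemma coarse_ray_ex_georay:
  assumes "\<And>x. finite {y. dle 1 x y}" "coarse_ray c X"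
  shows "\<exists>S. georay S \<and> fellow_travel S X"
  using coarse_ray_refine[OF assms(2)] quasi_ray_fellow_travel_georay[OF assms(1)] fellow_travel_trans by blast

end

section \<open>Digraphs as directed metrics\<close>

definition walk_le :: "('a, 'b) pre_digraph \<Rightarrow> nat \<Rightarrow> 'a \<Rightarrow> 'a \<Rightarrow> bool" where
  "walk_le D n x y \<longleftrightarrow> x \<in> verts D \<and> (\<exists>m\<le>n. (x, y) \<in> arcs_ends D ^^ m)"

context wf_digraph
begin

lemma vwalk_relpow: "vwalk p G \<Longrightarrow> (hd p, last p) \<in> arcs_ends G ^^ vwalk_length p"
proof (induction p rule: vwalk_induct)
  case (Cons u v es)
  then have "(u, last (v # es)) \<in> arcs_ends G ^^ Suc (vwalk_length (v # es))"
    using relpow_Suc_I2[of u v "arcs_ends G"] by simp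
  then show ?case by simp
qed simp

lemma relpow_vwalk:
  "(x, y) \<in> arcs_ends G ^^ m \<Longrightarrow> x \<in> verts G \<Longrightarrow>
    \<exists>p. vwalk p G \<and> hd p = x \<and> last p = y \<and> vwalk_length p = m"
proof (induction m arbitrary: x)
  case 0
  then show ?case by (intro exI[of _ "[x]"]) simp
next
  case (Suc m)
  then obtain z where z: "(x, z) \<in> arcs_ends G" "(z, y) \<in> arcs_ends G ^^ m"
    by (meson relpow_Suc_D2)
  then obtain p where p: "vwalk p G" "hd p = z" "last p = y" "vwalk_length p = m"
    using Suc.IH adj_in_verts by blast
  then have "p \<noteq> []" by blast
  then show ?case using p z Suc.prems(2) vwalk_consI[of p G x]
    by (intro exI[of _ "x # p"]) (auto simp: Suc_leI)
qed

lemma walk_le_iff_vwalk: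
  "walk_le G n x y \<longleftrightarrow> (\<exists>p. vwalk p G \<and> hd p = x \<and> last p = y \<and> vwalk_length p \<le> n)"
proof
  assume "walk_le G n x y"
  then show "\<exists>p. vwalk p G \<and> hd p = x \<and> last p = y \<and> vwalk_length p \<le> n"
    using relpow_vwalk unfolding walk_le_def by metis
next
  assume "\<exists>p. vwalk p G \<and> hd p = x \<and> last p = y \<and> vwalk_length p \<le> n"
  then obtain p where p: "vwalk p G" "hd p = x" "last p = y" "vwalk_length p \<le> n" by blast
  moreover have "hd p \<in> verts G" using p(1) hd_in_set unfolding vwalk_def by blast
  ultimately show "walk_le G n x y" using vwalk_relpow[OF p(1)] unfolding walk_le_def by blast
qed

lemma walk_le_verts: "walk_le G n x y \<Longrightarrow> x \<in> verts G \<and> y \<in> verts G"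
  unfolding walk_le_iff_vwalk vwalk_def by force

lemma ddist_le_real_iff:
  assumes "0 \<le> r"
  shows "ddist G x y \<le> ereal r \<longleftrightarrow> walk_le G (nat \<lfloor>r\<rfloor>) x y"
proof
  assume d: "ddist G x y \<le> ereal r"
  show "walk_le G (nat \<lfloor>r\<rfloor>) x y"
  proof (rule ccontr)
    assume no: "\<not> walk_le G (nat \<lfloor>r\<rfloor>) x y"
    have "ereal (real (nat \<lfloor>r\<rfloor> + 1)) \<le> ddist G x y"
      unfolding ddist_def
    proof (rule INF_greatest)
      fix p assume "p \<in> {p. vwalk p G \<and> hd p = x \<and> last p = y}"
      then have "\<not> vwalk_length p \<le> nat \<lfloor>r\<rfloor>" using no unfolding walk_le_iff_vwalk by blast
      then show "ereal (real (nat \<lfloor>r\<rfloor> + 1)) \<le> ereal (real (vwalk_length p))" by simp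
    qed
    then have "real (nat \<lfloor>r\<rfloor> + 1) \<le> r" using d order_trans by (metis ereal_less_eq(3))
    then show False using assms by linarith
  qed
next
  assume "walk_le G (nat \<lfloor>r\<rfloor>) x y"
  then obtain p where p: "vwalk p G" "hd p = x" "last p = y" "vwalk_length p \<le> nat \<lfloor>r\<rfloor>"
    unfolding walk_le_iff_vwalk by blast
  have "real (vwalk_length p) \<le> r" using p(4) assms by linarith
  then show "ddist G x y \<le> ereal r"
    unfolding ddist_def using p by (intro INF_lower2[of p]) auto
qed

lemma ddist_le_iff: "ddist G x y \<le> ereal (real n) \<longleftrightarrow> walk_le G n x y"
  using ddist_le_real_iff[of "real n" x y] by simp

lemma path_metric_walk_le: "path_metric (walk_le G)"
proof
  fix n x y assume "walk_le G n x y"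
  then have "x \<in> verts G" "y \<in> verts G" using walk_le_verts by blast+
  then show "walk_le G 0 x x \<and> walk_le G 0 y y" unfolding walk_le_def by auto
next
  fix x y assume "walk_le G 0 x y"
  then show "x = y" unfolding walk_le_def by auto
next
  fix m n x y assume "walk_le G m x y" "m \<le> n"
  then show "walk_le G n x y" unfolding walk_le_def using le_trans by blast
next
  fix m n x y z assume "walk_le G m x y" "walk_le G n y z"
  then obtain i j where "x \<in> verts G" "i \<le> m" "j \<le> n" "(x, y) \<in> arcs_ends G ^^ i" "(y, z) \<in> arcs_ends G ^^ j"
    unfolding walk_le_def by blast
  then have "(x, z) \<in> arcs_ends G ^^ (i + j)" "i + j \<le> m + n" by (auto simp: relpow_add)
  then show "walk_le G (m + n) x z" unfolding walk_le_def using \<open>x \<in> verts G\<close> by blast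
next
  fix m n x z assume a: "walk_le G (m + n) x z"
  then obtain k where k: "k \<le> m + n" "(x, z) \<in> arcs_ends G ^^ k" unfolding walk_le_def by blast
  have "k = min m k + (k - min m k)" by simp
  then obtain y where y: "(x, y) \<in> arcs_ends G ^^ min m k" "(y, z) \<in> arcs_ends G ^^ (k - min m k)"
    using k(2) relpow_add[of "min m k" "k - min m k" "arcs_ends G"] by auto
  have x: "x \<in> verts G" using a walk_le_verts by blast
  then have xy: "walk_le G m x y" using y(1) unfolding walk_le_def
    by (intro conjI exI[of _ "min m k"]) simp_all
  then have "y \<in> verts G" using walk_le_verts by blast
  moreover have "k - min m k \<le> n" using k(1) by simp
  ultimately have "walk_le G n y z" using y(2) unfolding walk_le_def by blast
  then show "\<exists>y. walk_le G m x y \<and> walk_le G n y z" using xy by blast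
qed

sublocale path_metric "walk_le G" by (rule path_metric_walk_le)

lemma ddist_eq: "reach x y \<Longrightarrow> ddist G x y = ereal (real (dst x y))"
proof -
  assume r: "reach x y"
  have le: "ddist G x y \<le> ereal (real (dst x y))" using dle_dst[OF r] ddist_le_iff by blast
  have "ereal (real (dst x y)) \<le> ddist G x y"
    unfolding ddist_def
  proof (rule INF_greatest)
    fix p assume "p \<in> {p. vwalk p G \<and> hd p = x \<and> last p = y}"
    then have "walk_le G (vwalk_length p) x y" unfolding walk_le_iff_vwalk by blast
    then show "ereal (real (dst x y)) \<le> ereal (real (vwalk_length p))" using dst_le by simp
  qed
  then show ?thesis using le by simp
qed

lemma ddist_infinite: "\<not> reach x y \<Longrightarrow> ddist G x y = \<infinity>"
proof -
  assume n: "\<not> reach x y"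
  have "{p. vwalk p G \<and> hd p = x \<and> last p = y} = {}"
    using n reachI unfolding walk_le_iff_vwalk by blast
  then show ?thesis unfolding ddist_def by (simp only: image_empty Inf_empty top_ereal_def)
qed

lemma ddist_finite_iff: "ddist G x y = ereal (real n) \<longleftrightarrow> reach x y \<and> dst x y = n"
  using ddist_eq ddist_infinite by (cases "reach x y") auto

lemma arc_of_dst: "reach x y \<Longrightarrow> dst x y = 1 \<Longrightarrow> (x, y) \<in> arcs_ends G"
proof -
  assume r: "reach x y" "dst x y = 1"
  then obtain m where m: "m \<le> 1" "(x, y) \<in> arcs_ends G ^^ m"
    using dle_dst[OF r(1)] unfolding walk_le_def by auto
  have "m \<noteq> 0" using m(2) r dst_self reach_refl(1)[OF r(1)] by (cases m) auto
  then have "m = 1" using m(1) by simp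
  then show ?thesis using m(2) by simp
qed

lemma arc_walk_le: "(x, y) \<in> arcs_ends G \<Longrightarrow> walk_le G 1 x y"
  unfolding walk_le_def using adj_in_verts(1) by (auto intro!: exI[of _ 1])

lemma walk_le_1_arc: "walk_le G 1 x y \<Longrightarrow> x \<noteq> y \<Longrightarrow> (x, y) \<in> arcs_ends G"
  unfolding walk_le_def by (auto simp: le_Suc_eq)

lemma vwalk_nthI:
  "p \<noteq> [] \<Longrightarrow> hd p \<in> verts G \<Longrightarrow>
    (\<And>i. Suc i < length p \<Longrightarrow> (p ! i, p ! Suc i) \<in> arcs_ends G) \<Longrightarrow> vwalk p G"
proof (induction p)
  case (Cons a p)
  show ?case
  proof (cases p)
    case Nil
    then show ?thesis using Cons.prems by simp
  next
    case (Cons b q)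
    have ab: "(a, b) \<in> arcs_ends G" using Cons.prems(3)[of 0] Cons by simp
    have "vwalk p G"
    proof (rule Cons.IH)
      fix i assume "Suc i < length p"
      then show "(p ! i, p ! Suc i) \<in> arcs_ends G" using Cons.prems(3)[of "Suc i"] by simp
    qed (use Cons ab adj_in_verts in auto)
    then show ?thesis using ab Cons by simp
  qed
qed simp

lemma vwalk_map:
  assumes "\<And>k. a \<le> k \<Longrightarrow> k < b \<Longrightarrow> (P k, P (Suc k)) \<in> arcs_ends G" "P a \<in> verts G" "a \<le> b"
  shows "vwalk (map P [a..<Suc b]) G"
  by (rule vwalk_nthI) (use assms in \<open>auto simp: hd_map nth_append simp del: upt_Suc\<close>)

lemma hd_last_map_upt:
  "a \<le> b \<Longrightarrow> hd (map P [a..<Suc b]) = P a" "a \<le> b \<Longrightarrow> last (map P [a..<Suc b]) = P b"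
  by (simp_all add: hd_map last_map del: upt_Suc)

lemma geodesic_map:
  assumes "geo P n"
  shows "geodesic G (map P [0..<Suc n])"
proof -
  have "(P k, P (Suc k)) \<in> arcs_ends G" if "k < n" for k
    using arc_of_dst geo_reach[OF assms, of k "Suc k"] geo_dst[OF assms, of k "Suc k"] that by simp
  moreover have "P 0 \<in> verts G" using geo_dle[OF assms, of 0 0] walk_le_verts by simp
  ultimately have "vwalk (map P [0..<Suc n]) G" by (intro vwalk_map) auto
  moreover have "ddist G (P 0) (P n) = ereal (real n)"
    unfolding ddist_finite_iff using geo_reach[OF assms, of 0 n] geo_dst[OF assms, of 0 n] by simp
  ultimately show ?thesis unfolding geodesic_def by (simp add: hd_last_map_upt del: upt_Suc)
qed

lemma geodesic_set_list:
  assumes "geodesic_set A x y"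
  obtains p where "geodesic G p" "hd p = x" "last p = y" "set p = A"
proof -
  obtain P n where P: "geo P n" "P 0 = x" "P n = y" "A = P ` {..n}"
    using assms unfolding geodesic_set_def by blast
  have "set (map P [0..<Suc n]) = A" using P(4) by (simp only: set_map set_upt atLeast0LessThan lessThan_Suc_atMost)
  then show thesis using that[OF geodesic_map[OF P(1)]] P(2,3) hd_last_map_upt[of 0 n P] by simp
qed

lemma between_list:
  assumes "between x w y"
  obtains p where "geodesic G p" "hd p = x" "last p = y" "w \<in> set p"
proof -
  obtain P n i where P: "geo P n" "P 0 = x" "P n = y" "P i = w" "i \<le> n" using between_geo[OF assms] .
  have "w \<in> P ` {..n}" using P(4,5) by blast
  then show thesis
    using geodesic_set_list[OF geodesic_setI[OF P(1)]] that unfolding P(2,3) by metis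
qed

text \<open>
  In the definition of thin triangles the sides may have any directions and labels; each of the three thinness
  axioms is one labelling of a transitive triangle.
\<close>

lemma hyperbolic_space_walk_le:
  assumes "hyperbolic G" "B1 G" "B2 G"
  shows "\<exists>\<delta> h. hyperbolic_space (walk_le G) \<delta> h"
proof -
  obtain d where d: "d \<ge> 0"
    "\<And>p1 p2 p3. geodesic_triangle G p1 p2 p3 \<Longrightarrow> thin_triangle G d p1 p2 p3"
    using assms(1) unfolding hyperbolic_def by blast
  obtain h1 where h1: "\<And>x r y z. x \<in> verts G \<Longrightarrow> r \<ge> 0 \<Longrightarrow> y \<in> out_ball G r x \<Longrightarrow> z \<in> out_ball G r x \<Longrightarrow>
     ddist G y z = \<infinity> \<or> ddist G y z \<le> ereal (h1 r)" using assms(2) unfolding B1_def by blast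
  obtain h2 where h2: "\<And>x r y z. x \<in> verts G \<Longrightarrow> r \<ge> 0 \<Longrightarrow> y \<in> in_ball G r x \<Longrightarrow> z \<in> in_ball G r x \<Longrightarrow>
     ddist G y z = \<infinity> \<or> ddist G y z \<le> ereal (h2 r)" using assms(3) unfolding B2_def by blast
  define \<delta> where "\<delta> = nat \<lfloor>d\<rfloor>"
  define h where "h r = nat \<lceil>h1 (real r)\<rceil> + nat \<lceil>h2 (real r)\<rceil>" for r :: nat
  have bound: "walk_le G (h r) y z"
    if "reach y z" "ddist G y z = \<infinity> \<or> ddist G y z \<le> ereal (h1 (real r)) \<or> ddist G y z \<le> ereal (h2 (real r))"
    for r y z
  proof -
    have "h1 (real r) \<le> real (h r)" "h2 (real r) \<le> real (h r)" unfolding h_def by linarith+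
    moreover have "real (dst y z) \<le> h1 (real r) \<or> real (dst y z) \<le> h2 (real r)"
      using that(2) ddist_eq[OF that(1)] by simp
    ultimately have "dst y z \<le> h r" by linarith
    then show ?thesis using that(1) dle_iff by blast
  qed
  have thin: "(\<exists>u\<in>set Q. walk_le G \<delta> u w) \<or> (\<exists>u\<in>set R. walk_le G \<delta> w u)"
    if "geodesic_triangle G p1 p2 p3" "{#P, Q, R#} = {#p1, p2, p3#}" "hd P \<in> {hd Q, last Q}"
      "last P \<in> {hd R, last R}" "w \<in> set P" for P Q R p1 p2 p3 w
  proof -
    have "set P \<subseteq> out_nbhd G d (set Q) \<union> in_nbhd G d (set R)"
      using d(2)[OF that(1)] that(2-4) unfolding thin_triangle_def by blast
    then show ?thesis using that(5) ddist_le_real_iff[OF d(1)]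
      unfolding out_nbhd_def in_nbhd_def out_ball_def in_ball_def \<delta>_def by blast
  qed
  have hv: "hd p \<in> verts G" "last p \<in> verts G" if "geodesic G p" for p
    using that hd_in_set last_in_set unfolding geodesic_def vwalk_def by blast+
  have "hyperbolic_space (walk_le G) \<delta> h"
  proof
    fix A x y B z w assume A: "geodesic_set A x y" and B: "geodesic_set B y z" and w: "between x w z"
    obtain a where a: "geodesic G a" "hd a = x" "last a = y" "set a = A" using geodesic_set_list[OF A] .
    obtain b where b: "geodesic G b" "hd b = y" "last b = z" "set b = B" using geodesic_set_list[OF B] .
    obtain p where p: "geodesic G p" "hd p = x" "last p = z" "w \<in> set p" using between_list[OF w] .
    have "geodesic_triangle G a b p" unfolding geodesic_triangle_def geodesic_side_def
      using a b p hv by metis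
    then show "(\<exists>u\<in>A. walk_le G \<delta> u w) \<or> (\<exists>u\<in>B. walk_le G \<delta> w u)"
      using thin[of a b p p a b w] a b p by (simp add: add_mset_commute)
  next
    fix C x z B y w assume C: "geodesic_set C x z" and B: "geodesic_set B y z" and w: "between x w y"
    obtain a where a: "geodesic G a" "hd a = x" "last a = z" "set a = C" using geodesic_set_list[OF C] .
    obtain b where b: "geodesic G b" "hd b = y" "last b = z" "set b = B" using geodesic_set_list[OF B] .
    obtain p where p: "geodesic G p" "hd p = x" "last p = y" "w \<in> set p" using between_list[OF w] .
    have "geodesic_triangle G p b a" unfolding geodesic_triangle_def geodesic_side_def
      using a b p hv by metis
    then show "(\<exists>u\<in>C. walk_le G \<delta> u w) \<or> (\<exists>u\<in>B. walk_le G \<delta> w u)"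
      using thin[of p b a p a b w] a b p by (simp add: add_mset_commute)
  next
    fix A x y C z w assume A: "geodesic_set A x y" and C: "geodesic_set C x z" and w: "between y w z"
    obtain a where a: "geodesic G a" "hd a = x" "last a = y" "set a = A" using geodesic_set_list[OF A] .
    obtain b where b: "geodesic G b" "hd b = x" "last b = z" "set b = C" using geodesic_set_list[OF C] .
    obtain p where p: "geodesic G p" "hd p = y" "last p = z" "w \<in> set p" using between_list[OF w] .
    have "geodesic_triangle G a p b" unfolding geodesic_triangle_def geodesic_side_def
      using a b p hv by metis
    then show "(\<exists>u\<in>A. walk_le G \<delta> u w) \<or> (\<exists>u\<in>C. walk_le G \<delta> w u)"
      using thin[of a p b p a b w] a b p by (simp add: add_mset_commute)
  next
    fix r x y z assume "walk_le G r x y" "walk_le G r x z" "reach y z"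
    then show "walk_le G (h r) y z"
      using bound h1[of x "real r" y z] walk_le_verts ddist_le_iff unfolding out_ball_def by auto
  next
    fix r x y z assume "walk_le G r y x" "walk_le G r z x" "reach y z"
    then show "walk_le G (h r) y z"
      using bound h2[of x "real r" y z] walk_le_verts ddist_le_iff unfolding in_ball_def by auto
  qed
  then show ?thesis by blast
qed

lemma finite_out_walk_le:
  assumes "finite_out_degrees G"
  shows "finite {y. walk_le G 1 x y}"
proof (rule finite_subset)
  show "{y. walk_le G 1 x y} \<subseteq> insert x (\<Union>x\<in>verts G \<inter> {x}. {y \<in> verts G. ddist G x y = 1})"
  proof
    fix y assume "y \<in> {y. walk_le G 1 x y}"
    then have y: "reach x y" "dst x y \<le> 1" "x \<in> verts G" "y \<in> verts G" using dle_iff walk_le_verts by auto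
    then have "x = y \<or> dst x y = 1" using dst_0[OF y(1)] by linarith
    then show "y \<in> insert x (\<Union>x\<in>verts G \<inter> {x}. {y \<in> verts G. ddist G x y = 1})"
      using ddist_finite_iff[of x y 1] y by auto
  qed
qed (use assms in \<open>auto simp: finite_out_degrees_def\<close>)

lemma finite_in_walk_le:
  assumes "finite_in_degrees G"
  shows "finite {y. walk_le G 1 y x}"
proof (rule finite_subset)
  show "{y. walk_le G 1 y x} \<subseteq> insert x (\<Union>x\<in>verts G \<inter> {x}. {y \<in> verts G. ddist G y x = 1})"
  proof
    fix y assume "y \<in> {y. walk_le G 1 y x}"
    then have y: "reach y x" "dst y x \<le> 1" "x \<in> verts G" "y \<in> verts G" using dle_iff walk_le_verts by auto
    then have "y = x \<or> dst y x = 1" using dst_0[OF y(1)] by linarith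
    then show "y \<in> insert x (\<Union>x\<in>verts G \<inter> {x}. {y \<in> verts G. ddist G y x = 1})"
      using ddist_finite_iff[of y x 1] y by auto
  qed
qed (use assms in \<open>auto simp: finite_in_degrees_def\<close>)

lemma vwalk_rev_segment:
  assumes "\<And>k. (P (Suc k), P k) \<in> arcs_ends G" "i \<le> j"
  shows "vwalk (rev (ray_segment P i j)) G"
proof (rule vwalk_nthI)
  have e: "rev (ray_segment P i j) ! k = P (j - k)" if "k < Suc j - i" for k
    using that unfolding ray_segment_def by (simp add: rev_nth del: upt_Suc)
  have l: "length (rev (ray_segment P i j)) = Suc j - i" unfolding ray_segment_def by (simp del: upt_Suc)
  fix k assume k: "Suc k < length (rev (ray_segment P i j))"
  then have "j - k = Suc (j - Suc k)" using l by simp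
  then show "(rev (ray_segment P i j) ! k, rev (ray_segment P i j) ! Suc k) \<in> arcs_ends G"
    using e[of k] e[of "Suc k"] k l assms(1)[of "j - Suc k"] by simp
next
  show "hd (rev (ray_segment P i j)) \<in> verts G"
    unfolding ray_segment_def hd_rev hd_last_map_upt(2)[OF assms(2)]
    using assms(1)[of j] adj_in_verts by blast
qed (use assms(2) in \<open>simp add: ray_segment_def\<close>)

lemma vwalk_segment:
  assumes "\<And>k. (P k, P (Suc k)) \<in> arcs_ends G" "i \<le> j"
  shows "vwalk (ray_segment P i j) G"
  unfolding ray_segment_def by (rule vwalk_map) (use assms adj_in_verts in blast)+

lemma segment_simps:
  assumes "i \<le> j"
  shows "hd (ray_segment P i j) = P i" "last (ray_segment P i j) = P j"
    "hd (rev (ray_segment P i j)) = P j" "last (rev (ray_segment P i j)) = P i"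
    "vwalk_length (ray_segment P i j) = j - i" "vwalk_length (rev (ray_segment P i j)) = j - i"
  using assms hd_last_map_upt[OF assms, of P] unfolding ray_segment_def
  by (simp_all add: hd_rev last_rev del: upt_Suc)

lemma geodesic_rays_eq: "geodesic_rays G = Collect georay"
proof (intro equalityI subsetI)
  fix R assume "R \<in> geodesic_rays G"
  then have g: "geodesic G (ray_segment R i j)" if "i \<le> j" for i j
    using that unfolding geodesic_rays_def by blast
  have "reach (R i) (R j) \<and> dst (R i) (R j) = j - i" if "i \<le> j" for i j
    using g[OF that] unfolding geodesic_def segment_simps[OF that] ddist_finite_iff[symmetric]
    by simp
  then show "R \<in> Collect georay" unfolding georay_iff by simp
next
  fix R assume "R \<in> Collect georay"
  then have R: "\<And>i j. i \<le> j \<Longrightarrow> reach (R i) (R j) \<and> dst (R i) (R j) = j - i" unfolding georay_iff by simp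
  have arcs: "(R i, R (Suc i)) \<in> arcs_ends G" for i using R[of i "Suc i"] arc_of_dst by simp
  have "inj R"
  proof (rule linorder_injI)
    fix i j :: nat assume "i < j"
    then show "R i \<noteq> R j" using R[of i j] R[of i i] by auto
  qed
  moreover have "geodesic G (ray_segment R i j)" if "i \<le> j" for i j
    unfolding geodesic_def segment_simps[OF that]
    using vwalk_segment[where P = R, OF arcs that] ddist_eq R[OF that] by simp
  ultimately show "R \<in> geodesic_rays G" unfolding geodesic_rays_def is_ray_def using arcs by blast
qed

lemma geodesic_antirays_eq: "geodesic_antirays G = Collect anti_georay"
proof (intro equalityI subsetI)
  fix R assume "R \<in> geodesic_antirays G"
  then have g: "geodesic G (rev (ray_segment R i j))" if "i \<le> j" for i j
    using that unfolding geodesic_antirays_def by blast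
  have "reach (R j) (R i) \<and> dst (R j) (R i) = j - i" if "i \<le> j" for i j
    using g[OF that] unfolding geodesic_def segment_simps[OF that] ddist_finite_iff[symmetric]
    by simp
  then show "R \<in> Collect anti_georay" unfolding anti_georay_def by simp
next
  fix R assume "R \<in> Collect anti_georay"
  then have R: "\<And>i j. i \<le> j \<Longrightarrow> reach (R j) (R i) \<and> dst (R j) (R i) = j - i" unfolding anti_georay_def by simp
  have arcs: "(R (Suc i), R i) \<in> arcs_ends G" for i using R[of i "Suc i"] arc_of_dst by simp
  have "inj R"
  proof (rule linorder_injI)
    fix i j :: nat assume "i < j"
    then show "R i \<noteq> R j" using R[of i j] R[of i i] by auto
  qed
  moreover have "geodesic G (rev (ray_segment R i j))" if "i \<le> j" for i j
    unfolding geodesic_def segment_simps[OF that]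
    using vwalk_rev_segment[where P = R, OF arcs that] ddist_eq R[OF that] by simp
  ultimately show "R \<in> geodesic_antirays G" unfolding geodesic_antirays_def is_antiray_def using arcs by blast
qed

lemma sublist_segment:
  assumes "sublist q (ray_segment R i j)" "q \<noteq> []" "i \<le> j"
  obtains a b where "a \<le> b" "b \<le> j" "q = ray_segment R a b"
proof -
  obtain ps ss where e: "ray_segment R i j = ps @ q @ ss" using assms(1) unfolding sublist_def by blast
  define a where "a = i + length ps"
  define b where "b = a + length q - 1"
  have "length (ray_segment R i j) = Suc j - i" unfolding ray_segment_def by (simp del: upt_Suc)
  then have "length ps + length q + length ss = Suc j - i" unfolding e by simp
  moreover have "0 < length q" using assms(2) by simp
  ultimately have ab: "a \<le> b" "b \<le> j" "Suc b = a + length q" using assms(3) unfolding a_def b_def by linarith+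
  have "q = take (length q) (drop (length ps) (ray_segment R i j))" unfolding e by simp
  also have "\<dots> = map R (take (length q) [a..<Suc j])"
    unfolding ray_segment_def a_def by (simp add: take_map drop_map del: upt_Suc)
  also have "\<dots> = ray_segment R a b"
    using ab take_upt[of a "length q" "Suc j"] unfolding ray_segment_def by (simp del: upt_Suc)
  finally show thesis using that ab by blast
qed

lemma real_gap_to_nat:
  fixes \<gamma> c :: real and m k :: nat
  assumes "real k \<le> \<gamma> * real m + c"
  shows "k \<le> nat \<lceil>max \<gamma> c\<rceil> * m + nat \<lceil>max \<gamma> c\<rceil>"
proof -
  let ?A = "nat \<lceil>max \<gamma> c\<rceil>"
  have "\<gamma> \<le> real ?A" "c \<le> real ?A" by linarith+
  then have "\<gamma> * real m + c \<le> real ?A * real m + real ?A"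
    using mult_right_mono[of \<gamma> "real ?A" "real m"] by simp
  then have "real k \<le> real (?A * m + ?A)" using assms by simp
  then show ?thesis by (simp only: of_nat_le_iff)
qed

lemma quasi_geodesic_gap:
  assumes p: "quasi_geodesic G \<gamma> c p" and \<gamma>: "1 \<le> \<gamma>" and m: "walk_le G m (hd p) (last p)"
  shows "vwalk_length p \<le> nat \<lceil>max \<gamma> c\<rceil> * m + nat \<lceil>max \<gamma> c\<rceil>"
proof -
  have d: "reach (hd p) (last p)" "dst (hd p) (last p) \<le> m" using m dle_iff by blast+
  have "p \<noteq> []" using p unfolding quasi_geodesic_def vwalk_def by blast
  then have "ereal (real (vwalk_length p)) \<le> ereal \<gamma> * ddist G (hd p) (last p) + ereal c"
    using p unfolding quasi_geodesic_def by blast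
  then have "real (vwalk_length p) \<le> \<gamma> * real (dst (hd p) (last p)) + c" unfolding ddist_eq[OF d(1)] by simp
  also have "\<dots> \<le> \<gamma> * real m + c" using \<gamma> d(2) by simp
  finally show ?thesis by (rule real_gap_to_nat)
qed

lemma quasi_geodesicI:
  assumes "vwalk p G" and "\<And>q. q \<noteq> [] \<Longrightarrow> sublist q p \<Longrightarrow>
    reach (hd q) (last q) \<and> vwalk_length q \<le> c * dst (hd q) (last q) + c"
  shows "quasi_geodesic G (real c + 1) (real c) p"
  unfolding quasi_geodesic_def
proof (intro conjI allI impI assms(1))
  fix q assume "q \<noteq> [] \<and> sublist q p"
  then have r: "reach (hd q) (last q)" and "vwalk_length q \<le> c * dst (hd q) (last q) + c"
    using assms(2) by blast+
  then have "real (vwalk_length q) \<le> real ((c + 1) * dst (hd q) (last q) + c)"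
    unfolding of_nat_le_iff by simp
  then have "real (vwalk_length q) \<le> (real c + 1) * real (dst (hd q) (last q)) + real c"
    by (simp add: distrib_right)
  then show "ereal (real (vwalk_length q)) \<le> ereal (real c + 1) * ddist G (hd q) (last q) + ereal (real c)"
    unfolding ddist_eq[OF r] by simp
qed

lemma quasi_geodesic_rays_coarse:
  assumes "Q \<in> quasi_geodesic_rays G"
  shows "\<exists>c. coarse_ray c Q"
proof -
  obtain \<gamma> c where c: "\<gamma> \<ge> 1" "c \<ge> 0" "\<And>i j. i \<le> j \<Longrightarrow> quasi_geodesic G \<gamma> c (ray_segment Q i j)"
    and arcs: "\<And>i. (Q i, Q (Suc i)) \<in> arcs_ends G"
    using assms unfolding quasi_geodesic_rays_def is_ray_def by blast
  define A where "A = nat \<lceil>max \<gamma> c\<rceil>"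
  have "1 \<le> A" using c(1) unfolding A_def by linarith
  have "coarse_ray A Q" unfolding coarse_ray_def
  proof (intro conjI allI impI)
    fix i show "walk_le G A (Q i) (Q (Suc i))" using dle_mono[OF arc_walk_le[OF arcs] \<open>1 \<le> A\<close>] .
  next
    fix i j m assume a: "i \<le> j \<and> walk_le G m (Q i) (Q j)"
    then have ij: "i \<le> j" by blast
    show "j - i \<le> A * m + A"
      using quasi_geodesic_gap[OF c(3)[OF ij] c(1), of m] a unfolding segment_simps[OF ij] A_def by blast
  qed
  then show ?thesis by blast
qed

lemma quasi_ray_quasi_geodesic:
  assumes "quasi_ray c Q" "inj Q"
  shows "Q \<in> quasi_geodesic_rays G"
proof -
  have gap: "j - i \<le> c * m + c" if "i \<le> j" "walk_le G m (Q i) (Q j)" for i j m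
    using assms(1) that quasi_geo_gap[of c Q j i j m] unfolding quasi_ray_def by blast
  have "walk_le G 1 (Q i) (Q (Suc i))" for i
    using assms(1) unfolding quasi_ray_def quasi_geo_def by blast
  moreover have "Q i \<noteq> Q (Suc i)" for i using inj_eq[OF assms(2), of i "Suc i"] by simp
  ultimately have arcs: "(Q i, Q (Suc i)) \<in> arcs_ends G" for i using walk_le_1_arc by blast
  have "quasi_geodesic G (real c + 1) (real c) (ray_segment Q i j)" if ij: "i \<le> j" for i j
  proof (rule quasi_geodesicI)
    show "vwalk (ray_segment Q i j) G" using vwalk_segment[where P = Q, OF arcs ij] .
  next
    fix q assume "q \<noteq> []" "sublist q (ray_segment Q i j)"
    then have q: "sublist q (ray_segment Q i j)" "q \<noteq> []" by blast+
    obtain a b where ab: "a \<le> b" "q = ray_segment Q a b" using sublist_segment[OF q ij] by blast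
    have r: "reach (Q a) (Q b)"
      using coarse_ray_reach[OF quasi_ray_coarse[OF assms(1)] ab(1)] .
    show "reach (hd q) (last q) \<and> vwalk_length q \<le> c * dst (hd q) (last q) + c"
      using r gap[OF ab(1) dle_dst[OF r]] unfolding ab(2) segment_simps[OF ab(1)] by blast
  qed
  moreover have "real c + 1 \<ge> 1" "real c \<ge> 0" by simp_all
  ultimately show ?thesis unfolding quasi_geodesic_rays_def is_ray_def using arcs assms(2) by blast
qed

lemma quasi_geodesic_antirays_coarse:
  assumes "Q \<in> quasi_geodesic_antirays G"
  shows "\<exists>c. path_metric.coarse_ray (\<lambda>n x y. walk_le G n y x) c Q"
proof -
  obtain \<gamma> c where c: "\<gamma> \<ge> 1" "c \<ge> 0"
    "\<And>i j. i \<le> j \<Longrightarrow> quasi_geodesic G \<gamma> c (rev (ray_segment Q i j))"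
    and arcs: "\<And>i. (Q (Suc i), Q i) \<in> arcs_ends G"
    using assms unfolding quasi_geodesic_antirays_def is_antiray_def by blast
  define A where "A = nat \<lceil>max \<gamma> c\<rceil>"
  have "1 \<le> A" using c(1) unfolding A_def by linarith
  have "path_metric.coarse_ray (\<lambda>n x y. walk_le G n y x) A Q"
    unfolding path_metric.coarse_ray_def[OF dual_path_metric]
  proof (intro conjI allI impI)
    fix i show "walk_le G A (Q (Suc i)) (Q i)" using dle_mono[OF arc_walk_le[OF arcs] \<open>1 \<le> A\<close>] .
  next
    fix i j m assume a: "i \<le> j \<and> walk_le G m (Q j) (Q i)"
    then have ij: "i \<le> j" by blast
    show "j - i \<le> A * m + A"
      using quasi_geodesic_gap[OF c(3)[OF ij] c(1), of m] a unfolding segment_simps[OF ij] A_def by blast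
  qed
  then show ?thesis by blast
qed

lemma dual_quasi_ray_quasi_geodesic:
  assumes "path_metric.quasi_ray (\<lambda>n x y. walk_le G n y x) c Q" "inj Q"
  shows "Q \<in> quasi_geodesic_antirays G"
proof -
  interpret dual: path_metric "\<lambda>n x y. walk_le G n y x" by (rule dual_path_metric)
  have gap: "j - i \<le> c * m + c" if "i \<le> j" "walk_le G m (Q j) (Q i)" for i j m
    using assms(1) that dual.quasi_geo_gap[of c Q j i j m] unfolding dual.quasi_ray_def by blast
  have "walk_le G 1 (Q (Suc i)) (Q i)" for i
    using assms(1) unfolding dual.quasi_ray_def dual.quasi_geo_def by blast
  moreover have "Q (Suc i) \<noteq> Q i" for i using inj_eq[OF assms(2), of "Suc i" i] by simp
  ultimately have arcs: "(Q (Suc i), Q i) \<in> arcs_ends G" for i using walk_le_1_arc by blast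
  have "quasi_geodesic G (real c + 1) (real c) (rev (ray_segment Q i j))" if ij: "i \<le> j" for i j
  proof (rule quasi_geodesicI)
    show "vwalk (rev (ray_segment Q i j)) G" using vwalk_rev_segment[where P = Q, OF arcs ij] .
  next
    fix q assume "q \<noteq> []" "sublist q (rev (ray_segment Q i j))"
    then have q: "sublist (rev q) (ray_segment Q i j)" "rev q \<noteq> []" by (simp_all add: sublist_rev_left)
    obtain a b where ab: "a \<le> b" "rev q = ray_segment Q a b" using sublist_segment[OF q ij] by blast
    have qr: "q = rev (ray_segment Q a b)" using ab(2) by (metis rev_rev_ident)
    have r: "reach (Q b) (Q a)"
      using dual.coarse_ray_reach[OF dual.quasi_ray_coarse[OF assms(1)] ab(1)] unfolding dual_reach .
    show "reach (hd q) (last q) \<and> vwalk_length q \<le> c * dst (hd q) (last q) + c"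
      using r gap[OF ab(1) dle_dst[OF r]] unfolding qr segment_simps[OF ab(1)] by blast
  qed
  moreover have "real c + 1 \<ge> 1" "real c \<ge> 0" by simp_all
  ultimately show ?thesis unfolding quasi_geodesic_antirays_def is_antiray_def using arcs assms(2) by blast
qed

text \<open>
  From left to right, the starts of finitely many links would lie in an out-ball or in-ball of
  fixed radius around \<open>X 0\<close>.  From right to left, a link of
  length \<open>L\<close> avoids the balls of radius \<open>r\<close> around \<open>x\<close> if its start does not reach \<open>x\<close> and its end is not
  reached from \<open>x\<close> within \<open>r + L\<close>; properness provides such links.
\<close>

lemma ray_le_iff_leads:
  assumes X: "proper X" and Y: "proper Y" and conn: "\<And>i. reach (X 0) (X i) \<or> reach (X i) (X 0)"
  shows "ray_le G X Y \<longleftrightarrow> leads X Y"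
proof
  assume "ray_le G X Y"
  then obtain M where M: "M \<ge> 0" "\<And>r x. r \<ge> 0 \<Longrightarrow> x \<in> verts G \<Longrightarrow>
     \<exists>p. vwalk p G \<and> hd p \<in> range X \<and> last p \<in> range Y \<and>
        real (vwalk_length p) \<le> M \<and> set p \<inter> (out_ball G r x \<union> in_ball G r x) = {}"
    unfolding ray_le_def by blast
  define I where "I = {i. \<exists>j. walk_le G (nat \<lfloor>M\<rfloor>) (X i) (Y j)}"
  have X0: "X 0 \<in> verts G" using conn[of 0] walk_le_verts unfolding reach_def by blast
  have "infinite I"
  proof
    assume fin: "finite I"
    define r where "r = Max (insert 0 ((\<lambda>i. dst (X 0) (X i)) ` I \<union> (\<lambda>i. dst (X i) (X 0)) ` I))"
    have r: "dst (X 0) (X i) \<le> r" "dst (X i) (X 0) \<le> r" if "i \<in> I" for i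
      unfolding r_def by (rule Max_ge; use fin that in auto)+
    obtain p where p: "vwalk p G" "hd p \<in> range X" "last p \<in> range Y" "real (vwalk_length p) \<le> M"
      "set p \<inter> (out_ball G (real r) (X 0) \<union> in_ball G (real r) (X 0)) = {}"
      using M(2)[of "real r" "X 0"] X0 by auto
    obtain i j where ij: "hd p = X i" "last p = Y j" using p(2,3) by blast
    have "vwalk_length p \<le> nat \<lfloor>M\<rfloor>" using p(4) M(1) by linarith
    then have "i \<in> I" unfolding I_def walk_le_iff_vwalk using p(1) ij by blast
    have "X i \<in> set p" using ij(1) p(1) hd_in_set unfolding vwalk_def by metis
    moreover have "X i \<in> out_ball G (real r) (X 0) \<union> in_ball G (real r) (X 0)"
      using conn[of i] r[OF \<open>i \<in> I\<close>] p(1) \<open>X i \<in> set p\<close> ddist_le_iff dle_iff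
      unfolding out_ball_def in_ball_def vwalk_def by blast
    ultimately show False using p(5) by blast
  qed
  then show "leads X Y" unfolding leads_def I_def by blast
next
  assume "leads X Y"
  then obtain L where L: "\<And>n m. \<exists>i\<ge>n. \<exists>j\<ge>m. walk_le G L (X i) (Y j)" using leads_cofinal[OF X] by blast
  show "ray_le G X Y" unfolding ray_le_def
  proof (rule exI[of _ "real L"], intro conjI allI impI ballI)
    fix r :: real and x assume r: "0 \<le> r" and x: "x \<in> verts G"
    define k where "k = nat \<lfloor>r\<rfloor>"
    obtain n where n: "\<And>i. walk_le G (L + k) (X i) x \<Longrightarrow> i < n"
      using X unfolding proper_def finite_nat_set_iff_bounded by blast
    obtain m where m: "\<And>j. walk_le G (k + L) x (Y j) \<Longrightarrow> j < m"
      using Y unfolding proper_def finite_nat_set_iff_bounded by blast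
    obtain i j where ij: "n \<le> i" "m \<le> j" "walk_le G L (X i) (Y j)" using L by blast
    obtain p where p: "vwalk p G" "hd p = X i" "last p = Y j" "vwalk_length p \<le> L"
      using ij(3) unfolding walk_le_iff_vwalk by blast
    have mid: "walk_le G L (X i) v \<and> walk_le G L v (Y j)" if v: "v \<in> set p" for v
    proof -
      obtain a b where ab: "p = a @ v # b" using split_list[OF v] by blast
      have "vwalk ((a @ [v]) @ b) G" using p(1) ab by simp
      then have "vwalk (a @ [v]) G" by (rule vwalkI_append_l[rotated]) simp
      moreover have "vwalk (v # b) G" using vwalkI_append_r[of "v # b" a] p(1) ab by simp
      moreover have "hd (a @ [v]) = X i" "last (v # b) = Y j" using p(2,3) ab by (cases a; simp)+
      moreover have "vwalk_length (a @ [v]) \<le> L" "vwalk_length (v # b) \<le> L" using p(4) ab by simp_all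
      moreover have "last (a @ [v]) = v" "hd (v # b) = v" by simp_all
      ultimately show ?thesis unfolding walk_le_iff_vwalk by blast
    qed
    have "v \<notin> out_ball G r x \<union> in_ball G r x" if "v \<in> set p" for v
    proof
      assume "v \<in> out_ball G r x \<union> in_ball G r x"
      then have "walk_le G k x v \<or> walk_le G k v x"
        unfolding out_ball_def in_ball_def k_def using ddist_le_real_iff[OF r] by blast
      then have "walk_le G (k + L) x (Y j) \<or> walk_le G (L + k) (X i) x"
        using mid[OF that] dle_trans by blast
      then show False using n[of i] m[of j] ij(1,2) by auto
    qed
    then show "\<exists>p. vwalk p G \<and> hd p \<in> range X \<and> last p \<in> range Y \<and>
        real (vwalk_length p) \<le> real L \<and> set p \<inter> (out_ball G r x \<union> in_ball G r x) = {}"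
      using p by (intro exI[of _ p]) auto
  qed simp
qed

lemma follows_iff_fellow_travel: "follows G Q (range X) \<longleftrightarrow> fellow_travel Q X"
proof
  assume "follows G Q (range X)"
  then obtain K where K: "K \<ge> 0" "range X \<subseteq> out_nbhd G K (range Q) \<inter> in_nbhd G K (range Q)"
    "range Q \<subseteq> out_nbhd G K (range X) \<inter> in_nbhd G K (range X)" unfolding follows_def by blast
  show "fellow_travel Q X" unfolding fellow_travel_def
    by (rule exI[of _ "nat \<lfloor>K\<rfloor>"])
      (use K(2,3) ddist_le_real_iff[OF K(1)] in \<open>auto simp: out_nbhd_def in_nbhd_def out_ball_def in_ball_def image_subset_iff\<close>)
next
  assume "fellow_travel Q X"
  then obtain K where K: "\<And>i. \<exists>j. walk_le G K (Q i) (X j)" "\<And>i. \<exists>j. walk_le G K (X j) (Q i)"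
    "\<And>j. \<exists>i. walk_le G K (Q i) (X j)" "\<And>j. \<exists>i. walk_le G K (X j) (Q i)"
    unfolding fellow_travel_def by blast
  have v: "Q i \<in> verts G" "X i \<in> verts G" for i using K walk_le_verts by blast+
  show "follows G Q (range X)" unfolding follows_def
    by (rule exI[of _ "real K"])
      (use K v ddist_le_iff in \<open>simp add: out_nbhd_def in_nbhd_def out_ball_def in_ball_def image_subset_iff\<close>)
qed

end

section \<open>Maps between boundaries\<close>

text \<open>
  A map \<open>F\<close> that preserves and reflects a quasiorder and is onto up to equivalence induces an
  isomorphism of the quotients; here the quotients are formed on representatives in \<open>G1\<close> and \<open>G2\<close> only.
\<close>

lemma boundary_map_of_order_embedding:
  assumes refl1: "\<And>X. X \<in> C1 \<Longrightarrow> ray_le D1 X X"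
    and trans1: "\<And>X Y Z. X \<in> C1 \<Longrightarrow> Y \<in> C1 \<Longrightarrow> Z \<in> C1 \<Longrightarrow>
      ray_le D1 X Y \<Longrightarrow> ray_le D1 Y Z \<Longrightarrow> ray_le D1 X Z"
    and refl2: "\<And>X. X \<in> C2 \<Longrightarrow> ray_le D2 X X"
    and trans2: "\<And>X Y Z. X \<in> C2 \<Longrightarrow> Y \<in> C2 \<Longrightarrow> Z \<in> C2 \<Longrightarrow>
      ray_le D2 X Y \<Longrightarrow> ray_le D2 Y Z \<Longrightarrow> ray_le D2 X Z"
    and G1: "G1 \<subseteq> C1" and G2: "G2 \<subseteq> C2"
    and rep1: "\<And>X. X \<in> C1 \<Longrightarrow> \<exists>S\<in>G1. ray_equiv D1 S X"
    and rep2: "\<And>X. X \<in> C2 \<Longrightarrow> \<exists>S\<in>G2. ray_equiv D2 S X"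
    and F: "\<And>X. X \<in> C1 \<Longrightarrow> F X \<in> C2"
    and emb: "\<And>X Y. X \<in> C1 \<Longrightarrow> Y \<in> C1 \<Longrightarrow> ray_le D2 (F X) (F Y) \<longleftrightarrow> ray_le D1 X Y"
    and onto: "\<And>Y. Y \<in> C2 \<Longrightarrow> \<exists>X\<in>C1. ray_equiv D2 (F X) Y"
  shows "\<exists>\<Phi>. (\<forall>R\<in>G1. \<Phi> (equiv_on D1 G1 `` {R}) = {S \<in> G2. ray_equiv D2 S (F R)}) \<and>
    bij_betw \<Phi> (boundary_of D1 G1) (boundary_of D2 G2) \<and>
    monotone_on (boundary_of D1 G1) (boundary_le D1) (boundary_le D2) \<Phi>"
proof -
  have esym: "ray_equiv D X Y \<Longrightarrow> ray_equiv D Y X" for D :: "('e, 'f) pre_digraph" and X Y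
    unfolding ray_equiv_def by blast
  have etrans1: "ray_equiv D1 X Z"
    if "X \<in> C1" "Y \<in> C1" "Z \<in> C1" "ray_equiv D1 X Y" "ray_equiv D1 Y Z" for X Y Z
    using that trans1 unfolding ray_equiv_def by blast
  have etrans2: "ray_equiv D2 X Z"
    if "X \<in> C2" "Y \<in> C2" "Z \<in> C2" "ray_equiv D2 X Y" "ray_equiv D2 Y Z" for X Y Z
    using that trans2 unfolding ray_equiv_def by blast
  have eemb: "ray_equiv D2 (F X) (F Y) \<longleftrightarrow> ray_equiv D1 X Y" if "X \<in> C1" "Y \<in> C1" for X Y
    using that emb unfolding ray_equiv_def by blast
  define cl1 where "cl1 R = equiv_on D1 G1 `` {R}" for R
  define cl2 where "cl2 S = equiv_on D2 G2 `` {S}" for S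
  define near where "near R = {S \<in> G2. ray_equiv D2 S (F R)}" for R
  define \<Phi> where "\<Phi> \<xi> = {S \<in> G2. \<exists>R\<in>\<xi>. ray_equiv D2 S (F R)}" for \<xi>
  have cl1: "cl1 R = {T \<in> G1. ray_equiv D1 R T}" if "R \<in> G1" for R
    using that unfolding cl1_def equiv_on_def by auto
  have cl2: "cl2 R = {T \<in> G2. ray_equiv D2 R T}" if "R \<in> G2" for R
    using that unfolding cl2_def equiv_on_def by auto
  have b1: "boundary_of D1 G1 = cl1 ` G1" unfolding boundary_of_def quotient_def cl1_def by blast
  have b2: "boundary_of D2 G2 = cl2 ` G2" unfolding boundary_of_def quotient_def cl2_def by blast
  have \<Phi>: "\<Phi> (cl1 R) = near R" if R: "R \<in> G1" for R
  proof (intro equalityI subsetI)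
    fix S assume "S \<in> \<Phi> (cl1 R)"
    then obtain T where T: "S \<in> G2" "T \<in> G1" "ray_equiv D1 R T" "ray_equiv D2 S (F T)"
      unfolding \<Phi>_def cl1[OF R] by blast
    have "ray_equiv D2 (F T) (F R)" using eemb T(2,3) R G1 esym by blast
    then have "ray_equiv D2 S (F R)"
      using etrans2[of S "F T" "F R"] T G2 F G1 R by blast
    then show "S \<in> near R" using T(1) unfolding near_def by blast
  next
    fix S assume "S \<in> near R"
    moreover have "R \<in> cl1 R" using refl1 R G1 unfolding cl1[OF R] ray_equiv_def by blast
    ultimately show "S \<in> \<Phi> (cl1 R)" unfolding \<Phi>_def near_def by blast
  qed
  have near_cl2: "near R = cl2 S" if "R \<in> G1" "S \<in> G2" "ray_equiv D2 S (F R)" for R S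
  proof (intro equalityI subsetI)
    fix T assume "T \<in> near R"
    then have T: "T \<in> G2" "ray_equiv D2 T (F R)" unfolding near_def by blast+
    have "ray_equiv D2 S T"
      using etrans2[of S "F R" T] that T G2 F G1 esym by blast
    then show "T \<in> cl2 S" unfolding cl2[OF that(2)] using T(1) by blast
  next
    fix T assume "T \<in> cl2 S"
    then have T: "T \<in> G2" "ray_equiv D2 S T" unfolding cl2[OF that(2)] by blast+
    have "ray_equiv D2 T (F R)"
      using etrans2[of T S "F R"] that T G2 F G1 esym by blast
    then show "T \<in> near R" unfolding near_def using T(1) by blast
  qed
  have rep: "\<exists>S\<in>G2. ray_equiv D2 S (F R)" if "R \<in> G1" for R using rep2 F G1 that by blast
  have bij: "bij_betw \<Phi> (boundary_of D1 G1) (boundary_of D2 G2)"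
    unfolding bij_betw_def
  proof
    show "inj_on \<Phi> (boundary_of D1 G1)"
    proof (rule inj_onI)
      fix \<xi> \<eta> assume "\<xi> \<in> boundary_of D1 G1" "\<eta> \<in> boundary_of D1 G1" and e: "\<Phi> \<xi> = \<Phi> \<eta>"
      then obtain R T where RT: "R \<in> G1" "T \<in> G1" "\<xi> = cl1 R" "\<eta> = cl1 T" unfolding b1 by blast
      obtain S where S: "S \<in> G2" "ray_equiv D2 S (F R)" using rep RT(1) by blast
      have "near R = near T" using e \<Phi> RT by simp
      then have S': "ray_equiv D2 S (F T)" using S unfolding near_def by blast
      have "ray_equiv D2 (F R) (F T)"
        using etrans2[of "F R" S "F T"] S S' G2 F G1 RT esym by blast
      then have RT': "ray_equiv D1 R T" using eemb RT G1 by blast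
      have "ray_equiv D1 R U \<longleftrightarrow> ray_equiv D1 T U" if "U \<in> G1" for U
        using etrans1[of R T U] etrans1[of T R U] RT RT' G1 that esym by blast
      then show "\<xi> = \<eta>" unfolding RT(3,4) cl1[OF RT(1)] cl1[OF RT(2)] by blast
    qed
    show "\<Phi> ` boundary_of D1 G1 = boundary_of D2 G2"
    proof (intro equalityI subsetI)
      fix \<eta> assume "\<eta> \<in> \<Phi> ` boundary_of D1 G1"
      then obtain R where R: "R \<in> G1" "\<eta> = near R" unfolding b1 using \<Phi> by blast
      then show "\<eta> \<in> boundary_of D2 G2" unfolding b2 using rep near_cl2 by blast
    next
      fix \<eta> assume "\<eta> \<in> boundary_of D2 G2"
      then obtain S where S: "S \<in> G2" "\<eta> = cl2 S" unfolding b2 by blast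
      obtain X where X: "X \<in> C1" "ray_equiv D2 (F X) S" using onto S(1) G2 by blast
      obtain R where R: "R \<in> G1" "ray_equiv D1 R X" using rep1 X(1) by blast
      have "ray_equiv D2 (F X) (F R)" using eemb R X G1 esym by blast
      then have "ray_equiv D2 S (F R)"
        using etrans2[of S "F X" "F R"] S R X G1 G2 F esym by blast
      then have "\<eta> = \<Phi> (cl1 R)" using near_cl2 R(1) S \<Phi> by simp
      then show "\<eta> \<in> \<Phi> ` boundary_of D1 G1" unfolding b1 using R(1) by blast
    qed
  qed
  have mono: "monotone_on (boundary_of D1 G1) (boundary_le D1) (boundary_le D2) \<Phi>"
  proof (rule monotone_onI)
    fix \<xi> \<eta> assume "\<xi> \<in> boundary_of D1 G1" "\<eta> \<in> boundary_of D1 G1" and le: "boundary_le D1 \<xi> \<eta>"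
    then obtain R0 T0 where RT0: "R0 \<in> G1" "T0 \<in> G1" "\<xi> = cl1 R0" "\<eta> = cl1 T0" unfolding b1 by blast
    obtain R T where RT: "R \<in> \<xi>" "T \<in> \<eta>" "ray_le D1 R T" using le unfolding boundary_le_def by blast
    have g: "R \<in> G1" "T \<in> G1" using RT(1,2) RT0 cl1 by blast+
    obtain S where S: "S \<in> G2" "ray_equiv D2 S (F R)" using rep g by blast
    obtain U where U: "U \<in> G2" "ray_equiv D2 U (F T)" using rep g by blast
    have c: "S \<in> C2" "F R \<in> C2" "F T \<in> C2" "U \<in> C2" using S(1) U(1) G2 F g G1 by blast+
    have "ray_le D2 (F R) (F T)" using emb RT(3) g G1 by blast
    then have "ray_le D2 S (F T)" using trans2[OF c(1,2,3)] S(2) unfolding ray_equiv_def by blast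
    then have "ray_le D2 S U" using trans2[OF c(1,3,4)] U(2) unfolding ray_equiv_def by blast
    moreover have "S \<in> \<Phi> \<xi>" "U \<in> \<Phi> \<eta>" using S U RT unfolding \<Phi>_def by blast+
    ultimately show "boundary_le D2 (\<Phi> \<xi>) (\<Phi> \<eta>)" unfolding boundary_le_def by blast
  qed
  show ?thesis using \<Phi> bij mono unfolding cl1_def near_def by blast
qed

text \<open>
  A quasi-isometric embedding in terms of step bounds.  Since the constants are natural numbers, the lower bound
  is stated as an upper bound for the distance of the arguments.  The reverse implication also expresses that
  \<open>f\<close> creates no new reachability.
\<close>

definition coarse_embedding ::
  "(nat \<Rightarrow> 'a \<Rightarrow> 'a \<Rightarrow> bool) \<Rightarrow> (nat \<Rightarrow> 'c \<Rightarrow> 'c \<Rightarrow> bool) \<Rightarrow> nat \<Rightarrow> ('a \<Rightarrow> 'c) \<Rightarrow> bool" where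
  "coarse_embedding d1 d2 c f \<longleftrightarrow>
     (\<forall>n x y. d1 n x y \<longrightarrow> d2 (c * n + c) (f x) (f y)) \<and>
     (\<forall>n x y. d1 0 x x \<and> d1 0 y y \<and> d2 n (f x) (f y) \<longrightarrow> d1 (c * n + c) x y)"

lemma coarse_embedding_dual:
  "coarse_embedding d1 d2 c f \<Longrightarrow> coarse_embedding (\<lambda>n x y. d1 n y x) (\<lambda>n x y. d2 n y x) c f"
  unfolding coarse_embedding_def by blast

lemma coarse_ray_embed:
  assumes d1: "path_metric d1" and d2: "path_metric d2" and f: "coarse_embedding d1 d2 c f"
    and X: "path_metric.coarse_ray d1 a X"
  shows "\<exists>b. path_metric.coarse_ray d2 b (f \<circ> X)"
proof -
  interpret d1: path_metric d1 by (rule d1)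
  interpret d2: path_metric d2 by (rule d2)
  let ?b = "c * a + c + a"
  have step: "d1 a (X i) (X (Suc i))" for i using X unfolding d1.coarse_ray_def by blast
  then have r: "d1 0 (X i) (X i)" for i using d1.dle_refl by blast
  have "d2.coarse_ray ?b (f \<circ> X)" unfolding d2.coarse_ray_def
  proof (intro conjI allI impI)
    fix i
    have "d2 (c * a + c) (f (X i)) (f (X (Suc i)))" using f step unfolding coarse_embedding_def by blast
    then show "d2 ?b ((f \<circ> X) i) ((f \<circ> X) (Suc i))" using d2.dle_mono by simp
  next
    fix i j m assume a: "i \<le> j \<and> d2 m ((f \<circ> X) i) ((f \<circ> X) j)"
    then have "d1 (c * m + c) (X i) (X j)" using f r unfolding coarse_embedding_def by simp
    then have "j - i \<le> a * (c * m + c) + a" using X a unfolding d1.coarse_ray_def by blast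
    also have "\<dots> \<le> ?b * m + ?b" by (simp add: algebra_simps)
    finally show "j - i \<le> ?b * m + ?b" .
  qed
  then show ?thesis by blast
qed

lemma leads_embed:
  assumes d1: "path_metric d1" and d2: "path_metric d2" and f: "coarse_embedding d1 d2 c f"
    and X: "\<And>i. d1 0 (X i) (X i)" and Y: "\<And>i. d1 0 (Y i) (Y i)"
  shows "path_metric.leads d2 (f \<circ> X) (f \<circ> Y) \<longleftrightarrow> path_metric.leads d1 X Y"
proof -
  interpret d1: path_metric d1 by (rule d1)
  interpret d2: path_metric d2 by (rule d2)
  have up: "d1 L (X i) (Y j) \<Longrightarrow> d2 (c * L + c) (f (X i)) (f (Y j))"
    and down: "d2 L (f (X i)) (f (Y j)) \<Longrightarrow> d1 (c * L + c) (X i) (Y j)" for L i j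
    using f X Y unfolding coarse_embedding_def by blast+
  show ?thesis
  proof
    assume "d2.leads (f \<circ> X) (f \<circ> Y)"
    then obtain L where L: "infinite {i. \<exists>j. d2 L (f (X i)) (f (Y j))}"
      unfolding d2.leads_def by auto
    have "{i. \<exists>j. d2 L (f (X i)) (f (Y j))} \<subseteq> {i. \<exists>j. d1 (c * L + c) (X i) (Y j)}"
      using down by blast
    then show "d1.leads X Y" unfolding d1.leads_def using L finite_subset by blast
  next
    assume "d1.leads X Y"
    then obtain L where L: "infinite {i. \<exists>j. d1 L (X i) (Y j)}" unfolding d1.leads_def by blast
    have "{i. \<exists>j. d1 L (X i) (Y j)} \<subseteq> {i. \<exists>j. d2 (c * L + c) ((f \<circ> X) i) ((f \<circ> Y) j)}"
      using up by auto
    then show "d2.leads (f \<circ> X) (f \<circ> Y)" unfolding d2.leads_def using L finite_subset by blast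
  qed
qed

text \<open>
  The map \<open>g\<close> is a quasi-inverse, chosen by the density of the image of \<open>f\<close>.
\<close>

lemma quasi_isometry_coarse:
  assumes wf1: "wf_digraph D1" and wf2: "wf_digraph D2" and qi: "quasi_isometry D1 D2 f"
  shows "\<exists>c g. coarse_embedding (walk_le D1) (walk_le D2) c f \<and>
    coarse_embedding (walk_le D2) (walk_le D1) c g \<and>
    (\<forall>y\<in>verts D2. walk_le D2 c (f (g y)) y \<and> walk_le D2 c y (f (g y)))"
proof -
  interpret D1: wf_digraph D1 by (rule wf1)
  interpret D2: wf_digraph D2 by (rule wf2)
  obtain \<gamma> c where fv: "f ` verts D1 \<subseteq> verts D2" and \<gamma>: "\<gamma> \<ge> 1" and c: "c \<ge> 0"
    and lower: "\<And>x x'. x \<in> verts D1 \<Longrightarrow> x' \<in> verts D1 \<Longrightarrow>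
       ereal (inverse \<gamma>) * ddist D1 x x' - ereal c \<le> ddist D2 (f x) (f x')"
    and upper: "\<And>x x'. x \<in> verts D1 \<Longrightarrow> x' \<in> verts D1 \<Longrightarrow>
       ddist D2 (f x) (f x') \<le> ereal \<gamma> * ddist D1 x x' + ereal c"
    and dense: "\<And>y. y \<in> verts D2 \<Longrightarrow> \<exists>x\<in>verts D1. ddist D2 (f x) y \<le> ereal c \<and> ddist D2 y (f x) \<le> ereal c"
    using qi unfolding quasi_isometry_def by blast
  define A where "A = nat \<lceil>max \<gamma> (\<gamma> * c)\<rceil>"
  have A: "\<gamma> \<le> real A" "\<gamma> * c \<le> real A" unfolding A_def by linarith+
  have "c \<le> \<gamma> * c" using mult_right_mono[OF \<gamma> c] by simp
  then have cA: "c \<le> real A" using A by linarith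
  have up: "walk_le D2 (A * n + A) (f x) (f y)" if "walk_le D1 n x y" for n x y
  proof -
    have xy: "x \<in> verts D1" "y \<in> verts D1" using D1.walk_le_verts that by blast+
    have r: "D1.reach x y" "D1.dst x y \<le> n" using that D1.dle_iff by blast+
    have "ddist D2 (f x) (f y) \<le> ereal (\<gamma> * real (D1.dst x y) + c)"
      using upper[OF xy] unfolding D1.ddist_eq[OF r(1)] by simp
    also have "\<dots> \<le> ereal (real (A * n + A))"
    proof -
      have "\<gamma> * real (D1.dst x y) \<le> real A * real n"
        using A(1) \<gamma> r(2) by (intro mult_mono) auto
      then show ?thesis using cA by simp
    qed
    finally show ?thesis unfolding D2.ddist_le_iff .
  qed
  have down: "walk_le D1 (A * n + A) x y"
    if "x \<in> verts D1" "y \<in> verts D1" "walk_le D2 n (f x) (f y)" for n x y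
  proof -
    have l: "ereal (inverse \<gamma>) * ddist D1 x y - ereal c \<le> ereal (real n)"
      using order_trans[OF lower[OF that(1,2)]] that(3) D2.ddist_le_iff by blast
    have r: "D1.reach x y"
    proof (rule ccontr)
      assume "\<not> D1.reach x y"
      then have "ddist D1 x y = \<infinity>" by (rule D1.ddist_infinite)
      moreover have "0 < inverse \<gamma>" using \<gamma> by simp
      ultimately show False using l by simp
    qed
    have "inverse \<gamma> * real (D1.dst x y) - c \<le> real n" using l unfolding D1.ddist_eq[OF r] by simp
    then have "\<gamma> * (inverse \<gamma> * real (D1.dst x y)) \<le> \<gamma> * (real n + c)"
      using \<gamma> by (intro mult_left_mono) auto
    then have "real (D1.dst x y) \<le> \<gamma> * real n + \<gamma> * c"
      using \<gamma> by (simp add: distrib_left mult.assoc[symmetric])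
    also have "\<dots> \<le> real (A * n + A)"
      using mult_right_mono[OF A(1), of "real n"] A(2) by simp
    finally have "D1.dst x y \<le> A * n + A" by (simp only: of_nat_le_iff)
    then show ?thesis using r D1.dle_iff by blast
  qed
  have "\<exists>x\<in>verts D1. walk_le D2 A (f x) y \<and> walk_le D2 A y (f x)" if y: "y \<in> verts D2" for y
  proof -
    have "ereal c \<le> ereal (real A)" using cA by simp
    then show ?thesis using dense[OF y] order_trans D2.ddist_le_iff by metis
  qed
  then obtain g where g: "\<And>y. y \<in> verts D2 \<Longrightarrow> g y \<in> verts D1"
    "\<And>y. y \<in> verts D2 \<Longrightarrow> walk_le D2 A (f (g y)) y" "\<And>y. y \<in> verts D2 \<Longrightarrow> walk_le D2 A y (f (g y))"
    by metis
  define B where "B = A * (2 * A) + 3 * A"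
  have AB: "A * n + A \<le> B * n + B" "A * (A + (n + A)) + A \<le> B * n + B" "A + (A * n + A + A) \<le> B * n + B" for n
  proof -
    have "A * n \<le> B * n" unfolding B_def by (intro mult_le_mono1) simp
    then show "A * n + A \<le> B * n + B" "A * (A + (n + A)) + A \<le> B * n + B" "A + (A * n + A + A) \<le> B * n + B"
      unfolding B_def by (simp_all add: algebra_simps)
  qed
  have v0: "x \<in> verts D1" if "walk_le D1 0 x x" for x using that D1.walk_le_verts by blast
  have "coarse_embedding (walk_le D1) (walk_le D2) B f"
    unfolding coarse_embedding_def
    using D2.dle_mono[OF up AB(1)] D1.dle_mono[OF down AB(1)] v0 by blast
  moreover have "coarse_embedding (walk_le D2) (walk_le D1) B g"
    unfolding coarse_embedding_def
  proof (intro conjI allI impI)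
    fix n x y assume xy: "walk_le D2 n x y"
    then have v: "x \<in> verts D2" "y \<in> verts D2" using D2.walk_le_verts by blast+
    have "walk_le D2 (A + (n + A)) (f (g x)) (f (g y))"
      using D2.dle_trans[OF g(2)[OF v(1)] D2.dle_trans[OF xy g(3)[OF v(2)]]] .
    then have "walk_le D1 (A * (A + (n + A)) + A) (g x) (g y)" using down g(1) v by blast
    then show "walk_le D1 (B * n + B) (g x) (g y)" using D1.dle_mono AB(2) by blast
  next
    fix n x y assume a: "walk_le D2 0 x x \<and> walk_le D2 0 y y \<and> walk_le D1 n (g x) (g y)"
    then have v: "x \<in> verts D2" "y \<in> verts D2" using D2.walk_le_verts by blast+
    have "walk_le D2 (A * n + A) (f (g x)) (f (g y))" using a up by blast
    then have "walk_le D2 (A + (A * n + A + A)) x y"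
      using D2.dle_trans[OF g(3)[OF v(1)] D2.dle_trans[OF _ g(2)[OF v(2)]]] by blast
    then show "walk_le D2 (B * n + B) x y" using D2.dle_mono AB(3) by blast
  qed
  moreover have "walk_le D2 B (f (g y)) y \<and> walk_le D2 B y (f (g y))" if "y \<in> verts D2" for y
    using g(2,3)[OF that] D2.dle_mono[where m = A and n = B] unfolding B_def by simp
  ultimately show ?thesis by blast
qed

definition coarse_rays :: "('a, 'b) pre_digraph \<Rightarrow> (nat \<Rightarrow> 'a) set" where
  "coarse_rays D = {X. \<exists>c. path_metric.coarse_ray (walk_le D) c X}"

definition coarse_antirays :: "('a, 'b) pre_digraph \<Rightarrow> (nat \<Rightarrow> 'a) set" where
  "coarse_antirays D = {X. \<exists>c. path_metric.coarse_ray (\<lambda>n x y. walk_le D n y x) c X}"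

text \<open>
  The class \<open>C\<close> consists of the sequences that define points of the boundary and \<open>G\<close> of the geodesic
  representatives.  As each point reaches \<open>X 0\<close> or is reached from it, finitely many points of \<open>X\<close> lie in the union of an
  out-ball and an in-ball around \<open>X 0\<close>.
\<close>

definition boundary_class :: "('a, 'b) pre_digraph \<Rightarrow> (nat \<Rightarrow> 'a) set \<Rightarrow> (nat \<Rightarrow> 'a) set \<Rightarrow> bool" where
  "boundary_class D C G \<longleftrightarrow> G \<subseteq> C \<and> (\<forall>X\<in>C. path_metric.proper (walk_le D) X \<and>
     (\<forall>i. path_metric.reach (walk_le D) (X 0) (X i) \<or> path_metric.reach (walk_le D) (X i) (X 0)) \<and>
     (\<exists>S\<in>G. (path_metric.georay (walk_le D) S \<or> path_metric.anti_georay (walk_le D) S) \<and>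
        path_metric.fellow_travel (walk_le D) S X))"

lemma boundary_class_Un:
  "boundary_class D C G \<Longrightarrow> boundary_class D C' G' \<Longrightarrow> boundary_class D (C \<union> C') (G \<union> G')"
  unfolding boundary_class_def by blast

lemma boundary_class_rays:
  assumes "wf_digraph D" "hyperbolic_space (walk_le D) \<delta> h" "finite_out_degrees D"
  shows "boundary_class D (coarse_rays D) (geodesic_rays D)"
proof -
  interpret wf_digraph D by (rule assms(1))
  interpret hyperbolic_space "walk_le D" \<delta> h by (rule assms(2))
  show ?thesis unfolding boundary_class_def
  proof (intro conjI ballI allI)
    show "geodesic_rays D \<subseteq> coarse_rays D"
      unfolding geodesic_rays_eq coarse_rays_def using georay_coarse by blast
  next
    fix X assume "X \<in> coarse_rays D"
    then obtain c where X: "coarse_ray c X" unfolding coarse_rays_def by blast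
    show "proper X" using coarse_ray_proper[OF X] .
    show "reach (X 0) (X i) \<or> reach (X i) (X 0)" for i using coarse_ray_reach[OF X, of 0 i] by simp
    show "\<exists>S\<in>geodesic_rays D. (georay S \<or> anti_georay S) \<and> fellow_travel S X"
      unfolding geodesic_rays_eq
      using coarse_ray_ex_georay[OF finite_out_walk_le[OF assms(3)] X] by blast
  qed
qed

lemma boundary_class_antirays:
  assumes "wf_digraph D" "hyperbolic_space (walk_le D) \<delta> h" "finite_in_degrees D"
  shows "boundary_class D (coarse_antirays D) (geodesic_antirays D)"
proof -
  interpret wf_digraph D by (rule assms(1))
  interpret hyperbolic_space "walk_le D" \<delta> h by (rule assms(2))
  interpret dual: hyperbolic_space "\<lambda>n x y. walk_le D n y x" \<delta> h by (rule dual_hyperbolic_space)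
  show ?thesis unfolding boundary_class_def
  proof (intro conjI ballI allI)
    show "geodesic_antirays D \<subseteq> coarse_antirays D"
      unfolding geodesic_antirays_eq coarse_antirays_def using dual.georay_coarse
      unfolding dual_georay by blast
  next
    fix X assume "X \<in> coarse_antirays D"
    then obtain c where X: "dual.coarse_ray c X" unfolding coarse_antirays_def by blast
    show "proper X" using dual.coarse_ray_proper[OF X] unfolding dual_proper .
    show "reach (X 0) (X i) \<or> reach (X i) (X 0)" for i
      using dual.coarse_ray_reach[OF X, of 0 i] unfolding dual_reach by simp
    show "\<exists>S\<in>geodesic_antirays D. (georay S \<or> anti_georay S) \<and> fellow_travel S X"
      unfolding geodesic_antirays_eq
      using dual.coarse_ray_ex_georay[OF finite_in_walk_le[OF assms(3)] X]
      unfolding dual_georay dual_fellow_travel by blast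
  qed
qed

lemma coarse_rays_embed:
  assumes "wf_digraph D1" "wf_digraph D2" "coarse_embedding (walk_le D1) (walk_le D2) c f"
  shows "X \<in> coarse_rays D1 \<Longrightarrow> f \<circ> X \<in> coarse_rays D2"
    and "X \<in> coarse_antirays D1 \<Longrightarrow> f \<circ> X \<in> coarse_antirays D2"
proof -
  note p = wf_digraph.path_metric_walk_le[OF assms(1)] wf_digraph.path_metric_walk_le[OF assms(2)]
  show "f \<circ> X \<in> coarse_rays D2" if "X \<in> coarse_rays D1"
    using coarse_ray_embed[OF p assms(3)] that unfolding coarse_rays_def by blast
  show "f \<circ> X \<in> coarse_antirays D2" if "X \<in> coarse_antirays D1"
    using coarse_ray_embed[OF p[THEN path_metric.dual_path_metric] coarse_embedding_dual[OF assms(3)]] that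
    unfolding coarse_antirays_def by blast
qed

lemma boundary_class_order:
  assumes "wf_digraph D" "hyperbolic_space (walk_le D) \<delta> h" "boundary_class D C G"
  shows "X \<in> C \<Longrightarrow> Y \<in> C \<Longrightarrow> ray_le D X Y \<longleftrightarrow> path_metric.leads (walk_le D) X Y"
    and "X \<in> C \<Longrightarrow> Y \<in> C \<Longrightarrow> path_metric.fellow_travel (walk_le D) X Y \<Longrightarrow> ray_equiv D X Y"
    and "X \<in> C \<Longrightarrow> ray_le D X X"
    and "X \<in> C \<Longrightarrow> Y \<in> C \<Longrightarrow> Z \<in> C \<Longrightarrow> ray_le D X Y \<Longrightarrow> ray_le D Y Z \<Longrightarrow> ray_le D X Z"
    and "X \<in> C \<Longrightarrow> \<exists>S\<in>G. ray_equiv D S X"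
    and "X \<in> C \<Longrightarrow> walk_le D 0 (X i) (X i)"
proof -
  interpret wf_digraph D by (rule assms(1))
  interpret hyperbolic_space "walk_le D" \<delta> h by (rule assms(2))
  have GC: "G \<subseteq> C" and C: "\<And>X. X \<in> C \<Longrightarrow> proper X"
    "\<And>X i. X \<in> C \<Longrightarrow> reach (X 0) (X i) \<or> reach (X i) (X 0)"
    "\<And>X. X \<in> C \<Longrightarrow> \<exists>S\<in>G. (georay S \<or> anti_georay S) \<and> fellow_travel S X"
    using assms(3) unfolding boundary_class_def by blast+
  have le: "ray_le D X Y \<longleftrightarrow> leads X Y" if "X \<in> C" "Y \<in> C" for X Y
    using ray_le_iff_leads C that by blast
  have eq: "ray_equiv D X Y" if "X \<in> C" "Y \<in> C" "fellow_travel X Y" for X Y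
    using le that fellow_travel_leads[OF that(3)] unfolding ray_equiv_def by blast
  have tame: "tame X" if "X \<in> C" for X
    using C(1,3) GC that unfolding tame_def by blast
  show "ray_le D X Y \<longleftrightarrow> leads X Y" if "X \<in> C" "Y \<in> C" using le that .
  show "ray_equiv D X Y" if "X \<in> C" "Y \<in> C" "fellow_travel X Y" using eq that .
  show w: "walk_le D 0 (X i) (X i)" if "X \<in> C" for X i
    using C(2)[OF that, of i] dle_refl unfolding reach_def by blast
  show "ray_le D X X" if "X \<in> C"
  proof -
    have "{i. \<exists>j. walk_le D 0 (X i) (X j)} = UNIV" using w[OF that] by blast
    then have "leads X X" unfolding leads_def by (metis infinite_UNIV_nat)
    then show ?thesis using le that by blast
  qed
  show "ray_le D X Z" if "X \<in> C" "Y \<in> C" "Z \<in> C" "ray_le D X Y" "ray_le D Y Z"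
    using leads_trans tame that le by blast
  show "\<exists>S\<in>G. ray_equiv D S X" if "X \<in> C" using C(3)[OF that] eq GC that by blast
qed

text \<open>
  The conclusion leaves \<open>A\<close> and \<open>Qs\<close> open because for the full boundary one map has to be canonical
  for rays and for anti-rays.
\<close>

lemma canonical_boundary_map:
  assumes wf1: "wf_digraph D1" and wf2: "wf_digraph D2"
    and hs1: "hyperbolic_space (walk_le D1) \<delta>1 h1" and hs2: "hyperbolic_space (walk_le D2) \<delta>2 h2"
    and bc1: "boundary_class D1 C1 G1" and bc2: "boundary_class D2 C2 G2"
    and f: "coarse_embedding (walk_le D1) (walk_le D2) c f"
    and fg: "\<forall>y\<in>verts D2. walk_le D2 c (f (g y)) y \<and> walk_le D2 c y (f (g y))"
    and f_class: "\<forall>X\<in>C1. f \<circ> X \<in> C2" and g_class: "\<forall>Y\<in>C2. g \<circ> Y \<in> C1"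
  shows "\<exists>\<Phi>. (\<forall>A Qs. A \<subseteq> G1 \<and> Qs \<subseteq> C2 \<and> (\<forall>R\<in>A. \<exists>Q\<in>Qs. follows D2 Q (f ` range R)) \<longrightarrow>
      canonical_on D1 D2 f A G1 Qs G2 \<Phi>) \<and>
    bij_betw \<Phi> (boundary_of D1 G1) (boundary_of D2 G2) \<and>
    monotone_on (boundary_of D1 G1) (boundary_le D1) (boundary_le D2) \<Phi>"
proof -
  interpret D1: wf_digraph D1 by (rule wf1)
  interpret D2: wf_digraph D2 by (rule wf2)
  note fC = bspec[OF f_class] and gC = bspec[OF g_class]
  note o1 = boundary_class_order[OF wf1 hs1 bc1] and o2 = boundary_class_order[OF wf2 hs2 bc2]
  have G1: "G1 \<subseteq> C1" and G2: "G2 \<subseteq> C2" using bc1 bc2 unfolding boundary_class_def by blast+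
  have emb: "ray_le D2 (f \<circ> X) (f \<circ> Y) \<longleftrightarrow> ray_le D1 X Y" if "X \<in> C1" "Y \<in> C1" for X Y
    using leads_embed[OF D1.path_metric_walk_le D2.path_metric_walk_le f, of X Y] o1(6)[OF that(1)]
      o1(6)[OF that(2)] o1(1)[OF that] o2(1)[OF fC[OF that(1)] fC[OF that(2)]] by simp
  have onto: "\<exists>X\<in>C1. ray_equiv D2 (f \<circ> X) Y" if Y: "Y \<in> C2" for Y
  proof -
    have "Y i \<in> verts D2" for i using o2(6)[OF Y, of i] D2.walk_le_verts by blast
    then have "walk_le D2 c ((f \<circ> (g \<circ> Y)) i) (Y i) \<and> walk_le D2 c (Y i) ((f \<circ> (g \<circ> Y)) i)" for i
      using fg by simp
    then have "D2.fellow_travel (f \<circ> (g \<circ> Y)) Y" unfolding D2.fellow_travel_def by blast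
    then show ?thesis using o2(2)[OF fC[OF gC[OF Y]] Y] gC[OF Y] by blast
  qed
  have "\<exists>\<Phi>. (\<forall>R\<in>G1. \<Phi> (equiv_on D1 G1 `` {R}) = {S \<in> G2. ray_equiv D2 S (f \<circ> R)}) \<and>
      bij_betw \<Phi> (boundary_of D1 G1) (boundary_of D2 G2) \<and>
      monotone_on (boundary_of D1 G1) (boundary_le D1) (boundary_le D2) \<Phi>"
  proof (rule boundary_map_of_order_embedding)
    show "ray_le D1 X X" if "X \<in> C1" for X using o1(3)[OF that] .
    show "ray_le D1 X Z" if "X \<in> C1" "Y \<in> C1" "Z \<in> C1" "ray_le D1 X Y" "ray_le D1 Y Z" for X Y Z
      using o1(4)[OF that] .
    show "ray_le D2 X X" if "X \<in> C2" for X using o2(3)[OF that] .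
    show "ray_le D2 X Z" if "X \<in> C2" "Y \<in> C2" "Z \<in> C2" "ray_le D2 X Y" "ray_le D2 Y Z" for X Y Z
      using o2(4)[OF that] .
    show "\<exists>S\<in>G1. ray_equiv D1 S X" if "X \<in> C1" for X using o1(5)[OF that] .
    show "\<exists>S\<in>G2. ray_equiv D2 S X" if "X \<in> C2" for X using o2(5)[OF that] .
    show "f \<circ> X \<in> C2" if "X \<in> C1" for X using fC[OF that] .
    show "ray_le D2 (f \<circ> X) (f \<circ> Y) \<longleftrightarrow> ray_le D1 X Y" if "X \<in> C1" "Y \<in> C1" for X Y
      using emb[OF that] .
    show "\<exists>X\<in>C1. ray_equiv D2 (f \<circ> X) Y" if "Y \<in> C2" for Y using onto[OF that] .
  qed (rule G1 G2)+
  then obtain \<Phi> where \<Phi>: "\<forall>R\<in>G1. \<Phi> (equiv_on D1 G1 `` {R}) = {S \<in> G2. ray_equiv D2 S (f \<circ> R)}"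
    "bij_betw \<Phi> (boundary_of D1 G1) (boundary_of D2 G2)"
    "monotone_on (boundary_of D1 G1) (boundary_le D1) (boundary_le D2) \<Phi>"
    by (elim exE conjE)
  have eq: "{S \<in> G2. ray_equiv D2 S (f \<circ> R)} = {S \<in> G2. ray_equiv D2 S Q}"
    if that: "R \<in> G1" "Q \<in> C2" "follows D2 Q (f ` range R)" for R Q
  proof -
    have fR: "f \<circ> R \<in> C2" using fC G1 that(1) by blast
    have "follows D2 Q (range (f \<circ> R))" using that(3) by (simp only: image_comp)
    then have e: "ray_equiv D2 Q (f \<circ> R)" using D2.follows_iff_fellow_travel o2(2)[OF that(2) fR] by blast
    have "ray_equiv D2 S (f \<circ> R) \<longleftrightarrow> ray_equiv D2 S Q" if S: "S \<in> C2" for S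
      using o2(4)[OF S fR \<open>Q \<in> C2\<close>] o2(4)[OF S \<open>Q \<in> C2\<close> fR] o2(4)[OF \<open>Q \<in> C2\<close> fR S]
        o2(4)[OF fR \<open>Q \<in> C2\<close> S] e unfolding ray_equiv_def by blast
    then show ?thesis using G2 by blast
  qed
  have "\<forall>R\<in>G1. \<forall>Q\<in>C2. follows D2 Q (f ` range R) \<longrightarrow>
      \<Phi> (equiv_on D1 G1 `` {R}) = {S \<in> G2. ray_equiv D2 S Q}"
  proof (intro ballI impI)
    fix R Q assume R: "R \<in> G1" and Q: "Q \<in> C2" "follows D2 Q (f ` range R)"
    show "\<Phi> (equiv_on D1 G1 `` {R}) = {S \<in> G2. ray_equiv D2 S Q}"
      using bspec[OF \<Phi>(1) R] eq[OF R Q] by (rule trans)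
  qed
  then have "canonical_on D1 D2 f A G1 Qs G2 \<Phi>"
    if "A \<subseteq> G1 \<and> Qs \<subseteq> C2 \<and> (\<forall>R\<in>A. \<exists>Q\<in>Qs. follows D2 Q (f ` range R))" for A Qs
    using that unfolding canonical_on_def by (simp add: subset_iff)
  then show ?thesis using \<Phi>(2,3) by (intro exI conjI allI impI)
qed

lemma ex_following_quasi_geodesic_ray:
  assumes "wf_digraph D" "hyperbolic_space (walk_le D) \<delta> h" "X \<in> coarse_rays D"
  shows "\<exists>Q\<in>quasi_geodesic_rays D. follows D Q (range X)"
proof -
  interpret wf_digraph D by (rule assms(1))
  interpret hyperbolic_space "walk_le D" \<delta> h by (rule assms(2))
  show ?thesis
    using assms(3) coarse_ray_refine quasi_ray_quasi_geodesic follows_iff_fellow_travel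
    unfolding coarse_rays_def by blast
qed

lemma ex_following_quasi_geodesic_antiray:
  assumes "wf_digraph D" "hyperbolic_space (walk_le D) \<delta> h" "X \<in> coarse_antirays D"
  shows "\<exists>Q\<in>quasi_geodesic_antirays D. follows D Q (range X)"
proof -
  interpret wf_digraph D by (rule assms(1))
  interpret hyperbolic_space "walk_le D" \<delta> h by (rule assms(2))
  interpret dual: hyperbolic_space "\<lambda>n x y. walk_le D n y x" \<delta> h by (rule dual_hyperbolic_space)
  obtain c where X: "dual.coarse_ray c X" using assms(3) unfolding coarse_antirays_def by blast
  obtain c' Q where Q: "dual.quasi_ray c' Q" "inj Q" "fellow_travel Q X"
    using dual.coarse_ray_refine[OF X] unfolding dual_fellow_travel by blast
  show ?thesis
    using dual_quasi_ray_quasi_geodesic[OF Q(1,2)] Q(3) follows_iff_fellow_travel by blast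
qed

theorem theorem5p5:
  fixes D1 :: "('a, 'b) pre_digraph" and D2 :: "('c, 'd) pre_digraph" and f :: "'a \<Rightarrow> 'c"
  assumes "wf_digraph D1" and "wf_digraph D2"
    and "hyperbolic D1" and "hyperbolic D2"
    and "B1 D1" and "B2 D1" and "B1 D2" and "B2 D2"
    and "quasi_isometry D1 D2 f"
  shows "(finite_out_degrees D1 \<and> finite_out_degrees D2 \<longrightarrow>
           (\<exists>\<Phi>. canonical_f D1 D2 f \<Phi> \<and>
                bij_betw \<Phi> (geodesic_f_boundary D1) (geodesic_f_boundary D2) \<and>
                monotone_on (geodesic_f_boundary D1) (boundary_le D1) (boundary_le D2) \<Phi>)) \<and>
         (finite_in_degrees D1 \<and> finite_in_degrees D2 \<longrightarrow>
           (\<exists>\<Phi>. canonical_b D1 D2 f \<Phi> \<and>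
                bij_betw \<Phi> (geodesic_b_boundary D1) (geodesic_b_boundary D2) \<and>
                monotone_on (geodesic_b_boundary D1) (boundary_le D1) (boundary_le D2) \<Phi>)) \<and>
         (locally_finite_digraph D1 \<and> locally_finite_digraph D2 \<longrightarrow>
           (\<exists>\<Phi>. canonical_fb D1 D2 f \<Phi> \<and>
                bij_betw \<Phi> (geodesic_boundary D1) (geodesic_boundary D2) \<and>
                monotone_on (geodesic_boundary D1) (boundary_le D1) (boundary_le D2) \<Phi>))"
proof -
  interpret D1: wf_digraph D1 by (rule assms(1))
  interpret D2: wf_digraph D2 by (rule assms(2))
  obtain \<delta>1 h1 where hs1: "hyperbolic_space (walk_le D1) \<delta>1 h1"
    using D1.hyperbolic_space_walk_le[OF assms(3,5,6)] by blast
  obtain \<delta>2 h2 where hs2: "hyperbolic_space (walk_le D2) \<delta>2 h2"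
    using D2.hyperbolic_space_walk_le[OF assms(4,7,8)] by blast
  obtain c g where f: "coarse_embedding (walk_le D1) (walk_le D2) c f"
    and g: "coarse_embedding (walk_le D2) (walk_le D1) c g"
    and fg: "\<forall>y\<in>verts D2. walk_le D2 c (f (g y)) y \<and> walk_le D2 c y (f (g y))"
    using quasi_isometry_coarse[OF assms(1,2,9)] by blast
  note fC = coarse_rays_embed[OF assms(1,2) f] and gC = coarse_rays_embed[OF assms(2,1) g]
  note map = canonical_boundary_map[OF assms(1,2) hs1 hs2 _ _ f fg]
  have Qf: "quasi_geodesic_rays D2 \<subseteq> coarse_rays D2"
    using D2.quasi_geodesic_rays_coarse unfolding coarse_rays_def by blast
  have Qb: "quasi_geodesic_antirays D2 \<subseteq> coarse_antirays D2"
    using D2.quasi_geodesic_antirays_coarse unfolding coarse_antirays_def by blast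
  have exf: "\<exists>Q\<in>quasi_geodesic_rays D2. follows D2 Q (f ` range R)" if "R \<in> coarse_rays D1" for R
    using ex_following_quasi_geodesic_ray[OF assms(2) hs2 fC(1)[OF that]] by (simp only: image_comp)
  have exb: "\<exists>Q\<in>quasi_geodesic_antirays D2. follows D2 Q (f ` range R)" if "R \<in> coarse_antirays D1" for R
    using ex_following_quasi_geodesic_antiray[OF assms(2) hs2 fC(2)[OF that]] by (simp only: image_comp)
  have fA: "\<forall>X\<in>coarse_rays D1. f \<circ> X \<in> coarse_rays D2"
    "\<forall>X\<in>coarse_antirays D1. f \<circ> X \<in> coarse_antirays D2" using fC by blast+
  have gA: "\<forall>Y\<in>coarse_rays D2. g \<circ> Y \<in> coarse_rays D1"
    "\<forall>Y\<in>coarse_antirays D2. g \<circ> Y \<in> coarse_antirays D1" using gC by blast+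
  note bf1 = boundary_class_rays[OF assms(1) hs1] and bf2 = boundary_class_rays[OF assms(2) hs2]
  note bb1 = boundary_class_antirays[OF assms(1) hs1] and bb2 = boundary_class_antirays[OF assms(2) hs2]
  have sub: "G \<subseteq> C" if "boundary_class D C G" for D :: "('e, 'g) pre_digraph" and C G
    using that unfolding boundary_class_def by blast
  have Gf: "geodesic_rays D1 \<subseteq> coarse_rays D1" if "finite_out_degrees D1" using sub[OF bf1[OF that]] .
  have Gb: "geodesic_antirays D1 \<subseteq> coarse_antirays D1" if "finite_in_degrees D1" using sub[OF bb1[OF that]] .
  show ?thesis
  proof (intro conjI impI; elim conjE)
    assume fin: "finite_out_degrees D1" "finite_out_degrees D2"
    have "\<forall>R\<in>geodesic_rays D1. \<exists>Q\<in>quasi_geodesic_rays D2. follows D2 Q (f ` range R)"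
      using exf Gf[OF fin(1)] by blast
    then show "\<exists>\<Phi>. canonical_f D1 D2 f \<Phi> \<and>
                bij_betw \<Phi> (geodesic_f_boundary D1) (geodesic_f_boundary D2) \<and>
                monotone_on (geodesic_f_boundary D1) (boundary_le D1) (boundary_le D2) \<Phi>"
      using map[OF bf1[OF fin(1)] bf2[OF fin(2)] fA(1) gA(1)] Qf by (elim exE conjE) (intro exI conjI; simp)
  next
    assume fin: "finite_in_degrees D1" "finite_in_degrees D2"
    have "\<forall>R\<in>geodesic_antirays D1. \<exists>Q\<in>quasi_geodesic_antirays D2. follows D2 Q (f ` range R)"
      using exb Gb[OF fin(1)] by blast
    then show "\<exists>\<Phi>. canonical_b D1 D2 f \<Phi> \<and>
                bij_betw \<Phi> (geodesic_b_boundary D1) (geodesic_b_boundary D2) \<and>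
                monotone_on (geodesic_b_boundary D1) (boundary_le D1) (boundary_le D2) \<Phi>"
      using map[OF bb1[OF fin(1)] bb2[OF fin(2)] fA(2) gA(2)] Qb by (elim exE conjE) (intro exI conjI; simp)
  next
    assume "locally_finite_digraph D1" "locally_finite_digraph D2"
    then have fin: "finite_out_degrees D1" "finite_out_degrees D2" "finite_in_degrees D1" "finite_in_degrees D2"
      unfolding locally_finite_digraph_def by blast+
    let ?C1 = "coarse_rays D1 \<union> coarse_antirays D1" and ?C2 = "coarse_rays D2 \<union> coarse_antirays D2"
    have fU: "\<forall>X\<in>?C1. f \<circ> X \<in> ?C2" and gU: "\<forall>Y\<in>?C2. g \<circ> Y \<in> ?C1" using fC gC by blast+
    have "\<forall>R\<in>geodesic_rays D1. \<exists>Q\<in>quasi_geodesic_rays D2. follows D2 Q (f ` range R)"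
      "\<forall>R\<in>geodesic_antirays D1. \<exists>Q\<in>quasi_geodesic_antirays D2. follows D2 Q (f ` range R)"
      using exf exb Gf[OF fin(1)] Gb[OF fin(3)] by blast+
    moreover have "quasi_geodesic_rays D2 \<subseteq> ?C2" "quasi_geodesic_antirays D2 \<subseteq> ?C2" using Qf Qb by blast+
    ultimately show "\<exists>\<Phi>. canonical_fb D1 D2 f \<Phi> \<and>
                bij_betw \<Phi> (geodesic_boundary D1) (geodesic_boundary D2) \<and>
                monotone_on (geodesic_boundary D1) (boundary_le D1) (boundary_le D2) \<Phi>"
      using map[OF boundary_class_Un[OF bf1[OF fin(1)] bb1[OF fin(3)]]
          boundary_class_Un[OF bf2[OF fin(2)] bb2[OF fin(4)]] fU gU]
      by (elim exE conjE) (intro exI conjI; simp)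
  qed
qed

end
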